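(* Let $G$ be a locally compact group and let $\alpha$ and $\beta$ be strongly continuous actions of $G$ on $C^*$-algebras $A$ and $B$ respectively. Suppose $\beta$ is proper and there is an equivariant morphism $\theta$ from $B$ to $A$. Then $\alpha$ is proper.
   Context: A morphism from $B$ to $A$ is a $*$-homomorphism $\theta:B\to M(A)$ (the multiplier algebra) such that $\theta(B)A$ is dense in $A$; it is equivariant if $\theta(\beta_x(b))=\alpha_x(\theta(b))$ for all $x\in G$, $b\in B$, where $\alpha$ is extended to $M(A)$. With a fixed left Haar measure on $G$, let $\mathcal B$ be the set of $\lambda\in L^\infty(G)$ with compact support and $0\le\lambda\le1$, directed pointwise; for an action $\gamma$ on a $C^*$-algebra $C$ put $p_\lambda(c)=\int\lambda(x)\gamma_x(c)\,dx$. An element $c\in C^+$ is $\gamma$-proper if $(p_\lambda(c))_{\lambda\in\mathcal B}$ converges in the strict topology of $M(C)$; $\gamma$ is proper if the linear span of the $\gamma$-proper elements is dense in $C$. *)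

theory Defs
  imports "HOL-Analysis.Analysis"
begin

class cstar_algebra = banach + real_normed_algebra +
  fixes cscale :: "complex \<Rightarrow> 'a \<Rightarrow> 'a"
    and cadj :: "'a \<Rightarrow> 'a"
  assumes cscale_of_real: "cscale (complex_of_real r) x = r *\<^sub>R x"
    and cscale_add_left: "cscale (a + b) x = cscale a x + cscale b x"
    and cscale_add_right: "cscale a (x + y) = cscale a x + cscale a y"
    and cscale_cscale: "cscale a (cscale b x) = cscale (a * b) x"
    and norm_cscale: "norm (cscale a x) = cmod a * norm x"
    and cscale_mult_left: "cscale a x * y = cscale a (x * y)"
    and cscale_mult_right: "x * cscale a y = cscale a (x * y)"
    and cadj_cadj: "cadj (cadj x) = x"
    and cadj_add: "cadj (x + y) = cadj x + cadj y"
    and cadj_cscale: "cadj (cscale a x) = cscale (cnj a) (cadj x)"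
    and cadj_mult: "cadj (x * y) = cadj y * cadj x"
    and cstar_identity: "norm (cadj x * x) = (norm x)\<^sup>2"

definition cpositive :: "'a::cstar_algebra \<Rightarrow> bool" where
  "cpositive c \<longleftrightarrow> (\<exists>x. c = cadj x * x)"

definition cspan :: "'a::cstar_algebra set \<Rightarrow> 'a set" where
  "cspan S = {x. \<exists>T c. finite T \<and> T \<subseteq> S \<and> x = (\<Sum>v\<in>T. cscale (c v) v)}"

definition star_hom :: "('a::cstar_algebra \<Rightarrow> 'b::cstar_algebra) \<Rightarrow> bool" where
  "star_hom f \<longleftrightarrow> (\<forall>x y. f (x + y) = f x + f y) \<and> (\<forall>a x. f (cscale a x) = cscale a (f x))
     \<and> (\<forall>x y. f (x * y) = f x * f y) \<and> (\<forall>x. f (cadj x) = cadj (f x))"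

definition star_aut :: "('a::cstar_algebra \<Rightarrow> 'a) \<Rightarrow> bool" where
  "star_aut f \<longleftrightarrow> star_hom f \<and> bij f"

text \<open>An element of \<open>M(A)\<close> is a double centralizer \<open>(L, R)\<close>: \<open>R(x) y = x L(y)\<close>.\<close>
type_synonym 'a mult = "('a \<Rightarrow> 'a) \<times> ('a \<Rightarrow> 'a)"

definition double_centralizer :: "'a::cstar_algebra mult \<Rightarrow> bool" where
  "double_centralizer m \<longleftrightarrow> (\<forall>x y. snd m x * y = x * fst m y)"

definition mult_of :: "'a::cstar_algebra \<Rightarrow> 'a mult" where
  "mult_of c = ((\<lambda>x. c * x), (\<lambda>x. x * c))"

definition mult_add :: "'a::cstar_algebra mult \<Rightarrow> 'a mult \<Rightarrow> 'a mult" where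
  "mult_add m n = ((\<lambda>x. fst m x + fst n x), (\<lambda>x. snd m x + snd n x))"

definition mult_scale :: "complex \<Rightarrow> 'a::cstar_algebra mult \<Rightarrow> 'a mult" where
  "mult_scale a m = ((\<lambda>x. cscale a (fst m x)), (\<lambda>x. cscale a (snd m x)))"

definition mult_mult :: "'a::cstar_algebra mult \<Rightarrow> 'a mult \<Rightarrow> 'a mult" where
  "mult_mult m n = (fst m \<circ> fst n, snd n \<circ> snd m)"

definition mult_adj :: "'a::cstar_algebra mult \<Rightarrow> 'a mult" where
  "mult_adj m = ((\<lambda>x. cadj (snd m (cadj x))), (\<lambda>x. cadj (fst m (cadj x))))"

definition strict_tendsto :: "('i \<Rightarrow> 'a::cstar_algebra mult) \<Rightarrow> 'a mult \<Rightarrow> 'i filter \<Rightarrow> bool" where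
  "strict_tendsto f m F \<longleftrightarrow>
     (\<forall>x. ((\<lambda>i. fst (f i) x) \<longlongrightarrow> fst m x) F \<and> ((\<lambda>i. snd (f i) x) \<longlongrightarrow> snd m x) F)"

definition cstar_morphism :: "('b::cstar_algebra \<Rightarrow> 'a::cstar_algebra mult) \<Rightarrow> bool" where
  "cstar_morphism \<theta> \<longleftrightarrow>
     (\<forall>b. double_centralizer (\<theta> b))
     \<and> (\<forall>b1 b2. \<theta> (b1 + b2) = mult_add (\<theta> b1) (\<theta> b2))
     \<and> (\<forall>a b. \<theta> (cscale a b) = mult_scale a (\<theta> b))
     \<and> (\<forall>b1 b2. \<theta> (b1 * b2) = mult_mult (\<theta> b1) (\<theta> b2))
     \<and> (\<forall>b. \<theta> (cadj b) = mult_adj (\<theta> b))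
     \<and> closure (cspan {fst (\<theta> b) x | b x. True}) = UNIV"

definition mult_ext :: "('a::cstar_algebra \<Rightarrow> 'a) \<Rightarrow> 'a mult \<Rightarrow> 'a mult" where
  "mult_ext f m = (f \<circ> fst m \<circ> inv f, f \<circ> snd m \<circ> inv f)"

text \<open>A left Haar measure on a locally compact Hausdorff group (written additively; not
necessarily commutative): a nonzero left-invariant Radon measure on the Borel sets.\<close>
definition left_haar_measure :: "'g::{topological_group_add, t2_space} measure \<Rightarrow> bool" where
  "left_haar_measure \<mu> \<longleftrightarrow>
     sets \<mu> = sets borel
     \<and> (\<forall>K. compact K \<longrightarrow> emeasure \<mu> K < \<infinity>)
     \<and> (\<forall>U. open U \<and> U \<noteq> {} \<longrightarrow> emeasure \<mu> U > 0)
     \<and> (\<forall>g A. A \<in> sets borel \<longrightarrow> emeasure \<mu> ((+) g ` A) = emeasure \<mu> A)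
     \<and> (\<forall>A \<in> sets borel. emeasure \<mu> A = (INF U \<in> {U. open U \<and> A \<subseteq> U}. emeasure \<mu> U))
     \<and> (\<forall>U. open U \<longrightarrow> emeasure \<mu> U = (SUP K \<in> {K. compact K \<and> K \<subseteq> U}. emeasure \<mu> K))"

definition cstar_action :: "('g::{topological_group_add, t2_space} \<Rightarrow> 'a::cstar_algebra \<Rightarrow> 'a) \<Rightarrow> bool" where
  "cstar_action \<alpha> \<longleftrightarrow>
     (\<forall>x. star_aut (\<alpha> x)) \<and> \<alpha> 0 = id \<and> (\<forall>x y. \<alpha> (x + y) = \<alpha> x \<circ> \<alpha> y)
     \<and> (\<forall>a. continuous_on UNIV (\<lambda>x. \<alpha> x a))"

definition equivariant :: "('g \<Rightarrow> 'a::cstar_algebra \<Rightarrow> 'a) \<Rightarrow> ('g \<Rightarrow> 'b::cstar_algebra \<Rightarrow> 'b)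
    \<Rightarrow> ('b \<Rightarrow> 'a mult) \<Rightarrow> bool" where
  "equivariant \<alpha> \<beta> \<theta> \<longleftrightarrow> (\<forall>x b. \<theta> (\<beta> x b) = mult_ext (\<alpha> x) (\<theta> b))"

definition cutoffs :: "('g::{topological_group_add, t2_space} \<Rightarrow> real) set" where
  "cutoffs = {l. l \<in> borel_measurable borel \<and> (\<exists>K. compact K \<and> (\<forall>x. x \<notin> K \<longrightarrow> l x = 0))
                 \<and> (\<forall>x. 0 \<le> l x \<and> l x \<le> 1)}"

definition cutoff_filter :: "('g::{topological_group_add, t2_space} \<Rightarrow> real) filter" where
  "cutoff_filter = (INF l0 \<in> cutoffs. principal {l \<in> cutoffs. l0 \<le> l})"

definition weak_integral :: "'g measure \<Rightarrow> ('g \<Rightarrow> 'a::real_normed_vector) \<Rightarrow> 'a" where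
  "weak_integral \<mu> f = (THE I. \<forall>\<phi>::'a \<Rightarrow> real. bounded_linear \<phi> \<longrightarrow>
       integrable \<mu> (\<lambda>x. \<phi> (f x)) \<and> \<phi> I = integral\<^sup>L \<mu> (\<lambda>x. \<phi> (f x)))"

definition p_avg :: "'g::{topological_group_add, t2_space} measure \<Rightarrow> ('g \<Rightarrow> 'a::cstar_algebra \<Rightarrow> 'a)
    \<Rightarrow> ('g \<Rightarrow> real) \<Rightarrow> 'a \<Rightarrow> 'a" where
  "p_avg \<mu> \<gamma> l c = weak_integral \<mu> (\<lambda>x. l x *\<^sub>R \<gamma> x c)"

definition proper_elem :: "'g::{topological_group_add, t2_space} measure \<Rightarrow> ('g \<Rightarrow> 'a::cstar_algebra \<Rightarrow> 'a)
    \<Rightarrow> 'a \<Rightarrow> bool" where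
  "proper_elem \<mu> \<gamma> c \<longleftrightarrow> cpositive c \<and>
     (\<exists>m. double_centralizer m \<and> strict_tendsto (\<lambda>l. mult_of (p_avg \<mu> \<gamma> l c)) m cutoff_filter)"

definition proper_action :: "'g::{topological_group_add, t2_space} measure \<Rightarrow> ('g \<Rightarrow> 'a::cstar_algebra \<Rightarrow> 'a)
    \<Rightarrow> bool" where
  "proper_action \<mu> \<gamma> \<longleftrightarrow> closure (cspan {c. proper_elem \<mu> \<gamma> c}) = UNIV"

end

(* A positive element of B has the form y* y. If y* y is proper, then for w = a theta(y) the
   averages of w* w are dominated by a multiple of those of theta(y* y). Hence the quadratic forms
   d* p(w* w) d are bounded and Cauchy along the cutoffs, which for positive elements amounts to
   strict convergence of p(w* w). The w whose forms behave in this way make up a dense subspace of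
   A, and by polarization the squares w* w span a dense subspace of A A = A.

   Positivity is obtained without spectral theory: square roots come from the iteration
   g -> (h + g^2) / 2, and norm estimates replace spectra. *)
theory Submission
  imports Defs
begin


text \<open>The order of the factors in \<open>w = a \<theta>(y)\<close> is essential:
  \<open>cadj a * a\<close> then sits inside \<open>cadj w * w\<close>, where one multiple of the
  unit dominates all its translates. In \<open>\<theta>(y) a\<close> the element \<open>a\<close>
  would stand outside, and nothing would absorb its translates.

  The averages form a net, and a convergent net need not be bounded. Here the forms grow with the
  cutoff, because the difference of comparable cutoffs is again a cutoff. Convergence therefore
  bounds each form over all cutoffs, and uniform boundedness, applied to operators whose squared
  norms are the forms, gives one bound for all averages. That bound extends the Cauchy property from
  a dense set of vectors to all of \<open>A\<close>, and it is also one factor in the Cauchy-Schwarz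
  estimate behind strict convergence.

  The algebras need not have units. Order arguments take place in the multipliers, which are made a
  type of class \<open>cstar_algebra\<close> with a unit; \<open>g + g - g * g = h\<close> states
  \<open>(1 - g)^2 = 1 - h\<close> without one and is also solved directly in \<open>A\<close> and
  \<open>B\<close>.\<close>

section \<open>Elementary consequences of the C*-algebra axioms\<close>

lemma cscale_1 [simp]: "cscale 1 x = (x::'a::cstar_algebra)"
  using cscale_of_real[of 1 x] by simp

lemma cscale_0_left [simp]: "cscale 0 x = (0::'a::cstar_algebra)"
  using cscale_of_real[of 0 x] by simp

lemma cscale_0_right [simp]: "cscale a 0 = (0::'a::cstar_algebra)"
  using norm_cscale[of a "0::'a"] by simp

lemma cscale_minus_left: "cscale (- a) x = - cscale a (x::'a::cstar_algebra)"
  using cscale_add_left[of "a" "-a" x] by (simp add: eq_neg_iff_add_eq_0 add.commute)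

lemma cscale_minus_right: "cscale a (- x) = - cscale a (x::'a::cstar_algebra)"
  using cscale_add_right[of a x "-x"] by (simp add: eq_neg_iff_add_eq_0 add.commute)

lemma cscale_diff_right: "cscale a (x - y) = cscale a x - cscale a (y::'a::cstar_algebra)"
  using cscale_add_right[of a x "-y"] by (simp add: cscale_minus_right)

lemma cscale_scaleR: "cscale a (r *\<^sub>R x) = r *\<^sub>R cscale a (x::'a::cstar_algebra)"
  by (simp add: cscale_of_real[symmetric] cscale_cscale mult.commute)

lemma bounded_linear_cscale: "bounded_linear (cscale a :: 'a::cstar_algebra \<Rightarrow> 'a)"
  by (rule bounded_linear_intro[where K = "cmod a"])
     (simp_all add: cscale_add_right cscale_scaleR norm_cscale mult.commute)

lemma cadj_0 [simp]: "cadj 0 = (0::'a::cstar_algebra)"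
  using cadj_add[of "0::'a" 0] by simp

lemma cadj_minus: "cadj (- x) = - cadj (x::'a::cstar_algebra)"
  using cadj_add[of x "-x"] by (simp add: eq_neg_iff_add_eq_0 add.commute)

lemma cadj_diff: "cadj (x - y) = cadj x - cadj (y::'a::cstar_algebra)"
  using cadj_add[of x "-y"] by (simp add: cadj_minus)

lemma cadj_scaleR: "cadj (r *\<^sub>R x) = r *\<^sub>R cadj (x::'a::cstar_algebra)"
  using cadj_cscale[of "complex_of_real r" x] by (simp add: cscale_of_real)

text \<open>Isometry of the involution is not an axiom. The C*-identity gives
  \<open>(norm y)^2 <= norm (cadj y) * norm y\<close>, used for \<open>x\<close> and for its
  adjoint.\<close>

lemma norm_cadj [simp]: "norm (cadj x) = norm (x::'a::cstar_algebra)"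
proof -
  have "norm y \<le> norm (cadj y)" for y :: 'a
  proof (cases "y = 0")
    case False
    have "norm y * norm y \<le> norm (cadj y) * norm y"
      using norm_mult_ineq[of "cadj y" y] by (simp add: cstar_identity power2_eq_square)
    then show ?thesis using False by simp
  qed simp
  from this[of x] this[of "cadj x"] show ?thesis by (simp add: cadj_cadj)
qed

lemma bounded_linear_cadj: "bounded_linear (cadj :: 'a::cstar_algebra \<Rightarrow> 'a)"
  by (rule bounded_linear_intro[where K = 1]) (simp_all add: cadj_add cadj_scaleR)

lemmas tendsto_cadj = bounded_linear.tendsto[OF bounded_linear_cadj]

lemma norm_mult_cadj: "norm (x * cadj x) = (norm (x::'a::cstar_algebra))\<^sup>2"
  using cstar_identity[of "cadj x"] by (simp add: cadj_cadj)

lemma norm_square_selfadj: "cadj k = k \<Longrightarrow> norm (k * k) = (norm (k::'a::cstar_algebra))\<^sup>2"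
  using cstar_identity[of k] by simp

text \<open>Tested at \<open>y = cadj x\<close>. Such faithfulness of multiplication stands in for
  evaluation at a unit.\<close>

lemma cstar_eq_0I_right: "(\<And>y. x * y = 0) \<Longrightarrow> x = (0::'a::cstar_algebra)"
  using norm_mult_cadj[of x] by simp

lemma cstar_eqI_right: "(\<And>y. x * y = x' * y) \<Longrightarrow> x = (x'::'a::cstar_algebra)"
  using cstar_eq_0I_right[of "x - x'"] by (simp add: left_diff_distrib)

lemma cstar_eqI_left:
  assumes "\<And>y. y * x = y * (x'::'a::cstar_algebra)"
  shows "x = x'"
proof -
  have "cadj x * y = cadj x' * y" for y
    using arg_cong[OF assms[of "cadj y"], of cadj] by (simp add: cadj_mult cadj_cadj)
  then have "cadj x = cadj x'" by (rule cstar_eqI_right)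
  then show ?thesis by (metis cadj_cadj)
qed

subsection \<open>Square roots\<close>

text \<open>The equation \<open>2 g - g\<^sup>2 = h\<close> reads \<open>(1 - g)\<^sup>2 = 1 - h\<close>; it makes sense without a unit.
The increments of the iteration \<open>g \<mapsto> (h + g\<^sup>2) / 2\<close> are dominated by those for \<open>h = 1\<close> in
the reals, where the iteration is monotone and bounded.\<close>
lemma selfadj_sqrt_iteration:
  fixes h :: "'a::cstar_algebra"
  assumes nh: "norm h \<le> 1" and sa: "cadj h = h"
  shows "\<exists>g. g + g - g * g = h \<and> cadj g = g \<and> norm g \<le> 1 \<and> (\<forall>z. z * h = h * z \<longrightarrow> z * g = g * z)"
proof -
  define g where "g = rec_nat (0::'a) (\<lambda>_ x. (1/2) *\<^sub>R (h + x * x))"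
  define G where "G = rec_nat (0::real) (\<lambda>_ x. (1/2) * (1 + x * x))"
  have g0: "g 0 = 0" and gS: "g (Suc n) = (1/2) *\<^sub>R (h + g n * g n)" for n
    by (simp_all add: g_def)
  have G0: "G 0 = 0" and GS: "G (Suc n) = (1/2) * (1 + G n * G n)" for n
    by (simp_all add: G_def)
  have G_bound: "0 \<le> G n \<and> G n \<le> 1" for n
  proof (induction n)
    case (Suc n)
    then have "G n * G n \<le> 1 * 1" by (intro mult_mono) auto
    with Suc show ?case by (simp add: GS)
  qed (simp add: G0)
  \<comment> \<open>Each iterate is a polynomial in \<open>h\<close>, so it commutes with whatever
    commutes with \<open>h\<close>, in particular with the other iterates.\<close>
  have g_comm: "z * g n = g n * z" if "z * h = h * z" for z n
  proof (induction n)
    case (Suc n)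
    have "z * (g n * g n) = g n * g n * z"
      using Suc by (metis mult.assoc)
    then show ?case by (simp add: gS that algebra_simps)
  qed (simp add: g0)
  have g_sa: "cadj (g n) = g n" for n
    by (induction n) (simp_all add: g0 gS cadj_scaleR cadj_add cadj_mult sa)
  have gg: "g m * g n = g n * g m" for m n
    by (rule g_comm, rule g_comm[symmetric], rule refl)
  have g_norm: "norm (g n) \<le> G n" for n
  proof (induction n)
    case (Suc n)
    have "norm (g n * g n) \<le> G n * G n"
      by (rule order_trans[OF norm_mult_ineq]) (intro mult_mono Suc, use G_bound in auto)
    then have "norm (h + g n * g n) \<le> 1 + G n * G n"
      using norm_triangle_ineq[of h "g n * g n"] nh by linarith
    then show ?case by (simp add: gS GS)
  qed (simp add: g0 G0)
  have inc: "norm (g (Suc n) - g n) \<le> G (Suc n) - G n" for n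
  proof (induction n)
    case 0
    then show ?case using nh by (simp add: gS g0 GS G0)
  next
    case (Suc n)
    have "g (Suc (Suc n)) - g (Suc n) = (1/2) *\<^sub>R (g (Suc n) * g (Suc n) - g n * g n)"
      unfolding gS[of "Suc n"] gS[of n] by (simp only: scaleR_diff_right[symmetric]) simp
    \<comment> \<open>The difference of squares factors because the iterates commute.\<close>
    also have "g (Suc n) * g (Suc n) - g n * g n = (g (Suc n) - g n) * (g (Suc n) + g n)"
      using gg[of "Suc n" n] by (simp add: algebra_simps)
    finally have eq: "norm (g (Suc (Suc n)) - g (Suc n))
        = (1/2) * norm ((g (Suc n) - g n) * (g (Suc n) + g n))" by simp
    have "norm ((g (Suc n) - g n) * (g (Suc n) + g n)) \<le> (G (Suc n) - G n) * (G (Suc n) + G n)"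
    proof (rule order_trans[OF norm_mult_ineq], rule mult_mono[OF Suc])
      show "norm (g (Suc n) + g n) \<le> G (Suc n) + G n"
        using norm_triangle_ineq[of "g (Suc n)" "g n"] g_norm[of n] g_norm[of "Suc n"] by linarith
      show "0 \<le> G (Suc n) - G n" using Suc norm_ge_zero order_trans by blast
    qed simp
    also have "(1/2) * ((G (Suc n) - G n) * (G (Suc n) + G n)) = G (Suc (Suc n)) - G (Suc n)"
      unfolding GS[of "Suc n"] GS[of n] by (simp add: algebra_simps)
    finally show ?case using eq by (simp add: algebra_simps)
  qed
  have Ginc: "incseq G"
    by (rule incseq_SucI) (use order_trans[OF norm_ge_zero inc] in simp)
  have "convergent G"
    by (rule Bseq_mono_convergent[OF BseqI'[of G 1]]) (use G_bound Ginc in \<open>auto simp: incseq_def\<close>)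
  \<comment> \<open>The telescoping increments of the convergent sequence \<open>G\<close> are
    summable and majorize those of \<open>g\<close>, so completeness yields a limit.\<close>
  then have "summable (\<lambda>n. G (Suc n) - G n)"
    unfolding convergent_def using telescope_summable by blast
  then have "summable (\<lambda>n. g (Suc n) - g n)"
    by (rule summable_comparison_test') (rule inc)
  then have "convergent (\<lambda>n. \<Sum>k<n. g (Suc k) - g k)"
    by (simp add: summable_iff_convergent)
  then have "convergent g"
    by (simp add: sum_lessThan_telescope g0)
  then obtain l where l: "g \<longlonglongrightarrow> l" by (auto simp: convergent_def)
  have "(\<lambda>n. (1/2) *\<^sub>R (h + g n * g n)) \<longlonglongrightarrow> (1/2) *\<^sub>R (h + l * l)"
    by (intro tendsto_intros l)
  moreover have "(\<lambda>n. g (Suc n)) \<longlonglongrightarrow> l" using l by (rule LIMSEQ_Suc)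
  ultimately have fix_eq: "l = (1/2) *\<^sub>R (h + l * l)"
    using LIMSEQ_unique gS by (metis (no_types, lifting) ext)
  have "l + l = h + l * l"
    using arg_cong[OF fix_eq, of "\<lambda>x. x + x"] by (simp add: scaleR_left.add[symmetric])
  then have 1: "l + l - l * l = h" by simp
  have 2: "cadj l = l"
    using LIMSEQ_unique[OF tendsto_cadj[OF l]] l g_sa by simp
  have 3: "norm l \<le> 1"
    by (rule Lim_bounded[OF tendsto_norm[OF l], of 0]) (use g_norm G_bound in \<open>metis order_trans\<close>)
  have 4: "z * l = l * z" if "z * h = h * z" for z
  proof -
    have "(\<lambda>n. z * g n) \<longlonglongrightarrow> z * l" "(\<lambda>n. g n * z) \<longlonglongrightarrow> l * z"
      by (intro tendsto_intros l)+
    then show ?thesis using g_comm[OF that] LIMSEQ_unique by simp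
  qed
  from 1 2 3 4 show ?thesis by blast
qed

subsection \<open>Positive elements of a unital C*-algebra\<close>

text \<open>Squares of selfadjoint elements admit a norm characterization that is stable under sums
  and limits. That every \<open>cadj x * x\<close> qualifies is the hard direction,
  \<open>psd_star_mult\<close>.\<close>

definition psd :: "'u::{cstar_algebra,monoid_mult} \<Rightarrow> bool" where
  "psd h \<longleftrightarrow> (\<exists>k. cadj k = k \<and> h = k * k)"

lemma cadj_1 [simp]: "cadj 1 = (1::'u::{cstar_algebra,monoid_mult})"
  by (metis cadj_cadj cadj_mult mult.right_neutral mult.left_neutral)

text \<open>Only an inequality, since \<open>1 = 0\<close> may hold, as for the multipliers of the
  zero algebra.\<close>

lemma norm_1_le: "norm (1::'u::{cstar_algebra,monoid_mult}) \<le> 1"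
proof -
  have "norm (1::'u) * (norm (1::'u) - 1) = 0"
    using norm_square_selfadj[of "1::'u"] by (simp add: power2_eq_square algebra_simps)
  then show ?thesis by auto
qed

lemma psd_selfadj: "psd h \<Longrightarrow> cadj h = h"
  by (auto simp: psd_def cadj_mult)

lemma psd_0: "psd 0"
  unfolding psd_def by (rule exI[of _ 0]) simp

lemma psd_scaleR: "0 \<le> r \<Longrightarrow> psd h \<Longrightarrow> psd (r *\<^sub>R h)"
  unfolding psd_def by (elim exE, rule_tac x = "sqrt r *\<^sub>R k" in exI) (auto simp: cadj_scaleR)

text \<open>For \<open>T = k + \<i> l\<close> commutation gives
  \<open>cadj T * T = k * k + l * l\<close>, and \<open>k\<close> is the real part of
  \<open>T\<close>, so \<open>norm k <= norm T\<close>.\<close>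

lemma norm_le_norm_add_squares:
  fixes k l :: "'a::cstar_algebra"
  assumes k: "cadj k = k" and l: "cadj l = l" and c: "k * l = l * k"
  shows "norm (k * k) \<le> norm (k * k + l * l)"
proof -
  define T where "T = k + cscale \<i> l"
  have aT: "cadj T = k - cscale \<i> l"
    by (simp add: T_def cadj_add cadj_cscale k l cscale_minus_left)
  have "cadj T * T = k * k + l * l"
    unfolding aT unfolding T_def
    by (simp add: algebra_simps cscale_mult_left cscale_mult_right cscale_cscale c cscale_minus_left
        cscale_diff_right)
  then have nT: "(norm T)\<^sup>2 = norm (k * k + l * l)"
    using cstar_identity[of T] by simp
  have "k = (1/2) *\<^sub>R (T + cadj T)"
    unfolding aT unfolding T_def by (simp add: scaleR_add_right[symmetric] scaleR_left.add[symmetric])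
  then have "norm k \<le> (1/2) * (norm T + norm (cadj T))"
    using norm_triangle_ineq[of T "cadj T"]
    by (metis abs_of_nonneg divide_nonneg_nonneg mult_left_mono norm_scaleR zero_le_numeral zero_le_one)
  then have "norm k \<le> norm T" by simp
  then have "(norm k)\<^sup>2 \<le> (norm T)\<^sup>2" by (intro power_mono) auto
  then show ?thesis using nT norm_square_selfadj[OF k] by simp
qed

text \<open>The iteration yields a square root \<open>l\<close> of \<open>1 - k * k\<close> that
  commutes with \<open>k\<close>; then \<open>l * l\<close> is one of two commuting squares with sum
  \<open>1\<close>.\<close>

lemma norm_one_minus_square_le:
  fixes k :: "'u::{cstar_algebra,monoid_mult}"
  assumes k: "cadj k = k" and n: "norm k \<le> 1"
  shows "norm (1 - k * k) \<le> 1"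
proof -
  have "norm (k * k) \<le> 1"
    using order_trans[OF norm_mult_ineq mult_mono[OF n n]] by simp
  moreover have "cadj (k * k) = k * k" by (simp add: cadj_mult k)
  ultimately have "\<exists>g. g + g - g * g = k * k \<and> cadj g = g \<and> norm g \<le> 1 \<and> (\<forall>z. z * (k * k) = k * k * z \<longrightarrow> z * g = g * z)"
    by (rule selfadj_sqrt_iteration)
  then obtain g where g: "g + g - g * g = k * k" "cadj g = g" "norm g \<le> 1"
      "\<forall>z. z * (k * k) = k * k * z \<longrightarrow> z * g = g * z"
    by blast
  define l where "l = 1 - g"
  have ll: "l * l = 1 - k * k" using g(1) by (simp add: l_def algebra_simps)
  have "l * k = k * l" using g(4)[rule_format, of k] by (simp add: l_def algebra_simps)
  moreover have "cadj l = l" by (simp add: l_def cadj_diff g(2))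
  ultimately have "norm (l * l) \<le> norm (l * l + k * k)"
    using norm_le_norm_add_squares k by blast
  then show ?thesis using norm_1_le[where 'u='u] by (simp add: ll)
qed

text \<open>The disc condition plays the role of a spectrum inside \<open>[0, 2 t]\<close>. After
  division by \<open>t\<close> it reads \<open>norm (1 - h) <= 1\<close>, and the iteration for
  \<open>1 - h\<close> gives the root \<open>1 - g\<close>. The radius \<open>t\<close> is left free
  so that discs can be added.\<close>

lemma disc_sqrt:
  fixes h :: "'u::{cstar_algebra,monoid_mult}"
  assumes sa: "cadj h = h" and n: "norm (t *\<^sub>R 1 - h) \<le> t"
  shows "\<exists>k. cadj k = k \<and> k * k = h \<and> psd k \<and> (\<forall>z. z * h = h * z \<longrightarrow> z * k = k * z)"
proof -
  { fix h :: 'u assume sa: "cadj h = h" and n: "norm (1 - h) \<le> 1"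
    have sa': "cadj (1 - h) = 1 - h" by (simp add: cadj_diff sa)
    obtain g where g: "g + g - g * g = 1 - h" "cadj g = g" "norm g \<le> 1"
        "\<forall>z. z * (1 - h) = (1 - h) * z \<longrightarrow> z * g = g * z"
      using selfadj_sqrt_iteration[OF n sa'] by blast
    have "(1 - g) * (1 - g) = h" using g(1) by (simp add: algebra_simps)
    moreover have "z * (1 - g) = (1 - g) * z" if "z * h = h * z" for z
    proof -
      have "z * g = g * z"
        by (rule g(4)[rule_format]) (simp only: right_diff_distrib left_diff_distrib that mult_1 mult_1_right)
      then show ?thesis by (simp only: right_diff_distrib left_diff_distrib mult_1 mult_1_right)
    qed
    moreover have "cadj (1 - g) = 1 - g" "norm (1 - (1 - g)) \<le> 1"
      using g(2,3) by (simp_all add: cadj_diff)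
    ultimately have "\<exists>k. cadj k = k \<and> k * k = h \<and> norm (1 - k) \<le> 1 \<and> (\<forall>z. z * h = h * z \<longrightarrow> z * k = k * z)"
      by (intro exI[of _ "1 - g"] conjI allI impI) }
  note unit = this
  show ?thesis
  proof (cases "t = 0")
    case True
    then have "h = 0" using n by simp
    then show ?thesis by (intro exI[of _ 0]) (simp add: psd_0)
  next
    case False
    moreover have "0 \<le> t" using n norm_ge_zero order_trans by blast
    ultimately have t: "t > 0" by simp
    define h' where "h' = (1/t) *\<^sub>R h"
    have "1 - h' = (1/t) *\<^sub>R (t *\<^sub>R 1 - h)" using t by (simp add: h'_def scaleR_diff_right)
    then have "norm (1 - h') = \<bar>1/t\<bar> * norm (t *\<^sub>R 1 - h)" by (simp only: norm_scaleR)
    then have "norm (1 - h') \<le> 1" using n t by simp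
    moreover have "cadj h' = h'" by (simp add: h'_def cadj_scaleR sa)
    ultimately have "\<exists>k. cadj k = k \<and> k * k = h' \<and> norm (1 - k) \<le> 1 \<and> (\<forall>z. z * h' = h' * z \<longrightarrow> z * k = k * z)"
      by (intro unit)
    then obtain k where k: "cadj k = k" "k * k = h'" "norm (1 - k) \<le> 1"
        "\<forall>z. z * h' = h' * z \<longrightarrow> z * k = k * z"
      by blast
    \<comment> \<open>The root lies in the unit disc around \<open>1\<close> again, so a second root
      shows that \<open>k\<close> itself is a square.\<close>
    obtain q where q: "cadj q = q" "q * q = k" using unit[OF k(1,3)] by blast
    show ?thesis
    proof (intro exI[of _ "sqrt t *\<^sub>R k"] conjI allI impI)
      show "cadj (sqrt t *\<^sub>R k) = sqrt t *\<^sub>R k" by (simp add: cadj_scaleR k(1))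
      show "sqrt t *\<^sub>R k * sqrt t *\<^sub>R k = h" using t by (simp add: k(2) h'_def)
      show "psd (sqrt t *\<^sub>R k)" by (rule psd_scaleR) (use t q in \<open>auto simp: psd_def\<close>)
      show "z * sqrt t *\<^sub>R k = sqrt t *\<^sub>R k * z" if "z * h = h * z" for z
        using k(4)[rule_format, of z] that by (simp add: h'_def)
    qed
  qed
qed

lemma psd_disc:
  fixes h :: "'u::{cstar_algebra,monoid_mult}"
  assumes "psd h"
  shows "norm (norm h *\<^sub>R 1 - h) \<le> norm h"
proof (cases "h = 0")
  case False
  obtain k where k: "cadj k = k" "h = k * k" using assms by (auto simp: psd_def)
  define j where "j = (1 / norm k) *\<^sub>R k"
  have k0: "norm k > 0" using False k by auto
  have nh: "norm h = (norm k)\<^sup>2" using k norm_square_selfadj by simp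
  have "norm (1 - j * j) \<le> 1"
    by (rule norm_one_minus_square_le) (use k0 in \<open>auto simp: j_def cadj_scaleR k\<close>)
  moreover have "norm h *\<^sub>R 1 - h = norm h *\<^sub>R (1 - j * j)"
    using k0 unfolding nh by (simp add: j_def scaleR_diff_right k power2_eq_square)
  ultimately show ?thesis
    by (metis abs_norm_cancel mult_left_mono mult.right_neutral norm_ge_zero norm_scaleR)
qed simp

text \<open>This norm condition replaces the spectrum: it turns sums into the triangle inequality
  and is visibly closed.\<close>

lemma psd_iff_disc:
  fixes h :: "'u::{cstar_algebra,monoid_mult}"
  shows "psd h \<longleftrightarrow> cadj h = h \<and> norm (norm h *\<^sub>R 1 - h) \<le> norm h"
  using psd_selfadj psd_disc disc_sqrt unfolding psd_def by metis

lemma psd_sqrt: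
  fixes h :: "'u::{cstar_algebra,monoid_mult}"
  assumes "psd h"
  shows "\<exists>k. cadj k = k \<and> k * k = h \<and> psd k \<and> (\<forall>z. z * h = h * z \<longrightarrow> z * k = k * z)"
  using assms disc_sqrt unfolding psd_iff_disc by blast

text \<open>Centres and radii of the two discs add up. The resulting radius may exceed
  \<open>norm (h + k)\<close>, which \<open>disc_sqrt\<close> permits.\<close>

lemma psd_add:
  fixes h k :: "'u::{cstar_algebra,monoid_mult}"
  assumes "psd h" "psd k"
  shows "psd (h + k)"
proof -
  have "norm ((norm h + norm k) *\<^sub>R 1 - (h + k)) = norm ((norm h *\<^sub>R 1 - h) + (norm k *\<^sub>R 1 - k))"
    by (simp add: algebra_simps)
  also have "\<dots> \<le> norm h + norm k"
    using assms by (meson add_mono norm_triangle_le psd_disc)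
  finally show ?thesis
    using disc_sqrt[of "h + k"] assms by (metis psd_selfadj cadj_add psd_def)
qed

lemma closed_psd: "closed {h::'u::{cstar_algebra,monoid_mult}. psd h}"
  unfolding psd_iff_disc
  by (intro closed_Collect_conj closed_Collect_eq closed_Collect_le continuous_intros
      linear_continuous_on bounded_linear_cadj)

text \<open>Norm comparison of \<open>(1 + x x\<^sup>*)\<^sup>2 = 1 + x (2 + x\<^sup>* x) x\<^sup>*\<close> for \<open>\<parallel>x\<parallel> = 1\<close>: the right side
has norm at most \<open>3\<close>, the left side at least \<open>4\<close>.\<close>
lemma star_mult_neg_square_imp_0:
  fixes x k m :: "'u::{cstar_algebra,monoid_mult}"
  assumes k: "cadj k = k" "cadj x * x = - (k * k)" and m: "cadj m = m" "x * cadj x = m * m"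
  shows "x = 0"
proof (rule ccontr)
  assume "x \<noteq> 0"
  define r where "r = 1 / norm x"
  have r: "r > 0" "r * norm x = 1" using \<open>x \<noteq> 0\<close> by (auto simp: r_def)
  define X K M where "X = r *\<^sub>R x" and "K = r *\<^sub>R k" and "M = r *\<^sub>R m"
  have nX: "norm X = 1" using r by (simp add: X_def)
  have K: "cadj K = K" "cadj X * X = - (K * K)" by (simp_all add: K_def X_def cadj_scaleR k)
  have M: "cadj M = M" "X * cadj X = M * M" by (simp_all add: M_def X_def cadj_scaleR m)
  have nK: "norm K \<le> 1"
    using cstar_identity[of X] norm_square_selfadj[OF K(1)] by (simp add: K nX power2_eq_1_iff) (smt (verit))
  have nM: "norm (M * M) = 1"
    using norm_mult_cadj[of X] by (simp add: M nX)
  \<comment> \<open>A sum of two commuting squares, so its norm is at least that of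
    \<open>4 *\<^sub>R (M * M)\<close>, which is \<open>4\<close>.\<close>
  have e1: "(1 + M * M) * (1 + M * M) = (2 *\<^sub>R M) * (2 *\<^sub>R M) + (1 - M * M) * (1 - M * M)"
    by (simp add: algebra_simps scaleR_2 scaleR_left_distrib[of 2 2, simplified])
  have "norm ((2 *\<^sub>R M) * (2 *\<^sub>R M)) \<le> norm ((1 + M * M) * (1 + M * M))"
    unfolding e1 by (rule norm_le_norm_add_squares)
      (simp_all add: cadj_scaleR cadj_diff cadj_mult M algebra_simps)
  then have low: "4 \<le> norm ((1 + M * M) * (1 + M * M))" using nM by simp
  have "(1 + M * M) * (1 + M * M) = 1 + X * (2 *\<^sub>R 1 + cadj X * X) * cadj X"
    unfolding M(2)[symmetric] scaleR_2 by (simp add: algebra_simps)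
  \<comment> \<open>The sign hypothesis enters here: the middle factor becomes
    \<open>1 + (1 - K * K)\<close>, of norm at most \<open>2\<close>.\<close>
  also have "2 *\<^sub>R 1 + cadj X * X = 1 + (1 - K * K)"
    by (simp add: K scaleR_2 algebra_simps)
  also have "norm (1 + X * (1 + (1 - K * K)) * cadj X) \<le> 1 + norm X * norm (1 + (1 - K * K)) * norm (cadj X)"
    by (rule norm_triangle_le) (smt (verit) norm_1_le norm_mult_ineq mult_right_mono norm_ge_zero)
  also have "\<dots> \<le> 1 + 2"
    using norm_triangle_ineq[of 1 "1 - K * K"] norm_1_le[where 'u='u]
      norm_one_minus_square_le[OF K(1) nK] by (simp add: nX)
  finally show False using low by simp
qed

text \<open>With \<open>h = cadj x * x\<close> and \<open>r\<close> the root of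
  \<open>h * h\<close>, the element \<open>d = r - h\<close> is twice the negative part of
  \<open>h\<close>. For \<open>y = x * d\<close> one gets \<open>cadj y * y = - (s * s)\<close> with
  \<open>s = q * d\<close> and \<open>q * q = r\<close>, which makes \<open>y * cadj y\<close> a sum
  of squares. The preceding lemma forces \<open>y = 0\<close>, and then \<open>d = 0\<close>, that
  is \<open>h = r\<close>.\<close>

theorem psd_star_mult:
  fixes x :: "'u::{cstar_algebra,monoid_mult}"
  shows "psd (cadj x * x)"
proof -
  define h where "h = cadj x * x"
  have sa_h: "cadj h = h" by (simp add: h_def cadj_mult cadj_cadj)
  then have "psd (h * h)" by (auto simp: psd_def)
  from psd_sqrt[OF this] obtain r where r: "cadj r = r" "r * r = h * h" "psd r"
      "\<forall>z. z * (h * h) = h * h * z \<longrightarrow> z * r = r * z"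
    by blast
  have hr: "h * r = r * h" by (rule r(4)[rule_format]) (simp add: mult.assoc)
  obtain q where q: "cadj q = q" "q * q = r" "\<forall>z. z * r = r * z \<longrightarrow> z * q = q * z"
    using psd_sqrt[OF r(3)] by blast
  have qr: "r * q = q * r" and qh: "h * q = q * h" using q(3) hr by simp_all
  define d where "d = r - h"
  have sa_d: "cadj d = d" by (simp add: d_def cadj_diff r sa_h)
  have dq: "d * q = q * d" by (simp add: d_def algebra_simps qr qh)
  have dr: "d * r = r * d" by (simp add: d_def algebra_simps hr)
  define s where "s = q * d"
  define y where "y = x * d"
  have sa_s: "cadj s = s" by (simp add: s_def cadj_mult q sa_d dq)
  have hd: "h * d = - (r * d)" by (simp add: d_def algebra_simps r hr)
  have ss: "s * s = r * d * d"
    unfolding s_def by (metis dq mult.assoc q(2))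
  have "cadj y * y = d * (h * d)" by (simp add: y_def h_def cadj_mult sa_d mult.assoc)
  then have yy: "cadj y * y = - (s * s)"
    by (simp add: hd ss mult.assoc[symmetric] dr)
  \<comment> \<open>The real and imaginary parts of \<open>y\<close>, chosen so that
    \<open>y * cadj y + cadj y * y = 2 *\<^sub>R (a * a + b * b)\<close>.\<close>
  define a b where "a = (1/2) *\<^sub>R (y + cadj y)" and "b = (1/2) *\<^sub>R cscale \<i> (cadj y - y)"
  have sa_ab: "cadj a = a" "cadj b = b"
    by (simp_all add: a_def b_def cadj_scaleR cadj_add cadj_diff cadj_cscale cadj_cadj cscale_diff_right
        cscale_minus_left add.commute)
  have "4 *\<^sub>R (a * a + b * b) = (y + cadj y) * (y + cadj y) - (cadj y - y) * (cadj y - y)"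
    by (simp add: a_def b_def scaleR_add_right[of 4] cscale_scaleR cscale_mult_left cscale_mult_right
        cscale_cscale cscale_minus_left 
        scaleR_diff_right[of 4])
  also have "\<dots> = 2 *\<^sub>R (y * cadj y + cadj y * y)"
    by (simp add: algebra_simps scaleR_2)
  finally have "2 *\<^sub>R (2 *\<^sub>R (a * a + b * b)) = 2 *\<^sub>R (y * cadj y + cadj y * y)" by simp
  then have "2 *\<^sub>R (a * a + b * b) = y * cadj y + cadj y * y" by (simp only: scaleR_cancel_left) simp
  then have "y * cadj y = 2 *\<^sub>R (a * a + b * b) + s * s" by (simp add: yy)
  moreover have "psd (2 *\<^sub>R (a * a + b * b) + s * s)"
    by (intro psd_add psd_scaleR) (use sa_ab sa_s in \<open>auto simp: psd_def\<close>)
  ultimately obtain m where "cadj m = m" "y * cadj y = m * m" by (auto simp: psd_def)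
  then have "y = 0" using star_mult_neg_square_imp_0[OF sa_s yy] by blast
  then have "s * s = 0" using yy by simp
  then have "s = 0" using norm_square_selfadj[OF sa_s] by simp
  \<comment> \<open>Here \<open>r * d = q * s\<close>. Since \<open>h * d = - (r * d)\<close>, both
    terms of \<open>d * d = r * d - h * d\<close> vanish.\<close>
  then have "r * d = 0" by (metis mult.assoc mult_zero_right q(2) s_def)
  then have "d * d = 0" using hd by (simp add: d_def algebra_simps)
  then have "d = 0" using norm_square_selfadj[OF sa_d] by simp
  then show ?thesis using r(3) by (simp add: d_def h_def)
qed

section \<open>Compressions and norm estimates for positive elements\<close>

lemma psd_compress:
  assumes "psd p"
  shows "psd (cadj x * p * x)"
proof -
  obtain k where "cadj k = k" "p = k * k" using assms by (auto simp: psd_def)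
  then have "cadj x * p * x = cadj (k * x) * (k * x)" by (simp add: cadj_mult mult.assoc)
  then show ?thesis using psd_star_mult by simp
qed

text \<open>Scaled so that \<open>norm (p + q) <= 1\<close>, both \<open>1 - (p + q)\<close> and
  hence \<open>1 - p\<close> are positive. The roots of \<open>p\<close> and \<open>1 - p\<close>
  commute and their squares add up to \<open>1\<close>.\<close>

lemma psd_norm_le_add:
  fixes p q :: "'u::{cstar_algebra,monoid_mult}"
  assumes p: "psd p" and q: "psd q"
  shows "norm p \<le> norm (p + q)"
proof -
  have *: "norm p \<le> 1" if p: "psd p" and q: "psd q" and n: "norm (p + q) \<le> 1" for p q :: 'u
  proof -
    have "norm (1 *\<^sub>R 1 - (1 - (p + q))) \<le> 1" using n by (simp add: add.commute)
    then have "psd (1 - (p + q))"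
      using disc_sqrt[of "1 - (p + q)"] p q by (metis cadj_1 cadj_diff cadj_add psd_selfadj psd_def)
    then have "psd (1 - p)" using psd_add[OF _ q] by fastforce
    from psd_sqrt[OF this]
    obtain n where n: "cadj n = n" "n * n = 1 - p" "\<forall>z. z * (1 - p) = (1 - p) * z \<longrightarrow> z * n = n * z"
      by blast
    obtain k where k: "cadj k = k" "k * k = p" using p by (auto simp: psd_def)
    have "k * n = n * k" by (rule n(3)[rule_format]) (simp add: k(2)[symmetric] algebra_simps)
    then have "norm (k * k) \<le> norm (k * k + n * n)"
      by (intro norm_le_norm_add_squares k n)
    then show ?thesis using norm_1_le[where 'u='u] by (simp add: k n)
  qed
  show ?thesis
  proof (rule field_le_epsilon)
    fix e :: real assume e: "0 < e"
    \<comment> \<open>The margin \<open>e\<close> keeps the divisor positive even for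
      \<open>p + q = 0\<close>.\<close>
    define t where "t = norm (p + q) + e"
    have t: "t > 0" using e norm_ge_zero[of "p + q"] unfolding t_def by linarith
    have "norm ((1/t) *\<^sub>R p) \<le> 1"
    proof (rule *)
      show "psd ((1/t) *\<^sub>R p)" "psd ((1/t) *\<^sub>R q)" using t p q by (auto intro!: psd_scaleR)
      have "norm ((1/t) *\<^sub>R p + (1/t) *\<^sub>R q) = norm (p + q) / t"
        using t by (simp add: scaleR_add_right[symmetric])
      also have "\<dots> \<le> 1" using t e by (simp add: t_def)
      finally show "norm ((1/t) *\<^sub>R p + (1/t) *\<^sub>R q) \<le> 1" .
    qed
    then show "norm p \<le> norm (p + q) + e" using t by (simp add: t_def[symmetric])
  qed
qed

text \<open>A Cauchy-Schwarz inequality, from \<open>p * d = k * (k * d)\<close> with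
  \<open>p = k * k\<close>. It converts smallness of quadratic forms into convergence of
  products.\<close>

lemma psd_norm_mult_le:
  fixes p d :: "'u::{cstar_algebra,monoid_mult}"
  assumes "psd p"
  shows "(norm (p * d))\<^sup>2 \<le> norm p * norm (cadj d * p * d)"
proof -
  obtain k where k: "cadj k = k" "p = k * k" using assms by (auto simp: psd_def)
  have "cadj d * p * d = cadj (k * d) * (k * d)" by (simp add: k cadj_mult mult.assoc)
  then have 1: "norm (cadj d * p * d) = (norm (k * d))\<^sup>2" by (simp add: cstar_identity)
  have "norm (p * d) \<le> norm k * norm (k * d)"
    using norm_mult_ineq[of k "k * d"] by (simp add: k mult.assoc)
  then have "(norm (p * d))\<^sup>2 \<le> (norm k * norm (k * d))\<^sup>2" by (intro power_mono) auto
  moreover have "norm p = (norm k)\<^sup>2" using norm_square_selfadj[OF k(1)] k(2) by simp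
  ultimately show ?thesis by (simp only: 1 power_mult_distrib)
qed


subsection \<open>The multiplier algebra\<close>

text \<open>The algebra is viewed as a right Hilbert module over itself with inner product
  \<open>cadj x * y\<close>. Its adjointable bounded operators are a concrete model of the
  multiplier algebra.\<close>

definition adjoint_pair :: "('a::cstar_algebra \<Rightarrow>\<^sub>L 'a) \<Rightarrow> ('a \<Rightarrow>\<^sub>L 'a) \<Rightarrow> bool" where
  "adjoint_pair S T \<longleftrightarrow> (\<forall>x y. cadj (blinfun_apply S x) * y = cadj x * blinfun_apply T y)"

lemma adjoint_pair_sym:
  assumes "adjoint_pair S T"
  shows "adjoint_pair T S"
  unfolding adjoint_pair_def
proof (intro allI)
  fix x y
  have "cadj (blinfun_apply T x) * y = cadj (cadj y * blinfun_apply T x)"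
    by (simp add: cadj_mult cadj_cadj)
  also have "cadj y * blinfun_apply T x = cadj (blinfun_apply S y) * x"
    using assms by (simp add: adjoint_pair_def)
  finally show "cadj (blinfun_apply T x) * y = cadj x * blinfun_apply S y"
    by (simp add: cadj_mult cadj_cadj)
qed

lemma adjoint_pair_unique:
  assumes "adjoint_pair S T" "adjoint_pair S T'"
  shows "T = T'"
proof (rule blinfun_eqI, rule cstar_eqI_left)
  fix x y
  have "cadj z * blinfun_apply T x = cadj z * blinfun_apply T' x" for z
  proof -
    have "cadj (blinfun_apply S z) * x = cadj z * blinfun_apply T x"
      "cadj (blinfun_apply S z) * x = cadj z * blinfun_apply T' x"
      using assms by (simp_all only: adjoint_pair_def)
    then show ?thesis by (rule trans[OF sym])
  qed
  from this[of "cadj y"] show "y * blinfun_apply T x = y * blinfun_apply T' x" by (simp add: cadj_cadj)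
qed

text \<open>From \<open>(norm (S x))^2 = norm (cadj x * T (S x))\<close> follows
  \<open>(norm S)^2 <= norm (T o\<^sub>L S) <= norm T * norm S\<close>; symmetry of the pair does
  the rest.\<close>

lemma adjoint_pair_norm_square:
  assumes "adjoint_pair S T"
  shows "norm (T o\<^sub>L S) = (norm S)\<^sup>2" and "norm T = norm S"
proof -
  have le: "(norm S)\<^sup>2 \<le> norm (T o\<^sub>L S)" if "adjoint_pair S T" for S T :: "'a \<Rightarrow>\<^sub>L 'a"
  proof -
    have "norm (S x) \<le> sqrt (norm (T o\<^sub>L S)) * norm x" for x
    proof -
      have "(norm (S x))\<^sup>2 = norm (cadj x * (T o\<^sub>L S) x)"
        using that by (simp add: cstar_identity[symmetric] adjoint_pair_def)
      also have "\<dots> \<le> norm x * (norm (T o\<^sub>L S) * norm x)"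
        using norm_mult_ineq[of "cadj x" "(T o\<^sub>L S) x"] mult_left_mono[OF norm_blinfun[of "T o\<^sub>L S" x] norm_ge_zero[of x]]
        unfolding norm_cadj by (rule order_trans)
      also have "\<dots> = (sqrt (norm (T o\<^sub>L S)) * norm x)\<^sup>2"
        by (simp add: power_mult_distrib) (simp add: power2_eq_square)
      finally show ?thesis by (rule power2_le_imp_le) simp
    qed
    then have "norm S \<le> sqrt (norm (T o\<^sub>L S))" by (intro norm_blinfun_bound) auto
    then have "(norm S)\<^sup>2 \<le> (sqrt (norm (T o\<^sub>L S)))\<^sup>2" by (intro power_mono) auto
    then show ?thesis by simp
  qed
  have le': "norm S \<le> norm T" if "adjoint_pair S T" for S T :: "'a \<Rightarrow>\<^sub>L 'a"
  proof (cases "S = 0")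
    case False
    have "norm S * norm S \<le> norm T * norm S"
      using order_trans[OF le[OF that] norm_blinfun_compose] by (simp add: power2_eq_square)
    then show ?thesis using False by simp
  qed simp
  show eq: "norm T = norm S"
    using le'[OF assms] le'[OF adjoint_pair_sym[OF assms]] by simp
  show "norm (T o\<^sub>L S) = (norm S)\<^sup>2"
    using le[OF assms] norm_blinfun_compose[of T S] by (simp add: eq power2_eq_square)
qed

lift_definition blinfun_cscale :: "complex \<Rightarrow> 'a::cstar_algebra \<Rightarrow>\<^sub>L 'a" is cscale
  by (rule bounded_linear_cscale)

text \<open>The operators are only real linear by type; possession of an adjoint forces complex
  linearity.\<close>

lemma adjoint_pair_cscale:
  assumes "adjoint_pair S T"
  shows "blinfun_apply S (cscale a x) = cscale a (blinfun_apply S x)"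
proof -
  have "cadj (blinfun_apply S (cscale a x)) = cadj (cscale a (blinfun_apply S x))"
    by (rule cstar_eqI_right) (use assms in \<open>simp add: adjoint_pair_def cadj_cscale cscale_mult_left\<close>)
  then show ?thesis by (metis cadj_cadj)
qed

text \<open>Carrying the adjoint along makes the involution a swap. By
  \<open>adjoint_pair_unique\<close> the second component is determined by the first.\<close>

typedef (overloaded) 'a multiplier =
  "{p. adjoint_pair (fst p) (snd p)} :: (('a::cstar_algebra \<Rightarrow>\<^sub>L 'a) \<times> ('a \<Rightarrow>\<^sub>L 'a)) set"
  by (rule exI[of _ "(0, 0)"]) (simp add: adjoint_pair_def)

setup_lifting type_definition_multiplier

definition mult_op :: "'a::cstar_algebra multiplier \<Rightarrow> 'a \<Rightarrow>\<^sub>L 'a" where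
  "mult_op m = fst (Rep_multiplier m)"

definition mult_adj_op :: "'a::cstar_algebra multiplier \<Rightarrow> 'a \<Rightarrow>\<^sub>L 'a" where
  "mult_adj_op m = snd (Rep_multiplier m)"

lemma adjoint_pair_mult_op: "adjoint_pair (mult_op m) (mult_adj_op m)"
  using Rep_multiplier[of m] by (simp add: mult_op_def mult_adj_op_def)

lemma multiplier_eqI:
  assumes "\<And>x. blinfun_apply (mult_op m) x = blinfun_apply (mult_op n) x"
  shows "m = n"
proof -
  have 1: "mult_op m = mult_op n" using assms by (intro blinfun_eqI)
  have "mult_adj_op m = mult_adj_op n"
    by (rule adjoint_pair_unique[OF adjoint_pair_mult_op]) (metis 1 adjoint_pair_mult_op)
  with 1 show ?thesis by (simp add: mult_op_def mult_adj_op_def prod_eq_iff Rep_multiplier_inject[symmetric])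
qed

instantiation multiplier :: (cstar_algebra) real_normed_algebra
begin

lift_definition zero_multiplier :: "'a multiplier" is "(0, 0)"
  by (simp add: adjoint_pair_def)

lift_definition plus_multiplier :: "'a multiplier \<Rightarrow> 'a multiplier \<Rightarrow> 'a multiplier"
  is "\<lambda>p q. (fst p + fst q, snd p + snd q)"
  by (simp add: adjoint_pair_def blinfun.add_left cadj_add distrib_left distrib_right)

lift_definition minus_multiplier :: "'a multiplier \<Rightarrow> 'a multiplier \<Rightarrow> 'a multiplier"
  is "\<lambda>p q. (fst p - fst q, snd p - snd q)"
  by (simp add: adjoint_pair_def blinfun.diff_left cadj_diff left_diff_distrib right_diff_distrib)

lift_definition uminus_multiplier :: "'a multiplier \<Rightarrow> 'a multiplier" is "\<lambda>p. (- fst p, - snd p)"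
  by (simp add: adjoint_pair_def blinfun.minus_left cadj_minus)

lift_definition times_multiplier :: "'a multiplier \<Rightarrow> 'a multiplier \<Rightarrow> 'a multiplier"
  is "\<lambda>p q. (fst p o\<^sub>L fst q, snd q o\<^sub>L snd p)"
  by (simp add: adjoint_pair_def)

lift_definition scaleR_multiplier :: "real \<Rightarrow> 'a multiplier \<Rightarrow> 'a multiplier"
  is "\<lambda>r p. (r *\<^sub>R fst p, r *\<^sub>R snd p)"
  by (simp add: adjoint_pair_def blinfun.scaleR_left cadj_scaleR)

lift_definition norm_multiplier :: "'a multiplier \<Rightarrow> real" is "\<lambda>p. norm (fst p)" .

definition dist_multiplier :: "'a multiplier \<Rightarrow> 'a multiplier \<Rightarrow> real" where
  "dist_multiplier m n = norm (m - n)"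

definition sgn_multiplier :: "'a multiplier \<Rightarrow> 'a multiplier" where
  "sgn_multiplier m = scaleR (inverse (norm m)) m"

definition uniformity_multiplier :: "('a multiplier \<times> 'a multiplier) filter" where
  "uniformity_multiplier = (INF e\<in>{0 <..}. principal {(x, y). dist x y < e})"

definition open_multiplier :: "'a multiplier set \<Rightarrow> bool" where
  "open_multiplier U = (\<forall>x\<in>U. \<forall>\<^sub>F (x', y) in uniformity. x' = x \<longrightarrow> y \<in> U)"

lemma mult_op_simps:
  "mult_op 0 = 0" "mult_op (m + n) = mult_op m + mult_op n" "mult_op (m - n) = mult_op m - mult_op n"
  "mult_op (- m) = - mult_op m" "mult_op (m * n) = mult_op m o\<^sub>L mult_op n"
  "mult_op (r *\<^sub>R m) = r *\<^sub>R mult_op m"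
 by (simp_all add: mult_op_def mult_adj_op_def zero_multiplier.rep_eq plus_multiplier.rep_eq
      minus_multiplier.rep_eq uminus_multiplier.rep_eq times_multiplier.rep_eq scaleR_multiplier.rep_eq)

lemma norm_mult_op: "norm m = norm (mult_op m)"
  by (simp add: mult_op_def norm_multiplier.rep_eq)

instance
proof
  fix m n p :: "'a multiplier" and r s :: real
  note ext = multiplier_eqI
  note simps = mult_op_simps blinfun.bilinear_simps
  show "m + n + p = m + (n + p)" "m + n = n + m" "0 + m = m" "- m + m = 0" "m - n = m + - n"
    "m * n * p = m * (n * p)" "(m + n) * p = m * p + n * p" "m * (n + p) = m * n + m * p"
    "r *\<^sub>R (m + n) = r *\<^sub>R m + r *\<^sub>R n" "(r + s) *\<^sub>R m = r *\<^sub>R m + s *\<^sub>R m"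
    "r *\<^sub>R s *\<^sub>R m = (r * s) *\<^sub>R m" "1 *\<^sub>R m = m"
    "r *\<^sub>R m * n = r *\<^sub>R (m * n)" "m * r *\<^sub>R n = r *\<^sub>R (m * n)"
    by (rule ext; simp add: simps algebra_simps)+
  show "sgn m = inverse (norm m) *\<^sub>R m" "dist m n = norm (m - n)"
    "(uniformity :: ('a multiplier \<times> 'a multiplier) filter) = (INF e\<in>{0 <..}. principal {(x, y). dist x y < e})"
    by (simp_all add: sgn_multiplier_def dist_multiplier_def uniformity_multiplier_def)
  show "open U = (\<forall>x\<in>U. \<forall>\<^sub>F (x', y) in uniformity. x' = x \<longrightarrow> y \<in> U)" for U :: "'a multiplier set"
    by (simp add: open_multiplier_def)
  show "norm m = 0 \<longleftrightarrow> m = 0"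
    by (auto simp: norm_mult_op mult_op_simps intro: ext)
  show "norm (m + n) \<le> norm m + norm n"
    by (simp add: norm_mult_op mult_op_simps norm_triangle_ineq)
  show "norm (r *\<^sub>R m) = \<bar>r\<bar> * norm m"
    by (simp add: norm_mult_op mult_op_simps)
  show "norm (m * n) \<le> norm m * norm n"
    by (simp add: norm_mult_op mult_op_simps norm_blinfun_compose)
qed

end

text \<open>Adjoints have equal norm, so both components of a Cauchy sequence converge, and the
  adjoint relation passes to the limits.\<close>

instance multiplier :: (cstar_algebra) banach
proof
  fix X :: "nat \<Rightarrow> 'a multiplier"
  assume X: "Cauchy X"
  have nadj: "norm (mult_adj_op m) = norm m" for m :: "'a multiplier"
    using adjoint_pair_norm_square(2)[OF adjoint_pair_mult_op[of m]] by (simp add: norm_mult_op)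
  have d1: "dist (mult_op m) (mult_op n) = dist m n" for m n :: "'a multiplier"
    by (simp add: dist_multiplier_def norm_mult_op mult_op_simps dist_norm)
  have diff_adj: "mult_adj_op (m - n) = mult_adj_op m - mult_adj_op n" for m n :: "'a multiplier"
    by (simp add: mult_adj_op_def minus_multiplier.rep_eq)
  have d2: "dist (mult_adj_op m) (mult_adj_op n) = dist m n" for m n :: "'a multiplier"
    by (simp add: dist_norm diff_adj[symmetric] nadj)
  have "Cauchy (\<lambda>n. mult_op (X n))" "Cauchy (\<lambda>n. mult_adj_op (X n))"
    using X by (simp_all add: Cauchy_def d1 d2)
  then obtain S T where S: "(\<lambda>n. mult_op (X n)) \<longlonglongrightarrow> S" and T: "(\<lambda>n. mult_adj_op (X n)) \<longlonglongrightarrow> T"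
    by (meson Cauchy_convergent convergent_def)
  have "adjoint_pair S T"
    unfolding adjoint_pair_def
  proof (intro allI)
    fix x y
    have "(\<lambda>n. cadj (mult_op (X n) x) * y) \<longlonglongrightarrow> cadj (S x) * y"
      by (intro tendsto_mult tendsto_const tendsto_cadj blinfun.tendsto S)
    moreover have "cadj (mult_op (X n) x) * y = cadj x * mult_adj_op (X n) y" for n
      using adjoint_pair_mult_op[of "X n"] by (simp add: adjoint_pair_def)
    ultimately have "(\<lambda>n. cadj x * mult_adj_op (X n) y) \<longlonglongrightarrow> cadj (S x) * y" by simp
    moreover have "(\<lambda>n. cadj x * mult_adj_op (X n) y) \<longlonglongrightarrow> cadj x * T y"
      by (intro tendsto_mult tendsto_const blinfun.tendsto T)
    ultimately show "cadj (S x) * y = cadj x * T y" by (rule LIMSEQ_unique)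
  qed
  then obtain l where l: "mult_op l = S"
    by (intro that[of "Abs_multiplier (S, T)"]) (simp add: mult_op_def Abs_multiplier_inverse)
  have "X \<longlonglongrightarrow> l"
  proof (rule metric_LIMSEQ_I)
    fix r :: real assume "0 < r"
    then show "\<exists>no. \<forall>n\<ge>no. dist (X n) l < r"
      using metric_LIMSEQ_D[OF S] by (simp add: d1[symmetric] l)
  qed
  then show "convergent X" by (auto simp: convergent_def)
qed

instantiation multiplier :: (cstar_algebra) cstar_algebra
begin

lift_definition cscale_multiplier :: "complex \<Rightarrow> 'a multiplier \<Rightarrow> 'a multiplier"
  is "\<lambda>a p. (blinfun_cscale a o\<^sub>L fst p, blinfun_cscale (cnj a) o\<^sub>L snd p)"
  by (simp add: adjoint_pair_def blinfun_cscale.rep_eq cadj_cscale cscale_mult_left cscale_mult_right)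

lift_definition cadj_multiplier :: "'a multiplier \<Rightarrow> 'a multiplier" is "\<lambda>p. (snd p, fst p)"
  by (simp add: adjoint_pair_sym)

lemma mult_op_cscale: "mult_op (cscale a m) = blinfun_cscale a o\<^sub>L mult_op m"
  and mult_op_cadj: "mult_op (cadj m) = mult_adj_op m"
  by (simp_all add: mult_op_def mult_adj_op_def cscale_multiplier.rep_eq cadj_multiplier.rep_eq)

instance
proof
  fix m n :: "'a multiplier" and r :: real and a b :: complex
  note ext = multiplier_eqI
  note simps = mult_op_simps mult_op_cscale blinfun.bilinear_simps blinfun_cscale.rep_eq
  show "cscale (complex_of_real r) m = r *\<^sub>R m"
    by (rule ext) (simp add: simps cscale_of_real)
  show "cscale (a + b) m = cscale a m + cscale b m" "cscale a (m + n) = cscale a m + cscale a n"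
    "cscale a (cscale b m) = cscale (a * b) m" "cscale a m * n = cscale a (m * n)"
    by (rule ext; simp add: simps cscale_add_left cscale_add_right cscale_cscale)+
  show "m * cscale a n = cscale a (m * n)"
    by (rule ext) (simp add: simps adjoint_pair_cscale[OF adjoint_pair_mult_op])
  show "norm (cscale a m) = cmod a * norm m"
  proof -
    have le: "norm (cscale a m) \<le> cmod a * norm m" for a and m :: "'a multiplier"
      unfolding norm_mult_op
      by (rule norm_blinfun_bound)
         (simp_all add: simps norm_cscale mult.assoc mult_left_mono norm_blinfun)
    show ?thesis
    proof (cases "a = 0")
      case True
      then show ?thesis using le[of a m] by (simp add: norm_mult_op)
    next
      case False
      have "m = cscale (inverse a) (cscale a m)"
        using False by (intro ext) (simp add: simps cscale_cscale)
      then have "norm m \<le> cmod (inverse a) * norm (cscale a m)" by (metis le)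
      then have "cmod a * norm m \<le> cmod a * (cmod (inverse a) * norm (cscale a m))"
        by (rule mult_left_mono) simp
      also have "\<dots> = norm (cscale a m)"
        using False by (simp add: mult.assoc[symmetric] norm_mult[symmetric])
      finally show ?thesis using le[of a m] by simp
    qed
  qed
  show "cadj (cadj m) = m" by transfer simp
  show "cadj (m + n) = cadj m + cadj n" by transfer simp
  show "cadj (cscale a m) = cscale (cnj a) (cadj m)" by transfer simp
  show "cadj (m * n) = cadj n * cadj m" by transfer simp
  show "norm (cadj m * m) = (norm m)\<^sup>2"
    using adjoint_pair_norm_square(1)[OF adjoint_pair_mult_op[of m]] by (simp add: norm_mult_op mult_op_simps mult_op_cadj)
qed

end

instantiation multiplier :: (cstar_algebra) monoid_mult
begin

lift_definition one_multiplier :: "'a multiplier" is "(id_blinfun, id_blinfun)"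
  by (simp add: adjoint_pair_def)

lemma mult_op_1: "mult_op 1 = id_blinfun"
  by (simp add: mult_op_def one_multiplier.rep_eq)

instance
  by standard (rule multiplier_eqI, simp add: mult_op_simps mult_op_1)+

end


section \<open>The embedding of an algebra into its multipliers\<close>

definition lmult :: "'a::cstar_algebra \<Rightarrow> 'a multiplier" where
  "lmult a = Abs_multiplier (Blinfun ((*) a), Blinfun ((*) (cadj a)))"

lemma mult_op_lmult [simp]: "blinfun_apply (mult_op (lmult a)) x = a * x"
  and mult_adj_op_lmult [simp]: "blinfun_apply (mult_adj_op (lmult a)) x = cadj a * x"
proof -
  have "adjoint_pair (Blinfun ((*) a)) (Blinfun ((*) (cadj a)))"
    by (simp add: adjoint_pair_def bounded_linear_Blinfun_apply[OF bounded_linear_mult_right]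
        cadj_mult mult.assoc)
  then show "blinfun_apply (mult_op (lmult a)) x = a * x"
    "blinfun_apply (mult_adj_op (lmult a)) x = cadj a * x"
    by (simp_all add: mult_op_def mult_adj_op_def lmult_def Abs_multiplier_inverse
        bounded_linear_Blinfun_apply[OF bounded_linear_mult_right])
qed

lemma lmult_0: "lmult 0 = 0"
  by (rule multiplier_eqI) (simp add: mult_op_simps)

lemma lmult_add: "lmult (a + b) = lmult a + lmult b"
  by (rule multiplier_eqI) (simp add: mult_op_simps blinfun.bilinear_simps distrib_right)

lemma lmult_diff: "lmult (a - b) = lmult a - lmult b"
  by (rule multiplier_eqI) (simp add: mult_op_simps blinfun.bilinear_simps left_diff_distrib)

lemma lmult_scaleR: "lmult (r *\<^sub>R a) = r *\<^sub>R lmult a"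
  by (rule multiplier_eqI) (simp add: mult_op_simps blinfun.bilinear_simps)

lemma lmult_mult: "lmult (a * b) = lmult a * lmult b"
  by (rule multiplier_eqI) (simp add: mult_op_simps mult.assoc)

lemma lmult_cadj: "lmult (cadj a) = cadj (lmult a)"
  by (rule multiplier_eqI) (simp add: mult_op_cadj)

text \<open>The algebra is a left ideal: a multiplier commutes with right multiplication, as testing
  against its adjoint shows.\<close>

lemma mult_lmult: "m * lmult a = lmult (blinfun_apply (mult_op m) a)"
proof (rule multiplier_eqI)
  fix x
  have "cadj z * mult_op m (a * x) = cadj z * (mult_op m a * x)" for z
  proof -
    have adj: "cadj z * mult_op m y = cadj (mult_adj_op m z) * y" for y
      using adjoint_pair_sym[OF adjoint_pair_mult_op[of m]] by (simp add: adjoint_pair_def)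
    show ?thesis unfolding mult.assoc[symmetric] adj by (simp only: mult.assoc)
  qed
  from this[of "cadj z" for z] have "mult_op m (a * x) = mult_op m a * x"
    by (rule_tac cstar_eqI_left) (simp only: cadj_cadj)
  then show "mult_op (m * lmult a) x = mult_op (lmult (mult_op m a)) x"
    by (simp add: mult_op_simps)
qed

text \<open>The C*-identity at \<open>cadj a\<close> shows that the operator norm is not smaller
  than \<open>norm a\<close>.\<close>

lemma norm_lmult [simp]: "norm (lmult a) = norm a"
proof (rule antisym)
  show "norm (lmult a) \<le> norm a"
    unfolding norm_mult_op by (rule norm_blinfun_bound) (simp_all add: norm_mult_ineq)
  have "norm a * norm a = norm (blinfun_apply (mult_op (lmult a)) (cadj a))"
    using norm_mult_cadj[of a] by (simp add: power2_eq_square)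
  also have "\<dots> \<le> norm (lmult a) * norm a"
    using norm_blinfun[of "mult_op (lmult a)" "cadj a"] by (simp add: norm_mult_op)
  finally show "norm a \<le> norm (lmult a)"
    by (cases "a = 0") auto
qed

lemma bounded_linear_lmult: "bounded_linear lmult"
  by (rule bounded_linear_intro[where K = 1]) (simp_all add: lmult_add lmult_scaleR)

subsection \<open>Positive elements of a C*-algebra\<close>

text \<open>Positivity is measured among the multipliers, where a unit is available; the square root
  found there need not lie in the algebra. By \<open>cnonneg_star_mult\<close> it covers every
  \<open>cpositive\<close> element.\<close>

definition cnonneg :: "'a::cstar_algebra \<Rightarrow> bool" where
  "cnonneg a \<longleftrightarrow> psd (lmult a)"

lemma cnonneg_0: "cnonneg 0"
  by (simp add: cnonneg_def lmult_0 psd_0)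

lemma cnonneg_add: "cnonneg a \<Longrightarrow> cnonneg b \<Longrightarrow> cnonneg (a + b)"
  by (simp add: cnonneg_def lmult_add psd_add)

lemma cnonneg_scaleR: "0 \<le> r \<Longrightarrow> cnonneg a \<Longrightarrow> cnonneg (r *\<^sub>R a)"
  by (simp add: cnonneg_def lmult_scaleR psd_scaleR)

lemma cnonneg_star_mult: "cnonneg (cadj x * x)"
  by (simp add: cnonneg_def lmult_mult lmult_cadj psd_star_mult)

lemma closed_cnonneg: "closed {a. cnonneg a}"
  unfolding cnonneg_def
  using continuous_closed_vimage[OF closed_psd, of lmult]
    linear_continuous_at[OF bounded_linear_lmult] by (auto simp: vimage_def)

lemma cnonneg_compress: "cnonneg p \<Longrightarrow> cnonneg (cadj x * p * x)"
  by (simp add: cnonneg_def lmult_mult lmult_cadj psd_compress)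

lemma cnonneg_norm_le_add: "cnonneg p \<Longrightarrow> cnonneg q \<Longrightarrow> norm p \<le> norm (p + q)"
  using psd_norm_le_add[of "lmult p" "lmult q"] by (simp add: cnonneg_def lmult_add[symmetric])

lemma cnonneg_norm_mono: "cnonneg p \<Longrightarrow> cnonneg (q - p) \<Longrightarrow> norm p \<le> norm q"
  using cnonneg_norm_le_add[of p "q - p"] by simp

lemma cnonneg_norm_mult_le: "cnonneg p \<Longrightarrow> (norm (p * d))\<^sup>2 \<le> norm p * norm (cadj d * p * d)"
  using psd_norm_mult_le[of "lmult p" "lmult d"]
  by (simp add: cnonneg_def lmult_mult[symmetric] lmult_cadj[symmetric])

lemma cnonneg_selfadj:
  assumes "cnonneg p"
  shows "cadj p = p"
proof -
  have "norm (lmult (cadj p - p)) = 0"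
    using psd_selfadj[of "lmult p"] assms by (simp add: cnonneg_def lmult_diff lmult_cadj del: norm_lmult)
  then show ?thesis by simp
qed

text \<open>At \<open>d = p\<close> the Cauchy-Schwarz estimate reads
  \<open>(norm p)^4 <= norm p * (M * (norm p)^2)\<close>.\<close>

lemma cnonneg_norm_le_form_bound:
  assumes "cnonneg p" and "0 \<le> M" and M: "\<And>d. norm (cadj d * p * d) \<le> M * (norm d)\<^sup>2"
  shows "norm p \<le> M"
proof (cases "p = 0")
  case True
  then show ?thesis using \<open>0 \<le> M\<close> by simp
next
  case False
  have sa: "cadj p = p" using assms cnonneg_selfadj by blast
  have "(norm p)\<^sup>2 * (norm p)\<^sup>2 = (norm (p * p))\<^sup>2"
    by (simp add: norm_square_selfadj[OF sa] power2_eq_square)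
  also have "\<dots> \<le> norm p * (M * (norm p)\<^sup>2)"
    using cnonneg_norm_mult_le[OF assms(1), of p] mult_left_mono[OF M[of p] norm_ge_zero[of p]]
    by (simp add: mult.assoc sa)
  also have "\<dots> = (norm p)\<^sup>2 * (norm p * M)" by (simp add: mult_ac)
  finally have "(norm p)\<^sup>2 \<le> norm p * M" by (rule mult_left_le_imp_le) (use False in simp)
  then show ?thesis using False by (simp add: power2_eq_square)
qed

text \<open>Writes the form as the squared norm of a linear operator, because uniform boundedness
  speaks about linear operators.\<close>

lemma cnonneg_sqrt_op:
  fixes p :: "'a::cstar_algebra"
  assumes "cnonneg p"
  obtains k :: "'a \<Rightarrow>\<^sub>L 'a" where "\<And>d. (norm (k d))\<^sup>2 = norm (cadj d * p * d)"
proof -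
  obtain k where k: "cadj k = k" "lmult p = k * k"
    using assms by (auto simp: cnonneg_def psd_def)
  have "(norm (mult_op k d))\<^sup>2 = norm (cadj d * p * d)" for d
  proof -
    have "cadj (mult_op k d) * mult_op k d = cadj d * mult_adj_op k (mult_op k d)"
      using adjoint_pair_mult_op[of k] by (simp add: adjoint_pair_def)
    also have "mult_adj_op k (mult_op k d) = mult_op (k * k) d"
      by (simp add: mult_op_simps) (metis k(1) mult_op_cadj)
    also have "\<dots> = p * d" by (simp add: k(2)[symmetric])
    finally show ?thesis by (simp add: cstar_identity[symmetric] mult.assoc)
  qed
  then show ?thesis by (rule that)
qed

text \<open>With \<open>p = x x\<^sup>*\<close> and \<open>u = 1 - p\<close>, the averages \<open>v\<close> of the first \<open>N\<close> powers of \<open>u\<close>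
satisfy \<open>p v = (1 - u\<^sup>N) / N\<close>, hence \<open>\<parallel>v x\<parallel>\<^sup>2 = \<parallel>v p v\<parallel> \<le> 2 / N\<close>, whereas \<open>1 - v\<close> belongs
to the algebra.\<close>
lemma approx_left_unit:
  fixes x :: "'a::cstar_algebra"
  assumes "0 < e"
  shows "\<exists>u. norm (x - u * x) < e"
proof -
  have unit_ball: "\<exists>u. norm (x - u * x) < e" if x: "norm x \<le> 1" and e: "0 < e" for x :: 'a and e
  proof -
    define X where "X = lmult x"
    define p where "p = X * cadj X"
    define U where "U = 1 - p"
    obtain k where k: "cadj k = k" "p = k * k"
      using psd_star_mult[of "cadj X"] by (auto simp: psd_def p_def cadj_cadj)
    have "(norm k)\<^sup>2 \<le> 1"
      using norm_mult_cadj[of X] power_le_one[OF norm_ge_zero x, of 2] norm_square_selfadj[OF k(1)]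
      unfolding p_def[symmetric] k(2)[symmetric] by (simp add: X_def)
    then have "norm k \<le> 1" by (simp add: power2_le_imp_le)
    then have nU: "norm U \<le> 1"
      unfolding U_def k(2) by (rule norm_one_minus_square_le[OF k(1)])
    have nUj: "norm (U ^ j) \<le> 1" for j
    proof (induction j)
      case (Suc j)
      then show ?case
        using order_trans[OF norm_mult_ineq mult_mono[OF nU Suc]] by simp
    qed (simp add: norm_1_le)
    have saU: "cadj (U ^ j) = U ^ j" for j
    proof (induction j)
      case (Suc j)
      have "cadj U = U" by (simp add: U_def p_def cadj_diff cadj_mult cadj_cadj)
      with Suc show ?case by (simp add: cadj_mult power_commutes)
    qed simp
    \<comment> \<open>With this threshold \<open>2 / N < e^2\<close>, which bounds
      \<open>(norm (v * X))^2\<close>.\<close>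
    obtain N :: nat where N: "2 / e\<^sup>2 < real N" using reals_Archimedean2 by blast
    have N0: "0 < real N" using N e by (smt (verit) divide_pos_pos zero_less_power)
    define s where "s = (\<Sum>j<N. U ^ j)"
    define v where "v = (1 / real N) *\<^sub>R s"
    have ps: "p * (\<Sum>j<n. U ^ j) = 1 - U ^ n" for n
    proof (induction n)
      case (Suc n)
      then show ?case by (simp add: U_def[symmetric] distrib_left) (simp add: U_def left_diff_distrib)
    qed simp
    have "norm s \<le> real N"
      unfolding s_def using sum_norm_le[of "{..<N}" "\<lambda>j. U ^ j" "\<lambda>_. 1"] nUj by simp
    then have nv: "norm v \<le> 1" using N0 by (simp add: v_def)
    have sav: "cadj v = v"
    proof -
      have "cadj (\<Sum>j<n. U ^ j) = (\<Sum>j<n. U ^ j)" for n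
        by (induction n) (simp_all add: cadj_add saU)
      then show ?thesis by (simp add: v_def s_def cadj_scaleR)
    qed
    have npv: "norm (p * v) \<le> 2 / real N"
    proof -
      have "norm (1 - U ^ N) \<le> 2"
        using norm_triangle_ineq4[of 1 "U ^ N"] nUj[of N] norm_1_le[where 'u = "'a multiplier"] by linarith
      moreover have "p * v = (1 / real N) *\<^sub>R (1 - U ^ N)" by (simp add: v_def s_def ps)
      ultimately show ?thesis using N0 by (simp add: divide_right_mono)
    qed
    have "(norm (v * X))\<^sup>2 = norm (v * (p * v))"
      using norm_mult_cadj[of "v * X"] by (simp add: cadj_mult sav p_def mult.assoc)
    also have "\<dots> \<le> 1 * (2 / real N)"
      by (rule order_trans[OF norm_mult_ineq mult_mono[OF nv npv]]) auto
    also have "\<dots> < e\<^sup>2" using N N0 e by (simp add: field_simps)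
    finally have small: "norm (v * X) < e" using e by (simp add: power_less_imp_less_base)
    \<comment> \<open>By induction: \<open>1 - U ^ Suc j\<close> differs from
      \<open>1 - U ^ j\<close> by \<open>U ^ j * p\<close>, and \<open>p\<close> lies in the
      embedded algebra, a left ideal.\<close>
    have "\<exists>a. 1 - U ^ j = lmult a" for j
    proof (induction j)
      case 0
      show ?case by (rule exI[of _ 0]) (simp add: lmult_0)
    next
      case (Suc j)
      then obtain a where a: "1 - U ^ j = lmult a" by blast
      have "1 - U ^ Suc j = (1 - U ^ j) + U ^ j * p"
        unfolding power_Suc2 by (simp add: U_def right_diff_distrib)
      also have "\<dots> = lmult (a + mult_op (U ^ j) (x * cadj x))"
        by (simp add: a p_def X_def lmult_cadj[symmetric] lmult_mult[symmetric] mult_lmult lmult_add)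
      finally show ?case by blast
    qed
    then obtain a where a: "\<And>j. 1 - U ^ j = lmult (a j)" by metis
    have "(\<Sum>j<n. 1 - U ^ j) = lmult (\<Sum>j<n. a j)" for n
      by (induction n) (simp_all add: lmult_0 lmult_add a)
    then have "real N *\<^sub>R 1 - s = lmult (\<Sum>j<N. a j)"
      unfolding s_def by (simp add: sum_subtractf sum_constant_scaleR)
    then have "(1 / real N) *\<^sub>R (real N *\<^sub>R 1 - s) = lmult ((1 / real N) *\<^sub>R (\<Sum>j<N. a j))"
      by (simp add: lmult_scaleR)
    then have "1 - v = lmult ((1 / real N) *\<^sub>R (\<Sum>j<N. a j))"
      using N0 by (simp add: v_def scaleR_diff_right)
    then obtain u where u: "1 - v = lmult u" by blast
    then have "v = 1 - lmult u" by (metis diff_diff_eq2 add_diff_cancel_left')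
    then have "v * X = lmult (x - u * x)"
      by (simp add: X_def left_diff_distrib lmult_diff lmult_mult)
    then show ?thesis using small by auto
  qed
  define r where "r = norm x + 1"
  have r: "r > 0" by (simp add: r_def add_nonneg_pos)
  have "norm ((1/r) *\<^sub>R x) \<le> 1" using r by (simp add: r_def)
  moreover have "0 < e / r" using r assms by simp
  ultimately obtain u where u: "norm ((1/r) *\<^sub>R x - u * ((1/r) *\<^sub>R x)) < e / r"
    using unit_ball by blast
  have "(1/r) *\<^sub>R x - u * ((1/r) *\<^sub>R x) = (1/r) *\<^sub>R (x - u * x)"
    by (simp add: scaleR_diff_right)
  then have "norm ((1/r) *\<^sub>R x - u * ((1/r) *\<^sub>R x)) = \<bar>1/r\<bar> * norm (x - u * x)"
    by (simp only: norm_scaleR)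
  with u r have "norm (x - u * x) < e" by (simp add: field_simps)
  then show ?thesis by blast
qed


subsection \<open>Norming functionals\<close>

definition sublinear :: "('a::real_vector \<Rightarrow> real) \<Rightarrow> bool" where
  "sublinear q \<longleftrightarrow> (\<forall>x y. q (x + y) \<le> q x + q y) \<and> (\<forall>t x. 0 \<le> t \<longrightarrow> q (t *\<^sub>R x) \<le> t * q x)"

lemma sublinear_add: "sublinear q \<Longrightarrow> q (x + y) \<le> q x + q y"
  and sublinear_scaleR: "sublinear q \<Longrightarrow> 0 \<le> t \<Longrightarrow> q (t *\<^sub>R x) \<le> t * q x"
  by (simp_all add: sublinear_def)

lemma sublinear_0: "sublinear q \<Longrightarrow> q 0 = 0"
  using sublinear_scaleR[of q 0 0] sublinear_add[of q 0 0] by simp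

lemma sublinear_scaleR_eq:
  assumes q: "sublinear q" and t: "0 \<le> t"
  shows "q (t *\<^sub>R x) = t * q x"
proof (cases "t = 0")
  case False
  then have "q x \<le> (1/t) * q (t *\<^sub>R x)"
    using sublinear_scaleR[OF q, of "1/t" "t *\<^sub>R x"] t by simp
  then have "t * q x \<le> q (t *\<^sub>R x)" using False t by (simp add: field_simps)
  then show ?thesis using sublinear_scaleR[OF q t, of x] by linarith
qed (simp add: sublinear_0 q)

lemma sublinear_neg: "sublinear q \<Longrightarrow> - q (- x) \<le> q x"
  using sublinear_add[of q x "-x"] sublinear_0[of q] by simp

text \<open>Lowers \<open>q\<close> in the direction \<open>- y\<close>: the choice
  \<open>t = 1\<close> gives \<open>tilt q y (- y) <= - q y\<close>, so a linear functional below
  the tilt is at least \<open>q y\<close> at \<open>y\<close>.\<close>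

definition tilt :: "('a::real_vector \<Rightarrow> real) \<Rightarrow> 'a \<Rightarrow> 'a \<Rightarrow> real" where
  "tilt q y x = (INF t\<in>{0..}. q (x + t *\<^sub>R y) - t * q y)"

lemma tilt_le:
  assumes q: "sublinear q" and t: "0 \<le> t"
  shows "tilt q y x \<le> q (x + t *\<^sub>R y) - t * q y"
  unfolding tilt_def
proof (rule cINF_lower)
  have "- q (- x) \<le> q (x + s *\<^sub>R y) - s * q y" if "0 \<le> s" for s
    using sublinear_add[OF q, of "x + s *\<^sub>R y" "- x"] sublinear_scaleR_eq[OF q that, of y] by simp
  then show "bdd_below ((\<lambda>t. q (x + t *\<^sub>R y) - t * q y) ` {0..})"
    by (intro bdd_belowI[of _ "- q (- x)"]) auto
qed (use t in auto)

lemma tilt_greatest: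
  "(\<And>t. 0 \<le> t \<Longrightarrow> c \<le> q (x + t *\<^sub>R y) - t * q y) \<Longrightarrow> c \<le> tilt q y x"
  unfolding tilt_def by (rule cINF_greatest) auto

lemma tilt_le_self: "sublinear q \<Longrightarrow> tilt q y x \<le> q x"
  using tilt_le[of q 0 y x] by simp

lemma sublinear_tilt:
  assumes q: "sublinear q"
  shows "sublinear (tilt q y)"
  unfolding sublinear_def
proof (intro conjI allI impI)
  fix x z
  have "tilt q y (x + z) \<le> (q (x + t *\<^sub>R y) - t * q y) + (q (z + s *\<^sub>R y) - s * q y)"
    if "0 \<le> t" "0 \<le> s" for s t
    using tilt_le[OF q, of "t + s" y "x + z"] that
      sublinear_add[OF q, of "x + t *\<^sub>R y" "z + s *\<^sub>R y"] by (simp add: algebra_simps)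
  then have "tilt q y (x + z) - (q (z + s *\<^sub>R y) - s * q y) \<le> tilt q y x" if "0 \<le> s" for s
    using that by (intro tilt_greatest) (simp add: algebra_simps)
  then have "tilt q y (x + z) - tilt q y x \<le> tilt q y z"
    by (intro tilt_greatest) (simp add: algebra_simps)
  then show "tilt q y (x + z) \<le> tilt q y x + tilt q y z" by simp
next
  fix t :: real and x assume t: "0 \<le> t"
  show "tilt q y (t *\<^sub>R x) \<le> t * tilt q y x"
  proof (cases "t = 0")
    case True
    then show ?thesis using tilt_le_self[OF q, of y 0] sublinear_0[OF q] by simp
  next
    case False
    with t have t: "t > 0" by simp
    have "(1/t) * tilt q y (t *\<^sub>R x) \<le> tilt q y x"
    proof (rule tilt_greatest)
      fix s :: real assume s: "0 \<le> s"
      have "tilt q y (t *\<^sub>R x) \<le> q (t *\<^sub>R (x + s *\<^sub>R y)) - (t * s) * q y"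
        using tilt_le[OF q, of "t * s" y "t *\<^sub>R x"] s t by (simp add: scaleR_add_right)
      also have "\<dots> = t * (q (x + s *\<^sub>R y) - s * q y)"
        using sublinear_scaleR_eq[OF q, of t "x + s *\<^sub>R y"] t by (simp add: algebra_simps)
      finally show "(1/t) * tilt q y (t *\<^sub>R x) \<le> q (x + s *\<^sub>R y) - s * q y"
        using t by (simp add: field_simps)
    qed
    then show ?thesis using t by (simp add: field_simps)
  qed
qed

text \<open>A minimal sublinear functional \<open>m\<close> coincides with all its tilts, whence
\<open>m x + m y \<le> m (x + y)\<close>.\<close>
lemma sublinear_dominates_linear:
  fixes p :: "'a::real_vector \<Rightarrow> real"
  assumes p: "sublinear p"
  shows "\<exists>f. linear f \<and> (\<forall>x. f x \<le> p x)"
proof -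
  define A where "A = {q. sublinear q \<and> q \<le> p}"
  have "\<exists>m\<in>A. \<forall>a\<in>A. a \<le> m \<longrightarrow> a = m"
  \<comment> \<open>Zorn's lemma for the reversed order, so that bounds of chains are pointwise
    lower bounds.\<close>
  proof (rule predicate_Zorn[of A "\<lambda>x y. y \<le> x"])
    show "partial_order_on A (relation_of (\<lambda>x y. y \<le> x) A)"
      by (auto simp: partial_order_on_def preorder_on_def refl_on_def trans_def antisym_def relation_of_def)
    fix C assume C: "C \<in> Chains (relation_of (\<lambda>x y. y \<le> x) A)"
    show "\<exists>u\<in>A. \<forall>a\<in>C. u \<le> a"
    proof (cases "C = {}")
      case True
      then show ?thesis using p by (auto simp: A_def)
    next
      case False
      have CA: "q \<in> A" if "q \<in> C" for q using C that by (auto simp: Chains_def relation_of_def)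
      have total: "q \<le> r \<or> r \<le> q" if "q \<in> C" "r \<in> C" for q r
        using C that by (auto simp: Chains_def relation_of_def)
      define u where "u x = (INF q\<in>C. q x)" for x
      have u_le: "u x \<le> q x" if "q \<in> C" for q x
        unfolding u_def
      proof (rule cINF_lower[OF _ that])
        \<comment> \<open>A lower bound shared by all members of the chain, which makes the
          pointwise infimum meaningful.\<close>
        have "- p (- x) \<le> r x" if "r \<in> C" for r
          using CA[OF that] sublinear_neg[of r x] by (auto simp: A_def le_fun_def) (meson neg_le_iff_le order_trans)
        then show "bdd_below ((\<lambda>q. q x) ` C)" by (intro bdd_belowI[of _ "- p (- x)"]) auto
      qed
      have u_greatest: "c \<le> u x" if "\<And>q. q \<in> C \<Longrightarrow> c \<le> q x" for c x
        unfolding u_def using False that by (intro cINF_greatest)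
      have "sublinear u"
        unfolding sublinear_def
      proof (intro conjI allI impI)
        fix x y
        have "u (x + y) \<le> q x + r y" if qr: "q \<in> C" "r \<in> C" for q r
        proof -
          \<comment> \<open>Subadditivity survives the infimum because one member of the chain lies
            below both \<open>q\<close> and \<open>r\<close>.\<close>
          obtain s where s: "s \<in> C" "s \<le> q" "s \<le> r" using total[OF qr] qr by blast
          have "u (x + y) \<le> s (x + y)" by (rule u_le[OF s(1)])
          also have "\<dots> \<le> s x + s y" using CA[OF s(1)] by (auto simp: A_def sublinear_add)
          also have "\<dots> \<le> q x + r y" using s by (simp add: le_fun_def add_mono)
          finally show ?thesis .
        qed
        then have "u (x + y) - r y \<le> u x" if "r \<in> C" for r
          using that by (intro u_greatest) (simp add: algebra_simps)
        then have "u (x + y) - u x \<le> u y" by (intro u_greatest) (simp add: algebra_simps)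
        then show "u (x + y) \<le> u x + u y" by simp
      next
        fix t :: real and x assume t: "0 \<le> t"
        show "u (t *\<^sub>R x) \<le> t * u x"
        proof (cases "t = 0")
          case True
          obtain q where "q \<in> C" using False by blast
          then show ?thesis using u_le[of q 0] CA[of q] True by (auto simp: A_def sublinear_0)
        next
          case False
          with t have t: "t > 0" by simp
          have "(1/t) * u (t *\<^sub>R x) \<le> u x"
          proof (rule u_greatest)
            fix q assume q: "q \<in> C"
            have "u (t *\<^sub>R x) \<le> t * q x"
              using u_le[OF q, of "t *\<^sub>R x"] CA[OF q] t by (auto simp: A_def sublinear_scaleR_eq)
            then show "(1/t) * u (t *\<^sub>R x) \<le> q x" using t by (simp add: field_simps)
          qed
          then show ?thesis using t by (simp add: field_simps)
        qed
      qed
      moreover have "u \<le> p"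
        using False u_le CA by (fastforce simp: A_def le_fun_def intro: order_trans)
      ultimately show ?thesis using u_le by (auto simp: A_def le_fun_def)
    qed
  qed
  then obtain m where m: "sublinear m" "m \<le> p" "\<And>q. sublinear q \<Longrightarrow> q \<le> m \<Longrightarrow> q = m"
    by (auto simp: A_def intro: order_trans)
  have "tilt m y = m" for y
    by (rule m(3)) (auto simp: le_fun_def sublinear_tilt tilt_le_self m(1))
  then have "m x \<le> m (x + y) - m y" for x y
    using tilt_le[OF m(1), of 1 y x] by simp
  then have add: "m (x + y) = m x + m y" for x y
    using sublinear_add[OF m(1), of x y] by (smt (verit))
  have neg: "m (- x) = - m x" for x
    using add[of x "-x"] sublinear_0[OF m(1)] by simp
  have "m (t *\<^sub>R x) = t * m x" for t x
  proof (cases "0 \<le> t")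
    case False
    then have "m ((- t) *\<^sub>R x) = (- t) * m x" by (intro sublinear_scaleR_eq m) simp
    then show ?thesis by (simp add: neg)
  qed (simp add: sublinear_scaleR_eq m)
  then have "linear m" by (intro linearI) (simp_all add: add)
  then show ?thesis using m(2) by (auto simp: le_fun_def)
qed

text \<open>A linear functional below the tilt of the norm at \<open>z\<close> satisfies
  \<open>f (- z) <= - norm z\<close>, hence \<open>f z = norm z\<close>.\<close>

lemma norming_functional:
  fixes z :: "'a::real_normed_vector"
  obtains \<phi> :: "'a \<Rightarrow> real"
  where "bounded_linear \<phi>" "\<And>x. \<bar>\<phi> x\<bar> \<le> norm x" "\<phi> z = norm z"
proof -
  have n: "sublinear (norm :: 'a \<Rightarrow> real)" by (simp add: sublinear_def norm_triangle_ineq)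
  obtain f where f: "linear f" "\<And>x. f x \<le> tilt norm z x"
    using sublinear_dominates_linear[OF sublinear_tilt[OF n]] by blast
  have le: "f x \<le> norm x" for x using f(2) tilt_le_self[OF n] order_trans by blast
  have neg: "f (- x) = - f x" for x using f(1) by (rule linear_neg)
  have bound: "\<bar>f x\<bar> \<le> norm x" for x
    using le[of x] le[of "-x"] by (simp add: neg abs_le_iff)
  have "f (- z) \<le> - norm z"
    using f(2)[of "-z"] tilt_le[OF n, of 1 z "-z"] by simp
  then have "f z = norm z" using le[of z] by (simp add: neg)
  moreover have "bounded_linear f"
    using f(1) bound by (intro linear_conv_bounded_linear[THEN iffD1] bounded_linear_intro[where K=1])
      (auto simp: linear_add linear_scale)
  ultimately show ?thesis using that bound by blast
qed

subsection \<open>Weak integrals\<close>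

definition has_weak_integral :: "'g measure \<Rightarrow> ('g \<Rightarrow> 'a::real_normed_vector) \<Rightarrow> 'a \<Rightarrow> bool" where
  "has_weak_integral \<mu> f I \<longleftrightarrow> (\<forall>\<phi>::'a \<Rightarrow> real. bounded_linear \<phi> \<longrightarrow>
     integrable \<mu> (\<lambda>x. \<phi> (f x)) \<and> \<phi> I = integral\<^sup>L \<mu> (\<lambda>x. \<phi> (f x)))"

lemma has_weak_integralD:
  fixes \<phi> :: "'a::real_normed_vector \<Rightarrow> real"
  shows "has_weak_integral \<mu> f I \<Longrightarrow> bounded_linear \<phi> \<Longrightarrow>
    integrable \<mu> (\<lambda>x. \<phi> (f x)) \<and> \<phi> I = integral\<^sup>L \<mu> (\<lambda>x. \<phi> (f x))"
  unfolding has_weak_integral_def by blast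

lemma has_weak_integral_unique:
  fixes f :: "'g \<Rightarrow> 'a::real_normed_vector"
  assumes "has_weak_integral \<mu> f I" "has_weak_integral \<mu> f J"
  shows "I = J"
proof -
  obtain \<phi> where \<phi>: "bounded_linear \<phi>" "\<And>x. \<bar>\<phi> x\<bar> \<le> norm x" "\<phi> (I - J) = norm (I - J)"
    using norming_functional[of "I - J"] by blast
  have "\<phi> I = \<phi> J"
    using assms[THEN has_weak_integralD, OF \<phi>(1)] by simp
  then have "norm (I - J) = 0"
    using \<phi>(3) linear_diff[OF bounded_linear.linear[OF \<phi>(1)], of I J] by simp
  then show ?thesis by simp
qed

lemma weak_integral_eqI:
  assumes "has_weak_integral \<mu> f I"
  shows "weak_integral \<mu> f = I"
proof -
  have "weak_integral \<mu> f = (THE I. has_weak_integral \<mu> f I)"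
    by (simp only: weak_integral_def has_weak_integral_def)
  also have "\<dots> = I" using assms has_weak_integral_unique[OF _ assms] by (rule the_equality)
  finally show ?thesis .
qed

lemma has_weak_integral_add:
  fixes f g :: "'g \<Rightarrow> 'b::real_normed_vector"
  assumes "has_weak_integral \<mu> f I" "has_weak_integral \<mu> g J"
  shows "has_weak_integral \<mu> (\<lambda>x. f x + g x) (I + J)"
  unfolding has_weak_integral_def
proof (intro allI impI)
  fix \<phi> :: "'b \<Rightarrow> real" assume \<phi>: "bounded_linear \<phi>"
  show "integrable \<mu> (\<lambda>x. \<phi> (f x + g x)) \<and> \<phi> (I + J) = (\<integral>x. \<phi> (f x + g x) \<partial>\<mu>)"
    using assms[THEN has_weak_integralD, OF \<phi>] by (simp add: linear_add[OF bounded_linear.linear[OF \<phi>]])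
qed

lemma has_weak_integral_diff:
  fixes f g :: "'g \<Rightarrow> 'b::real_normed_vector"
  assumes "has_weak_integral \<mu> f I" "has_weak_integral \<mu> g J"
  shows "has_weak_integral \<mu> (\<lambda>x. f x - g x) (I - J)"
  unfolding has_weak_integral_def
proof (intro allI impI)
  fix \<phi> :: "'b \<Rightarrow> real" assume \<phi>: "bounded_linear \<phi>"
  show "integrable \<mu> (\<lambda>x. \<phi> (f x - g x)) \<and> \<phi> (I - J) = (\<integral>x. \<phi> (f x - g x) \<partial>\<mu>)"
    using assms[THEN has_weak_integralD, OF \<phi>] by (simp add: linear_diff[OF bounded_linear.linear[OF \<phi>]])
qed

lemma has_weak_integral_linear:
  fixes T :: "'a::real_normed_vector \<Rightarrow> 'b::real_normed_vector"
  assumes "bounded_linear T" "has_weak_integral \<mu> f I"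
  shows "has_weak_integral \<mu> (\<lambda>x. T (f x)) (T I)"
  unfolding has_weak_integral_def
proof (intro allI impI)
  fix \<phi> :: "'b \<Rightarrow> real" assume "bounded_linear \<phi>"
  then have "bounded_linear (\<lambda>x. \<phi> (T x))" using assms(1) by (rule bounded_linear_compose)
  then show "integrable \<mu> (\<lambda>x. \<phi> (T (f x))) \<and> \<phi> (T I) = (\<integral>x. \<phi> (T (f x)) \<partial>\<mu>)"
    by (rule has_weak_integralD[OF assms(2)])
qed

lemma has_weak_integral_cutoff:
  fixes f :: "'g::{topological_group_add, t2_space} \<Rightarrow> 'a::banach"
  assumes sets_\<mu>: "sets \<mu> = sets borel"
    and fin: "\<And>K. compact K \<Longrightarrow> emeasure \<mu> K < \<infinity>"
    and l: "l \<in> cutoffs" and f: "continuous_on UNIV f"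
  shows "\<exists>I. has_weak_integral \<mu> (\<lambda>x. l x *\<^sub>R f x) I \<and>
    (\<forall>C. closed C \<and> 0 \<in> C \<and> (\<forall>a\<in>C. \<forall>b\<in>C. a + b \<in> C) \<and> (\<forall>r\<ge>0. \<forall>a\<in>C. r *\<^sub>R a \<in> C) \<and> range f \<subseteq> C \<longrightarrow> I \<in> C)"
proof -
  obtain K where K: "compact K" "\<And>x. x \<notin> K \<Longrightarrow> l x = 0"
    and l01: "\<And>x. 0 \<le> l x" "\<And>x. l x \<le> 1" and lm: "l \<in> borel_measurable borel"
    using l by (auto simp: cutoffs_def)
  have KS: "K \<in> sets borel" using K(1) compact_imp_closed borel_closed by blast
  have "bounded (f ` K)"
    by (intro compact_imp_bounded compact_continuous_image K(1)) (rule continuous_on_subset[OF f], simp)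
  then obtain B where B: "\<And>x. x \<in> K \<Longrightarrow> norm (f x) \<le> B" by (auto simp: bounded_iff)
  have meas: "g \<in> borel_measurable borel \<Longrightarrow> g \<in> borel_measurable \<mu>" for g :: "'g \<Rightarrow> real"
    using measurable_cong_sets[OF sets_\<mu> refl] by blast
  have int_bdd: "integrable \<mu> (\<lambda>x. indicator D x * (l x * g x))"
    if D: "D \<in> sets borel" and g: "g \<in> borel_measurable borel" "\<And>x. x \<in> K \<Longrightarrow> \<bar>g x\<bar> \<le> c"
    for D and g :: "'g \<Rightarrow> real" and c
  proof (rule Bochner_Integration.integrable_bound)
    have "integrable \<mu> (indicator K :: 'g \<Rightarrow> real)"
      using KS fin[OF K(1)] by (intro integrable_real_indicator) (simp_all add: sets_\<mu>)
    then show "integrable \<mu> (\<lambda>x. c * indicator K x)" by simp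
    show "(\<lambda>x. indicator D x * (l x * g x)) \<in> borel_measurable \<mu>"
      using D g(1) lm by (intro meas) simp
    have "\<bar>indicator D x * (l x * g x)\<bar> \<le> \<bar>c * indicator K x\<bar>" for x
    proof (cases "x \<in> K")
      case True
      have "\<bar>indicator D x * (l x * g x)\<bar> = (indicator D x * l x) * \<bar>g x\<bar>"
        using l01[of x] by (simp add: abs_mult)
      also have "\<dots> \<le> 1 * \<bar>g x\<bar>"
        using l01[of x] by (intro mult_right_mono) (auto simp: indicator_def)
      finally show ?thesis using g(2)[OF True] True by simp
    qed (simp add: K(2))
    then show "AE x in \<mu>. norm (indicator D x * (l x * g x)) \<le> norm (c * indicator K x)" by simp
  qed
  have int_l: "integrable \<mu> (\<lambda>x. indicator D x * l x)" if "D \<in> sets borel" for D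
    using int_bdd[OF that, of "\<lambda>_. 1" 1] by simp
  have int_\<phi>: "integrable \<mu> (\<lambda>x. indicator D x * (l x * \<phi> (f x)))"
    if D: "D \<in> sets borel" and \<phi>: "bounded_linear \<phi>" for D and \<phi> :: "'a \<Rightarrow> real"
  proof -
    obtain N where N: "N \<ge> 0" "\<And>y. norm (\<phi> y) \<le> norm y * N"
      using bounded_linear.nonneg_bounded[OF \<phi>] by blast
    have "continuous_on UNIV (\<lambda>x. \<phi> (f x))"
      by (rule bounded_linear.continuous_on[OF \<phi> f])
    moreover have "\<bar>\<phi> (f x)\<bar> \<le> B * N" if "x \<in> K" for x
      using N(2)[of "f x"] mult_right_mono[OF B[OF that] N(1)] by simp
    ultimately show ?thesis
      by (intro int_bdd[OF D]) (auto intro: borel_measurable_continuous_onI)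
  qed
  define J where "J = (\<integral>x. indicator K x * l x \<partial>\<mu>)"
  have J0: "0 \<le> J" unfolding J_def using l01 by (intro integral_nonneg_AE) simp
  have l_K: "indicator K x * l x = l x" for x using K(2)[of x] by (auto simp: indicator_def)
  \<comment> \<open>Each induction step removes from \<open>D\<close> the points with values near
    \<open>f p\<close> and gives \<open>p\<close> their mass. The weights are chosen before
    \<open>\<phi>\<close>, so the error bound is uniform over functionals.\<close>
  have step: "\<exists>c. (\<forall>p. 0 \<le> c p) \<and> (\<forall>\<phi> N. bounded_linear \<phi> \<and> 0 \<le> N \<and> (\<forall>y. \<bar>\<phi> y\<bar> \<le> N * norm y) \<longrightarrow>
      \<bar>(\<Sum>p\<in>F. c p * \<phi> (f p)) - (\<integral>x. indicator D x * (l x * \<phi> (f x)) \<partial>\<mu>)\<bar>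
        \<le> N * e * (\<integral>x. indicator D x * l x \<partial>\<mu>))"
    if "finite F" "D \<in> sets borel" "D \<subseteq> (\<Union>p\<in>F. {x. dist (f x) (f p) < e})" "0 < e" for F D e
    using that
  proof (induction F arbitrary: D rule: finite_induct)
    case empty
    then show ?case by (intro exI[of _ "\<lambda>_. 0"]) simp
  next
    case (insert p F)
    define U where "U = {x. dist (f x) (f p) < e}"
    have "open U" unfolding U_def
      by (intro open_Collect_less continuous_intros f)
    then have DU: "D \<inter> U \<in> sets borel" "D - U \<in> sets borel" using insert.prems(1) by auto
    have split: "(\<integral>x. indicator D x * g x \<partial>\<mu>) = (\<integral>x. indicator (D \<inter> U) x * g x \<partial>\<mu>) + (\<integral>x. indicator (D - U) x * g x \<partial>\<mu>)"
      if "\<And>D. D \<in> sets borel \<Longrightarrow> integrable \<mu> (\<lambda>x. indicator D x * g x)" for g :: "'g \<Rightarrow> real"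
    proof -
      have "indicator D x * g x = indicator (D \<inter> U) x * g x + indicator (D - U) x * g x" for x
        by (auto simp: indicator_def)
      then show ?thesis using that DU by simp
    qed
    have "D - U \<subseteq> (\<Union>p\<in>F. {x. dist (f x) (f p) < e})" using insert.prems(2) by (auto simp: U_def)
    from insert.IH[OF DU(2) this insert.prems(3)]
    obtain c where c0: "\<And>q. 0 \<le> c q" and c: "\<And>\<phi> N. bounded_linear \<phi> \<and> 0 \<le> N \<and> (\<forall>y. \<bar>\<phi> y\<bar> \<le> N * norm y) \<Longrightarrow>
      \<bar>(\<Sum>p\<in>F. c p * \<phi> (f p)) - (\<integral>x. indicator (D - U) x * (l x * \<phi> (f x)) \<partial>\<mu>)\<bar>
        \<le> N * e * (\<integral>x. indicator (D - U) x * l x \<partial>\<mu>)" by blast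
    define c' where "c' = c(p := (\<integral>x. indicator (D \<inter> U) x * l x \<partial>\<mu>))"
    show ?case
    proof (intro exI[of _ c'] conjI allI impI)
      fix q
      have "0 \<le> (\<integral>x. indicator (D \<inter> U) x * l x \<partial>\<mu>)" using l01 by (intro integral_nonneg_AE) simp
      then show "0 \<le> c' q" using c0 by (simp add: c'_def)
    next
      fix \<phi> :: "'a \<Rightarrow> real" and N
      assume \<phi>: "bounded_linear \<phi> \<and> 0 \<le> N \<and> (\<forall>y. \<bar>\<phi> y\<bar> \<le> N * norm y)"
      have sum: "(\<Sum>q\<in>insert p F. c' q * \<phi> (f q)) = c' p * \<phi> (f p) + (\<Sum>q\<in>F. c q * \<phi> (f q))"
        using insert.hyps by (simp add: c'_def) (intro sum.cong, auto)
      have i1: "integrable \<mu> (\<lambda>x. indicator (D \<inter> U) x * l x * \<phi> (f p))"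
        using int_l[OF DU(1)] by simp
      have i2: "integrable \<mu> (\<lambda>x. indicator (D \<inter> U) x * (l x * \<phi> (f x)))"
        using int_\<phi>[OF DU(1)] \<phi> by simp
      have "c' p * \<phi> (f p) - (\<integral>x. indicator (D \<inter> U) x * (l x * \<phi> (f x)) \<partial>\<mu>)
        = (\<integral>x. indicator (D \<inter> U) x * l x * \<phi> (f p) \<partial>\<mu>) - (\<integral>x. indicator (D \<inter> U) x * (l x * \<phi> (f x)) \<partial>\<mu>)"
        by (simp add: c'_def)
      also have "\<dots> = (\<integral>x. indicator (D \<inter> U) x * l x * \<phi> (f p) - indicator (D \<inter> U) x * (l x * \<phi> (f x)) \<partial>\<mu>)"
        using i1 i2 by simp
      also have "\<bar>\<dots>\<bar> \<le> (\<integral>x. \<bar>indicator (D \<inter> U) x * l x * \<phi> (f p) - indicator (D \<inter> U) x * (l x * \<phi> (f x))\<bar> \<partial>\<mu>)"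
        by (rule integral_abs_bound)
      also have "\<dots> \<le> (\<integral>x. N * e * (indicator (D \<inter> U) x * l x) \<partial>\<mu>)"
      proof (rule integral_mono)
        show "integrable \<mu> (\<lambda>x. \<bar>indicator (D \<inter> U) x * l x * \<phi> (f p) - indicator (D \<inter> U) x * (l x * \<phi> (f x))\<bar>)"
          using i1 i2 by simp
        show "integrable \<mu> (\<lambda>x. N * e * (indicator (D \<inter> U) x * l x))" using int_l[OF DU(1)] by simp
        fix x
        show "\<bar>indicator (D \<inter> U) x * l x * \<phi> (f p) - indicator (D \<inter> U) x * (l x * \<phi> (f x))\<bar>
          \<le> N * e * (indicator (D \<inter> U) x * l x)"
        proof (cases "x \<in> D \<inter> U")
          case True
          have "\<bar>\<phi> (f p) - \<phi> (f x)\<bar> = \<bar>\<phi> (f p - f x)\<bar>"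
            using \<phi> by (simp add: linear_diff[OF bounded_linear.linear])
          also have "\<dots> \<le> N * norm (f p - f x)" using \<phi> by blast
          also have "\<dots> \<le> N * e"
            using True \<phi> by (intro mult_left_mono) (auto simp: U_def dist_norm norm_minus_commute)
          finally have "l x * \<bar>\<phi> (f p) - \<phi> (f x)\<bar> \<le> l x * (N * e)" using l01(1) by (rule mult_left_mono)
          moreover have "l x * \<bar>\<phi> (f p) - \<phi> (f x)\<bar> = \<bar>l x * \<phi> (f p) - l x * \<phi> (f x)\<bar>"
            using l01(1)[of x] by (simp add: right_diff_distrib[symmetric] abs_mult)
          ultimately show ?thesis using True by (simp add: mult_ac)
        qed simp
      qed
      finally have 1: "\<bar>c' p * \<phi> (f p) - (\<integral>x. indicator (D \<inter> U) x * (l x * \<phi> (f x)) \<partial>\<mu>)\<bar>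
          \<le> N * e * (\<integral>x. indicator (D \<inter> U) x * l x \<partial>\<mu>)" by simp
      have s1: "(\<integral>x. indicator D x * (l x * \<phi> (f x)) \<partial>\<mu>) = (\<integral>x. indicator (D \<inter> U) x * (l x * \<phi> (f x)) \<partial>\<mu>)
          + (\<integral>x. indicator (D - U) x * (l x * \<phi> (f x)) \<partial>\<mu>)"
        by (rule split) (use int_\<phi> \<phi> in blast)
      have s2: "(\<integral>x. indicator D x * l x \<partial>\<mu>) = (\<integral>x. indicator (D \<inter> U) x * l x \<partial>\<mu>)
          + (\<integral>x. indicator (D - U) x * l x \<partial>\<mu>)"
        by (rule split) (rule int_l)
      show "\<bar>(\<Sum>q\<in>insert p F. c' q * \<phi> (f q)) - (\<integral>x. indicator D x * (l x * \<phi> (f x)) \<partial>\<mu>)\<bar>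
        \<le> N * e * (\<integral>x. indicator D x * l x \<partial>\<mu>)"
        unfolding sum s1 s2 distrib_left using 1 c[OF \<phi>] by linarith
    qed
  qed
  define cone where "cone C \<longleftrightarrow> closed C \<and> 0 \<in> C \<and> (\<forall>a\<in>C. \<forall>b\<in>C. a + b \<in> C) \<and>
    (\<forall>r\<ge>0. \<forall>a\<in>C. r *\<^sub>R a \<in> C) \<and> range f \<subseteq> C" for C
  have approx: "\<exists>S. (\<forall>C. cone C \<longrightarrow> S \<in> C) \<and> (\<forall>\<phi> N. bounded_linear \<phi> \<and> 0 \<le> N \<and> (\<forall>y. \<bar>\<phi> y\<bar> \<le> N * norm y) \<longrightarrow>
      \<bar>\<phi> S - (\<integral>x. l x * \<phi> (f x) \<partial>\<mu>)\<bar> \<le> N * e * J)" if e: "0 < e" for e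
  proof -
    have op: "open {x. dist (f x) (f p) < e}" for p
      by (intro open_Collect_less continuous_intros f)
    have "K \<subseteq> (\<Union>p\<in>K. {x. dist (f x) (f p) < e})" using e by force
    then obtain F where F: "finite F" "K \<subseteq> (\<Union>p\<in>F. {x. dist (f x) (f p) < e})"
      using compactE_image[OF K(1), of K "\<lambda>p. {x. dist (f x) (f p) < e}"] op by metis
    obtain c where c0: "\<And>q. 0 \<le> c q" and c: "\<And>\<phi> N. bounded_linear \<phi> \<and> 0 \<le> N \<and> (\<forall>y. \<bar>\<phi> y\<bar> \<le> N * norm y) \<Longrightarrow>
      \<bar>(\<Sum>p\<in>F. c p * \<phi> (f p)) - (\<integral>x. indicator K x * (l x * \<phi> (f x)) \<partial>\<mu>)\<bar> \<le> N * e * J"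
      using step[OF F(1) KS F(2) e] unfolding J_def by blast
    show ?thesis
    proof (intro exI[of _ "\<Sum>p\<in>F. c p *\<^sub>R f p"] conjI allI impI)
      fix C assume C: "cone C"
      show "(\<Sum>p\<in>F. c p *\<^sub>R f p) \<in> C"
      proof -
        have "f p \<in> C" for p using C by (auto simp: cone_def)
        then have "c p *\<^sub>R f p \<in> C" for p using C c0 by (simp add: cone_def)
        note cf = this
        have C0: "0 \<in> C" and Cadd: "\<And>a b. a \<in> C \<Longrightarrow> b \<in> C \<Longrightarrow> a + b \<in> C" using C by (simp_all add: cone_def)
        have "(\<Sum>p\<in>H. c p *\<^sub>R f p) \<in> C" if "finite H" for H
          using that by (induction H rule: finite_induct) (simp_all add: C0 Cadd cf)
        then show ?thesis using F(1) .
      qed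
    next
      fix \<phi> :: "'a \<Rightarrow> real" and N assume \<phi>: "bounded_linear \<phi> \<and> 0 \<le> N \<and> (\<forall>y. \<bar>\<phi> y\<bar> \<le> N * norm y)"
      then have lin: "linear \<phi>" by (simp add: bounded_linear.linear)
      have "\<phi> (\<Sum>p\<in>F. c p *\<^sub>R f p) = (\<Sum>p\<in>F. c p * \<phi> (f p))"
        by (simp add: linear_sum[OF lin] linear_scale[OF lin])
      then show "\<bar>\<phi> (\<Sum>p\<in>F. c p *\<^sub>R f p) - (\<integral>x. l x * \<phi> (f x) \<partial>\<mu>)\<bar> \<le> N * e * J"
        using c[OF \<phi>] by (simp add: mult.assoc[symmetric] l_K)
    qed
  qed
  define e where "e n = 1 / real (Suc n)" for n
  have e0: "0 < e n" for n by (simp add: e_def)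
  have e_lim: "e \<longlonglongrightarrow> 0" unfolding e_def by (rule LIMSEQ_inverse_real_of_nat[unfolded inverse_eq_divide])
  have "\<forall>n. \<exists>S. (\<forall>C. cone C \<longrightarrow> S \<in> C) \<and> (\<forall>\<phi> N. bounded_linear \<phi> \<and> 0 \<le> N \<and> (\<forall>y. \<bar>\<phi> y\<bar> \<le> N * norm y) \<longrightarrow>
      \<bar>\<phi> S - (\<integral>x. l x * \<phi> (f x) \<partial>\<mu>)\<bar> \<le> N * e n * J)"
    using approx[OF e0] by (rule allI)
  from choice[OF this] obtain S where SS: "\<forall>n. (\<forall>C. cone C \<longrightarrow> S n \<in> C) \<and> (\<forall>\<phi> N. bounded_linear \<phi> \<and> 0 \<le> N \<and> (\<forall>y. \<bar>\<phi> y\<bar> \<le> N * norm y) \<longrightarrow>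
      \<bar>\<phi> (S n) - (\<integral>x. l x * \<phi> (f x) \<partial>\<mu>)\<bar> \<le> N * e n * J)" ..
  have S_cone: "S n \<in> C" if "cone C" for n C using spec[OF SS, of n, THEN conjunct1] that by blast
  have S: "\<bar>\<phi> (S n) - (\<integral>x. l x * \<phi> (f x) \<partial>\<mu>)\<bar> \<le> N * e n * J"
    if "bounded_linear \<phi>" "0 \<le> N" "\<And>y. \<bar>\<phi> y\<bar> \<le> N * norm y" for n \<phi> N
    using spec[OF SS, of n, THEN conjunct2, rule_format, of \<phi> N] that by blast
  \<comment> \<open>The uniform estimate, applied to a functional norming the difference, becomes an
    estimate in norm.\<close>
  have S_diff: "norm (S m - S n) \<le> (e m + e n) * J" for m n
  proof -
    obtain \<phi> where \<phi>: "bounded_linear \<phi>" "\<And>x. \<bar>\<phi> x\<bar> \<le> norm x" "\<phi> (S m - S n) = norm (S m - S n)"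
      using norming_functional[of "S m - S n"] by blast
    have "\<bar>\<phi> (S k) - (\<integral>x. l x * \<phi> (f x) \<partial>\<mu>)\<bar> \<le> e k * J" for k
      using S[OF \<phi>(1), of 1 k] \<phi>(2) by simp
    from this[of m] this[of n] show ?thesis
      using \<phi>(3) linear_diff[OF bounded_linear.linear[OF \<phi>(1)], of "S m" "S n"]
      by (simp add: distrib_right)
  qed
  have "Cauchy S"
  proof (rule metric_CauchyI)
    fix r :: real assume r: "0 < r"
    have "(\<lambda>n. e n * (2 * J)) \<longlonglongrightarrow> 0 * (2 * J)" by (intro tendsto_intros e_lim)
    then have "\<forall>\<^sub>F n in sequentially. e n * (2 * J) < r" using r by (auto intro: order_tendstoD)
    then obtain M where M: "e M * (2 * J) < r" by (auto simp: eventually_sequentially)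
    have "dist (S m) (S n) < r" if "M \<le> m" "M \<le> n" for m n
    proof -
      have "e m \<le> e M" "e n \<le> e M" using that by (auto simp: e_def frac_le)
      then have "(e m + e n) * J \<le> (e M + e M) * J" using J0 by (intro mult_right_mono) auto
      then show ?thesis using S_diff[of m n] M by (simp add: dist_norm)
    qed
    then show "\<exists>M. \<forall>m\<ge>M. \<forall>n\<ge>M. dist (S m) (S n) < r" by blast
  qed
  then obtain I where I: "S \<longlonglongrightarrow> I" using Cauchy_convergent convergent_def by blast
  show ?thesis
  proof (intro exI[of _ I] conjI allI impI)
    show "has_weak_integral \<mu> (\<lambda>x. l x *\<^sub>R f x) I"
      unfolding has_weak_integral_def
    proof (intro allI impI conjI)
      fix \<phi> :: "'a \<Rightarrow> real" assume \<phi>: "bounded_linear \<phi>"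
      have lin: "\<phi> (l x *\<^sub>R f x) = l x * \<phi> (f x)" for x
        using linear_scale[OF bounded_linear.linear[OF \<phi>]] by simp
      show "integrable \<mu> (\<lambda>x. \<phi> (l x *\<^sub>R f x))"
        using int_\<phi>[OF KS \<phi>] by (simp add: mult.assoc[symmetric] l_K lin)
      obtain N where N: "N \<ge> 0" "\<And>y. norm (\<phi> y) \<le> norm y * N"
        using bounded_linear.nonneg_bounded[OF \<phi>] by blast
      have "(\<lambda>n. \<phi> (S n) - (\<integral>x. l x * \<phi> (f x) \<partial>\<mu>)) \<longlonglongrightarrow> 0"
      proof (rule Lim_null_comparison)
        show "\<forall>\<^sub>F n in sequentially. norm (\<phi> (S n) - (\<integral>x. l x * \<phi> (f x) \<partial>\<mu>)) \<le> N * e n * J"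
          using S[OF \<phi> N(1)] N(2) by (intro always_eventually) (simp add: mult.commute)
        have "(\<lambda>n. N * e n * J) \<longlonglongrightarrow> N * 0 * J" by (intro tendsto_intros e_lim)
        then show "(\<lambda>n. N * e n * J) \<longlonglongrightarrow> 0" by simp
      qed
      then have "(\<lambda>n. \<phi> (S n)) \<longlonglongrightarrow> (\<integral>x. l x * \<phi> (f x) \<partial>\<mu>)" by (simp add: LIM_zero_iff)
      moreover have "(\<lambda>n. \<phi> (S n)) \<longlonglongrightarrow> \<phi> I" by (rule bounded_linear.tendsto[OF \<phi> I])
      ultimately show "\<phi> I = (\<integral>x. \<phi> (l x *\<^sub>R f x) \<partial>\<mu>)" using LIMSEQ_unique by (simp add: lin)
    qed
  next
    fix C assume "closed C \<and> 0 \<in> C \<and> (\<forall>a\<in>C. \<forall>b\<in>C. a + b \<in> C) \<and> (\<forall>r\<ge>0. \<forall>a\<in>C. r *\<^sub>R a \<in> C) \<and> range f \<subseteq> C"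
    then have "cone C" "closed C" by (auto simp: cone_def)
    then show "I \<in> C" using closed_sequentially[OF _ _ I] S_cone by blast
  qed
qed


subsection \<open>Uniform boundedness\<close>

text \<open>By Baire some \<open>A n\<close> contains a ball of radius \<open>r\<close>. For
  \<open>norm z = r\<close> the vector \<open>T i z\<close> is a difference of two values of norm at
  most \<open>n\<close>, whence the bound \<open>2 n / r\<close>.\<close>

theorem banach_steinhaus:
  fixes T :: "'i \<Rightarrow> 'a::banach \<Rightarrow>\<^sub>L 'b::real_normed_vector"
  assumes bdd: "\<And>x. \<exists>B. \<forall>i\<in>I. norm (T i x) \<le> B"
  shows "\<exists>M\<ge>0. \<forall>i\<in>I. norm (T i) \<le> M"
proof -
  define A where "A n = {x. \<forall>i\<in>I. norm (T i x) \<le> real n}" for n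
  have closed_A: "closed (A n)" for n
  proof -
    have "A n = (\<Inter>i\<in>I. {x. norm (T i x) \<le> real n})" by (auto simp: A_def)
    then show ?thesis by (simp add: closed_INT closed_Collect_le continuous_intros)
  qed
  have "\<Union>(range A) = UNIV"
  proof (intro equalityI subsetI UNIV_I)
    fix x
    obtain B where B: "\<forall>i\<in>I. norm (T i x) \<le> B" using bdd by blast
    obtain n where "B \<le> real n" using real_arch_simple by blast
    then have "x \<in> A n" using B by (auto simp: A_def intro: order_trans)
    then show "x \<in> \<Union>(range A)" by blast
  qed
  moreover have "interior (\<Union>(range A)) = {}" if "\<And>n. interior (A n) = {}"
    using Met_TC.metric_Baire_category_alt[of "range A"] closed_A that
    by (auto simp: mcomplete_iff_complete complete_UNIV)
  ultimately obtain n x where "x \<in> interior (A n)" by (metis interior_UNIV UNIV_I empty_iff equals0I)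
  then obtain r where r: "r > 0" "cball x r \<subseteq> A n"
    by (meson mem_interior_cball)
  have "norm (T i) \<le> 2 * real n / r" if i: "i \<in> I" for i
  proof (rule norm_blinfun_bound)
    fix y
    show "norm (T i y) \<le> 2 * real n / r * norm y"
    proof (cases "y = 0")
      case False
      define z where "z = (r / norm y) *\<^sub>R y"
      have "norm z = r" using False r(1) by (simp add: z_def)
      then have "x + z \<in> A n" "x \<in> A n" using r by (auto simp: subset_iff dist_norm)
      then have "norm (T i (x + z)) \<le> real n" "norm (T i x) \<le> real n" using i by (auto simp: A_def)
      then have "norm (T i (x + z) - T i x) \<le> 2 * real n"
        using norm_triangle_ineq4[of "T i (x + z)" "T i x"] by linarith
      then have "norm (T i z) \<le> 2 * real n" by (simp add: blinfun.add_right)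
      then have "r / norm y * norm (T i y) \<le> 2 * real n" using r(1) by (simp add: z_def blinfun.scaleR_right)
      then show ?thesis using r(1) False by (simp add: field_simps)
    qed simp
  qed (use r in simp)
  then show ?thesis using r(1) by (intro exI[of _ "2 * real n / r"]) auto
qed

subsection \<open>Complex subspaces\<close>

definition complex_subspace :: "'a::cstar_algebra set \<Rightarrow> bool" where
  "complex_subspace S \<longleftrightarrow> 0 \<in> S \<and> (\<forall>x\<in>S. \<forall>y\<in>S. x + y \<in> S) \<and> (\<forall>a. \<forall>x\<in>S. cscale a x \<in> S)"

lemma cspan_least:
  assumes "complex_subspace D" "S \<subseteq> D"
  shows "cspan S \<subseteq> D"
proof
  fix x assume "x \<in> cspan S"
  then obtain T c where T: "finite T" "T \<subseteq> S" "x = (\<Sum>v\<in>T. cscale (c v) v)"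
    by (auto simp: cspan_def)
  have "(\<Sum>v\<in>T. cscale (c v) v) \<in> D" using T(1,2)
    by (induction T rule: finite_induct) (use assms in \<open>auto simp: complex_subspace_def\<close>)
  then show "x \<in> D" by (simp add: T(3))
qed

lemma cspan_superset: "S \<subseteq> cspan S"
proof
  fix x assume "x \<in> S"
  then show "x \<in> cspan S"
    unfolding cspan_def by (intro CollectI exI[of _ "{x}"] exI[of _ "\<lambda>_. 1"]) simp
qed

lemma complex_subspace_cspan: "complex_subspace (cspan S)"
  unfolding complex_subspace_def
proof (intro conjI ballI allI)
  show "0 \<in> cspan S"
    unfolding cspan_def by (intro CollectI exI[of _ "{}"] exI[of _ "\<lambda>_. 1"]) simp
next
  fix x y assume "x \<in> cspan S" "y \<in> cspan S"
  then obtain T c U d where T: "finite T" "T \<subseteq> S" "x = (\<Sum>v\<in>T. cscale (c v) v)"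
    and U: "finite U" "U \<subseteq> S" "y = (\<Sum>v\<in>U. cscale (d v) v)"
    unfolding cspan_def by blast
  \<comment> \<open>Padding with zero puts both sums over the same index set.\<close>
  define c' d' where "c' v = (if v \<in> T then c v else 0)" and "d' v = (if v \<in> U then d v else 0)" for v
  have "x = (\<Sum>v\<in>T \<union> U. cscale (c' v) v)"
    unfolding T(3) by (rule sum.mono_neutral_cong_left) (use T U in \<open>auto simp: c'_def\<close>)
  moreover have "y = (\<Sum>v\<in>T \<union> U. cscale (d' v) v)"
    unfolding U(3) by (rule sum.mono_neutral_cong_left) (use T U in \<open>auto simp: d'_def\<close>)
  ultimately have "x + y = (\<Sum>v\<in>T \<union> U. cscale (c' v + d' v) v)"
    by (simp add: cscale_add_left sum.distrib)
  then show "x + y \<in> cspan S"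
    unfolding cspan_def using T U by (intro CollectI exI[of _ "T \<union> U"] exI[of _ "\<lambda>v. c' v + d' v"]) auto
next
  fix a x assume "x \<in> cspan S"
  then obtain T c where T: "finite T" "T \<subseteq> S" "x = (\<Sum>v\<in>T. cscale (c v) v)"
    unfolding cspan_def by blast
  have "cscale a x = (\<Sum>v\<in>T. cscale (a * c v) v)"
    unfolding T(3) by (simp add: cscale_cscale linear_sum[OF bounded_linear.linear[OF bounded_linear_cscale]])
  then show "cscale a x \<in> cspan S"
    unfolding cspan_def using T by (intro CollectI exI[of _ T] exI[of _ "\<lambda>v. a * c v"]) auto
qed

lemma complex_subspace_closure:
  assumes "complex_subspace S"
  shows "complex_subspace (closure S)"
  unfolding complex_subspace_def
proof (intro conjI ballI allI)
  show "0 \<in> closure S" using assms closure_subset by (auto simp: complex_subspace_def)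
next
  fix x y assume "x \<in> closure S" "y \<in> closure S"
  then obtain X Y where X: "\<And>n. X n \<in> S" "X \<longlonglongrightarrow> x" and Y: "\<And>n. Y n \<in> S" "Y \<longlonglongrightarrow> y"
    unfolding closure_sequential by blast
  have "(\<lambda>n. X n + Y n) \<longlonglongrightarrow> x + y" by (intro tendsto_add X Y)
  moreover have "X n + Y n \<in> S" for n using assms X(1) Y(1) by (simp add: complex_subspace_def)
  ultimately show "x + y \<in> closure S" unfolding closure_sequential by (intro exI[of _ "\<lambda>n. X n + Y n"]) simp
next
  fix a x assume "x \<in> closure S"
  then obtain X where X: "\<And>n. X n \<in> S" "X \<longlonglongrightarrow> x"
    unfolding closure_sequential by blast
  have "(\<lambda>n. cscale a (X n)) \<longlonglongrightarrow> cscale a x" by (rule bounded_linear.tendsto[OF bounded_linear_cscale X(2)])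
  moreover have "cscale a (X n) \<in> S" for n using assms X(1) by (simp add: complex_subspace_def)
  ultimately show "cscale a x \<in> closure S" unfolding closure_sequential by (intro exI[of _ "\<lambda>n. cscale a (X n)"]) simp
qed

text \<open>Signs appear as complex scalars, so every square has the form
  \<open>z + cscale s w\<close> and the right side is built from the operations of a complex
  subspace.\<close>

lemma polarization:
  fixes z w :: "'a::cstar_algebra"
  shows "cadj z * w = cscale (1/4) ((cadj (z + w) * (z + w) + cscale (- 1) (cadj (z + cscale (- 1) w) * (z + cscale (- 1) w)))
    + (cscale (- \<i>) (cadj (z + cscale \<i> w) * (z + cscale \<i> w)) + cscale \<i> (cadj (z + cscale (- \<i>) w) * (z + cscale (- \<i>) w))))"
proof -
  define a b c d where "a = cadj z * z" and "b = cadj z * w" and "c = cadj w * z" and "d = cadj w * w"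
  have e: "cadj (z + cscale s w) * (z + cscale s w) = a + cscale s b + cscale (cnj s) c + cscale (cnj s * s) d" for s
    by (simp add: a_def b_def c_def d_def cadj_add cadj_cscale distrib_left distrib_right cscale_mult_left
        cscale_mult_right cscale_cscale cscale_add_right algebra_simps)
  have e1: "cadj (z + w) * (z + w) = a + b + c + d" using e[of 1] by simp
  have four: "cscale 4 b = b + b + (b + b)"
    using cscale_add_left[of 2 2 b] cscale_add_left[of 1 1 b] by simp
  have "(cadj (z + w) * (z + w) + cscale (- 1) (cadj (z + cscale (- 1) w) * (z + cscale (- 1) w)))
    + (cscale (- \<i>) (cadj (z + cscale \<i> w) * (z + cscale \<i> w)) + cscale \<i> (cadj (z + cscale (- \<i>) w) * (z + cscale (- \<i>) w)))
    = cscale 4 b"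
    unfolding e e1 four
    by (simp add: cscale_add_right cscale_diff_right cscale_cscale cscale_minus_left)
  then show ?thesis by (simp add: cscale_cscale b_def)
qed

subsection \<open>Cutoffs\<close>

lemma cutoffs_0: "(\<lambda>_. 0) \<in> cutoffs"
  by (auto simp: cutoffs_def)

lemma cutoffs_max:
  assumes "l \<in> cutoffs" "l' \<in> cutoffs"
  shows "(\<lambda>x. max (l x) (l' x)) \<in> cutoffs"
proof -
  obtain K K' where "compact K" "\<forall>x. x \<notin> K \<longrightarrow> l x = 0" "compact K'" "\<forall>x. x \<notin> K' \<longrightarrow> l' x = 0"
    using assms unfolding cutoffs_def by blast
  then have "compact (K \<union> K') \<and> (\<forall>x. x \<notin> K \<union> K' \<longrightarrow> max (l x) (l' x) = 0)"
    by (auto intro: compact_Un)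
  then show ?thesis using assms unfolding cutoffs_def by (auto simp: le_max_iff_disj)
qed

text \<open>Makes the increment of the averages between comparable cutoffs an average again, hence
  positive on positive elements.\<close>

lemma cutoffs_diff:
  assumes "l \<in> cutoffs" "l' \<in> cutoffs" "l' \<le> l"
  shows "(\<lambda>x. l x - l' x) \<in> cutoffs"
proof -
  obtain K where K: "compact K" "\<forall>x. x \<notin> K \<longrightarrow> l x = 0"
    using assms unfolding cutoffs_def by blast
  have b: "0 \<le> l' x" "l' x \<le> l x" "l x \<le> 1" for x
    using assms by (auto simp: cutoffs_def le_fun_def)
  have "l x - l' x = 0" if "x \<notin> K" for x
    using b[of x] K(2) that by (metis diff_self order_antisym)
  moreover have "0 \<le> l x - l' x \<and> l x - l' x \<le> 1" for x using b[of x] by linarith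
  moreover have "(\<lambda>x. l x - l' x) \<in> borel_measurable borel"
    using assms by (auto simp: cutoffs_def)
  ultimately show ?thesis using K(1) unfolding cutoffs_def by blast
qed

lemma eventually_cutoff_filter:
  "eventually P cutoff_filter \<longleftrightarrow> (\<exists>l0\<in>cutoffs. \<forall>l\<in>cutoffs. l0 \<le> l \<longrightarrow> P l)"
proof -
  have "eventually P cutoff_filter \<longleftrightarrow> (\<exists>l0\<in>cutoffs. eventually P (principal {l \<in> cutoffs. l0 \<le> l}))"
    unfolding cutoff_filter_def
  proof (rule eventually_INF_base)
    show "(cutoffs :: ('a \<Rightarrow> real) set) \<noteq> {}" using cutoffs_0 by blast
    fix a b :: "'a \<Rightarrow> real" assume "a \<in> cutoffs" "b \<in> cutoffs"
    then show "\<exists>x\<in>cutoffs. principal {l \<in> cutoffs. x \<le> l}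
        \<le> inf (principal {l \<in> cutoffs. a \<le> l}) (principal {l \<in> cutoffs. b \<le> l})"
      by (intro bexI[OF _ cutoffs_max[of a b]]) (auto simp: le_fun_def)
  qed
  then show ?thesis by (auto simp: eventually_principal)
qed

lemma cutoff_filter_neq_bot: "cutoff_filter \<noteq> bot"
  unfolding trivial_limit_def eventually_cutoff_filter by auto

lemma cutoffs_upper:
  assumes "l \<in> cutoffs" "l' \<in> cutoffs"
  obtains m where "m \<in> cutoffs" "l \<le> m" "l' \<le> m"
  by (rule that[OF cutoffs_max[OF assms]]) (auto simp: le_fun_def)


subsection \<open>Averages over a group action\<close>

text \<open>The positive elements form a closed convex cone, and the integral stays in it.\<close>

lemma has_weak_integral_cnonneg:
  assumes \<mu>: "left_haar_measure \<mu>" and l: "l \<in> cutoffs"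
    and f: "continuous_on UNIV f" "\<And>x. cnonneg (f x)"
    and I: "has_weak_integral \<mu> (\<lambda>x. l x *\<^sub>R f x) I"
  shows "cnonneg I"
proof -
  have "\<exists>I. has_weak_integral \<mu> (\<lambda>x. l x *\<^sub>R f x) I \<and>
    (\<forall>C. closed C \<and> 0 \<in> C \<and> (\<forall>a\<in>C. \<forall>b\<in>C. a + b \<in> C) \<and> (\<forall>r\<ge>0. \<forall>a\<in>C. r *\<^sub>R a \<in> C) \<and> range f \<subseteq> C \<longrightarrow> I \<in> C)"
    by (rule has_weak_integral_cutoff[OF _ _ l f(1)]) (use \<mu> in \<open>auto simp: left_haar_measure_def\<close>)
  then obtain J where J: "has_weak_integral \<mu> (\<lambda>x. l x *\<^sub>R f x) J"
    "\<And>C. closed C \<and> 0 \<in> C \<and> (\<forall>a\<in>C. \<forall>b\<in>C. a + b \<in> C) \<and> (\<forall>r\<ge>0. \<forall>a\<in>C. r *\<^sub>R a \<in> C) \<and> range f \<subseteq> C \<Longrightarrow> J \<in> C"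
    by blast
  have "J \<in> {a. cnonneg a}"
    by (rule J(2)) (use f(2) in \<open>auto simp: closed_cnonneg cnonneg_0 cnonneg_add cnonneg_scaleR\<close>)
  then show ?thesis using has_weak_integral_unique[OF J(1) I] by simp
qed

locale haar_action =
  fixes \<mu> :: "'g::{topological_group_add, t2_space} measure"
    and \<gamma> :: "'g \<Rightarrow> 'a::cstar_algebra \<Rightarrow> 'a"
  assumes haar: "left_haar_measure \<mu>" and action: "cstar_action \<gamma>"
begin

lemma act_add: "\<gamma> x (a + b) = \<gamma> x a + \<gamma> x b"
  and act_cscale: "\<gamma> x (cscale z a) = cscale z (\<gamma> x a)"
  and act_mult: "\<gamma> x (a * b) = \<gamma> x a * \<gamma> x b"
  and act_cadj: "\<gamma> x (cadj a) = cadj (\<gamma> x a)"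
  and act_bij: "bij (\<gamma> x)"
  and act_cont: "continuous_on UNIV (\<lambda>x. \<gamma> x a)"
  using action unfolding cstar_action_def star_aut_def star_hom_def by blast+

lemma act_scaleR: "\<gamma> x (r *\<^sub>R a) = r *\<^sub>R \<gamma> x a"
  using act_cscale[of x "complex_of_real r" a] by (simp add: cscale_of_real)

lemma act_diff: "\<gamma> x (a - b) = \<gamma> x a - \<gamma> x b"
  using act_add[of x "a - b" b] by simp

abbreviation avg :: "('g \<Rightarrow> real) \<Rightarrow> 'a \<Rightarrow> 'a" where
  "avg \<equiv> p_avg \<mu> \<gamma>"

lemma avg_integral:
  assumes "l \<in> cutoffs"
  shows "has_weak_integral \<mu> (\<lambda>x. l x *\<^sub>R \<gamma> x c) (avg l c)"
proof -
  have "\<exists>I. has_weak_integral \<mu> (\<lambda>x. l x *\<^sub>R \<gamma> x c) I \<and>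
    (\<forall>C. closed C \<and> 0 \<in> C \<and> (\<forall>a\<in>C. \<forall>b\<in>C. a + b \<in> C) \<and> (\<forall>r\<ge>0. \<forall>a\<in>C. r *\<^sub>R a \<in> C) \<and> range (\<lambda>x. \<gamma> x c) \<subseteq> C \<longrightarrow> I \<in> C)"
    by (rule has_weak_integral_cutoff[OF _ _ assms act_cont]) (use haar in \<open>auto simp: left_haar_measure_def\<close>)
  then obtain I where "has_weak_integral \<mu> (\<lambda>x. l x *\<^sub>R \<gamma> x c) I" by blast
  then show ?thesis unfolding p_avg_def using weak_integral_eqI by metis
qed

lemma avg_eqI: "has_weak_integral \<mu> (\<lambda>x. l x *\<^sub>R \<gamma> x c) I \<Longrightarrow> avg l c = I"
  unfolding p_avg_def by (rule weak_integral_eqI)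

lemma avg_add: "l \<in> cutoffs \<Longrightarrow> avg l (c + d) = avg l c + avg l d"
  using has_weak_integral_add[OF avg_integral avg_integral, of l l c d]
  by (intro avg_eqI) (simp add: act_add scaleR_add_right)

lemma avg_scaleR: "l \<in> cutoffs \<Longrightarrow> avg l (r *\<^sub>R c) = r *\<^sub>R avg l c"
  using has_weak_integral_linear[OF bounded_linear_scaleR_right[of r] avg_integral, of l c]
  by (intro avg_eqI) (simp add: act_scaleR mult.commute)

lemma avg_cutoff_diff:
  assumes "l \<in> cutoffs" "l' \<in> cutoffs"
  shows "avg (\<lambda>x. l x - l' x) c = avg l c - avg l' c"
  using has_weak_integral_diff[OF avg_integral[OF assms(1)] avg_integral[OF assms(2)], of c c]
  by (intro avg_eqI) (simp add: scaleR_diff_left)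

lemma avg_nonneg:
  assumes "l \<in> cutoffs"
  shows "cnonneg (avg l (cadj w * w))"
proof (rule has_weak_integral_cnonneg[OF haar assms act_cont _ avg_integral[OF assms]])
  fix x show "cnonneg (\<gamma> x (cadj w * w))" by (simp add: act_mult act_cadj cnonneg_star_mult)
qed

lemma avg_form_nonneg: "l \<in> cutoffs \<Longrightarrow> cnonneg (cadj d * avg l (cadj w * w) * d)"
  by (intro cnonneg_compress avg_nonneg)

lemma avg_form_mono:
  assumes "l \<in> cutoffs" "l' \<in> cutoffs" "l' \<le> l"
  shows "norm (cadj d * avg l' (cadj w * w) * d) \<le> norm (cadj d * avg l (cadj w * w) * d)"
proof (rule cnonneg_norm_mono[OF avg_form_nonneg[OF assms(2)]])
  have "cadj d * avg l (cadj w * w) * d - cadj d * avg l' (cadj w * w) * d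
      = cadj d * avg (\<lambda>x. l x - l' x) (cadj w * w) * d"
    by (simp add: avg_cutoff_diff assms algebra_simps)
  then show "cnonneg (cadj d * avg l (cadj w * w) * d - cadj d * avg l' (cadj w * w) * d)"
    using avg_form_nonneg[OF cutoffs_diff[OF assms]] by simp
qed

text \<open>Equivalent to properness of \<open>w\<^sup>* w\<close>, but visibly stable under linear combinations of \<open>w\<close>.\<close>
definition form_proper :: "'a \<Rightarrow> bool" where
  "form_proper w \<longleftrightarrow>
    (\<exists>M\<ge>0. \<forall>l\<in>cutoffs. \<forall>d. norm (cadj d * avg l (cadj w * w) * d) \<le> M * (norm d)\<^sup>2) \<and>
    (\<forall>d. \<forall>e>0. \<exists>l0\<in>cutoffs. \<forall>l\<in>cutoffs. l0 \<le> l \<longrightarrow>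
      norm (cadj d * avg (\<lambda>x. l x - l0 x) (cadj w * w) * d) \<le> e)"

text \<open>Cauchy-Schwarz for the positive element \<open>avg (l - l0) c\<close> bounds
  \<open>(avg l c - avg l0 c) * d\<close> by the forms, so \<open>avg l c * d\<close> is a Cauchy
  net for every \<open>d\<close>.\<close>

lemma form_proper_imp_proper_elem:
  assumes "form_proper w"
  shows "proper_elem \<mu> \<gamma> (cadj w * w)"
proof -
  define c where "c = cadj w * w"
  obtain M where M0: "0 \<le> M" and M: "\<And>l d. l \<in> cutoffs \<Longrightarrow> norm (cadj d * avg l c * d) \<le> M * (norm d)\<^sup>2"
    using assms unfolding form_proper_def c_def by blast
  have nM: "norm (avg l c) \<le> M" if "l \<in> cutoffs" for l
    by (rule cnonneg_norm_le_form_bound[OF _ M0 M[OF that]]) (simp add: c_def avg_nonneg that)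
  have "\<exists>L. ((\<lambda>l. avg l c * d) \<longlongrightarrow> L) cutoff_filter" for d
  proof -
    have "cauchy_filter (filtermap (\<lambda>l. avg l c * d) cutoff_filter)"
      unfolding cauchy_filter_metric_filtermap
    proof (intro allI impI)
      fix e :: real assume e: "0 < e"
      \<comment> \<open>Solves \<open>(M + 1) * e' = (e / 4)^2\<close>, with \<open>M + 1\<close> to
        allow \<open>M = 0\<close>; two distances of at most \<open>e / 4\<close> then stay below
        \<open>e\<close>.\<close>
      define e' where "e' = (e / 4)\<^sup>2 / (M + 1)"
      have e': "0 < e'" using e M0 by (simp add: e'_def)
      obtain l0 where l0: "l0 \<in> cutoffs"
        and *: "\<And>l. l \<in> cutoffs \<Longrightarrow> l0 \<le> l \<Longrightarrow> norm (cadj d * avg (\<lambda>x. l x - l0 x) c * d) \<le> e'"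
        using assms e' unfolding form_proper_def c_def by blast
      have close: "dist (avg l c * d) (avg l0 c * d) \<le> e / 4" if l: "l \<in> cutoffs" "l0 \<le> l" for l
      proof -
        have lc: "(\<lambda>x. l x - l0 x) \<in> cutoffs" by (rule cutoffs_diff[OF l(1) l0 l(2)])
        have "(norm (avg (\<lambda>x. l x - l0 x) c * d))\<^sup>2
            \<le> norm (avg (\<lambda>x. l x - l0 x) c) * norm (cadj d * avg (\<lambda>x. l x - l0 x) c * d)"
          by (rule cnonneg_norm_mult_le) (simp add: c_def avg_nonneg lc)
        also have "\<dots> \<le> M * e'"
          by (rule mult_mono[OF nM[OF lc] *[OF l]]) (simp_all add: M0)
        also have "\<dots> \<le> (M + 1) * e'" using e' by (simp add: algebra_simps)
        also have "\<dots> = (e / 4)\<^sup>2" using M0 by (simp add: e'_def)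
        finally have "norm (avg (\<lambda>x. l x - l0 x) c * d) \<le> e / 4"
          by (rule power2_le_imp_le) (use e in simp)
        then show ?thesis by (simp add: dist_norm avg_cutoff_diff l l0 left_diff_distrib)
      qed
      show "\<exists>P. eventually P cutoff_filter \<and> (\<forall>x y. P x \<and> P y \<longrightarrow> dist (avg x c * d) (avg y c * d) < e)"
      proof (intro exI[of _ "\<lambda>l. dist (avg l c * d) (avg l0 c * d) \<le> e / 4"] conjI allI impI)
        show "\<forall>\<^sub>F l in cutoff_filter. dist (avg l c * d) (avg l0 c * d) \<le> e / 4"
          unfolding eventually_cutoff_filter using l0 close by blast
        fix x y
        assume "dist (avg x c * d) (avg l0 c * d) \<le> e / 4 \<and> dist (avg y c * d) (avg l0 c * d) \<le> e / 4"
        then show "dist (avg x c * d) (avg y c * d) < e"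
          using dist_triangle2[of "avg x c * d" "avg y c * d" "avg l0 c * d"] e by linarith
      qed
    qed
    then show ?thesis
      using cauchy_filter_convergent unfolding convergent_filter_iff filterlim_def by blast
  qed
  then obtain L where L: "\<And>d. ((\<lambda>l. avg l c * d) \<longlongrightarrow> L d) cutoff_filter" by metis
  \<comment> \<open>The averages are selfadjoint, so right multiplication by them is left
    multiplication conjugated by the involution.\<close>
  define m where "m = (L, \<lambda>d. cadj (L (cadj d)))"
  have R: "((\<lambda>l. d * avg l c) \<longlongrightarrow> snd m d) cutoff_filter" for d
  proof -
    have "((\<lambda>l. cadj (avg l c * cadj d)) \<longlongrightarrow> snd m d) cutoff_filter"
      unfolding m_def snd_conv by (rule tendsto_cadj[OF L])
    moreover have "\<forall>\<^sub>F l in cutoff_filter. cadj (avg l c * cadj d) = d * avg l c"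
      unfolding eventually_cutoff_filter
      by (intro bexI[OF _ cutoffs_0])
         (auto simp: cadj_mult cadj_cadj c_def cnonneg_selfadj avg_nonneg)
    ultimately show ?thesis by (rule Lim_transform_eventually)
  qed
  have "double_centralizer m"
    unfolding double_centralizer_def
  proof (intro allI)
    fix x y
    have "((\<lambda>l. x * avg l c * y) \<longlongrightarrow> snd m x * y) cutoff_filter"
      by (intro tendsto_mult R tendsto_const)
    moreover have "((\<lambda>l. x * (avg l c * y)) \<longlongrightarrow> x * L y) cutoff_filter"
      by (intro tendsto_mult L tendsto_const)
    ultimately show "snd m x * y = x * fst m y"
      using tendsto_unique[OF cutoff_filter_neq_bot] by (simp add: m_def mult.assoc)
  qed
  moreover have "strict_tendsto (\<lambda>l. mult_of (avg l c)) m cutoff_filter"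
    unfolding strict_tendsto_def mult_of_def using L R by (simp add: m_def)
  ultimately show ?thesis
    unfolding proper_elem_def cpositive_def c_def by blast
qed

lemma form_proper_0: "form_proper 0"
proof -
  have "avg l 0 = 0" if "l \<in> cutoffs" for l
    using avg_scaleR[OF that, of 0 0] by simp
  then show ?thesis
    unfolding form_proper_def using cutoffs_0 cutoffs_diff
    by (intro conjI allI impI exI[of _ 0] bexI[OF _ cutoffs_0]) auto
qed

text \<open>The parallelogram law: the square of \<open>w - v\<close> is positive, and discarding it
  bounds the form of \<open>w + v\<close> by twice those of \<open>w\<close> and
  \<open>v\<close>.\<close>

lemma form_proper_add:
  assumes w: "form_proper w" and v: "form_proper v"
  shows "form_proper (w + v)"
proof -
  have le: "norm (cadj d * avg l (cadj (w + v) * (w + v)) * d)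
      \<le> 2 * norm (cadj d * avg l (cadj w * w) * d) + 2 * norm (cadj d * avg l (cadj v * v) * d)"
    if l: "l \<in> cutoffs" for l d
  proof -
    have "cadj (w + v) * (w + v) + cadj (w - v) * (w - v) = 2 *\<^sub>R (cadj w * w) + 2 *\<^sub>R (cadj v * v)"
      by (simp add: cadj_add cadj_diff algebra_simps scaleR_2)
    then have "avg l (cadj (w + v) * (w + v)) + avg l (cadj (w - v) * (w - v))
        = 2 *\<^sub>R avg l (cadj w * w) + 2 *\<^sub>R avg l (cadj v * v)"
      by (simp only: avg_add[OF l, symmetric] avg_scaleR[OF l, symmetric])
    then have "cadj d * (avg l (cadj (w + v) * (w + v)) + avg l (cadj (w - v) * (w - v))) * d
        = cadj d * (2 *\<^sub>R avg l (cadj w * w) + 2 *\<^sub>R avg l (cadj v * v)) * d"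
      by simp
    then have eq: "cadj d * avg l (cadj (w + v) * (w + v)) * d + cadj d * avg l (cadj (w - v) * (w - v)) * d
        = 2 *\<^sub>R (cadj d * avg l (cadj w * w) * d) + 2 *\<^sub>R (cadj d * avg l (cadj v * v) * d)"
      by (simp only: distrib_left distrib_right mult_scaleR_left mult_scaleR_right)
    have "norm (cadj d * avg l (cadj (w + v) * (w + v)) * d)
      \<le> norm (cadj d * avg l (cadj (w + v) * (w + v)) * d + cadj d * avg l (cadj (w - v) * (w - v)) * d)"
      by (intro cnonneg_norm_le_add avg_form_nonneg l)
    also have "\<dots> \<le> norm (2 *\<^sub>R (cadj d * avg l (cadj w * w) * d)) + norm (2 *\<^sub>R (cadj d * avg l (cadj v * v) * d))"
      unfolding eq by (rule norm_triangle_ineq)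
    finally show ?thesis by simp
  qed
  obtain M N where M: "0 \<le> M" "\<And>l d. l \<in> cutoffs \<Longrightarrow> norm (cadj d * avg l (cadj w * w) * d) \<le> M * (norm d)\<^sup>2"
    and N: "0 \<le> N" "\<And>l d. l \<in> cutoffs \<Longrightarrow> norm (cadj d * avg l (cadj v * v) * d) \<le> N * (norm d)\<^sup>2"
    using w v unfolding form_proper_def by blast
  show ?thesis
    unfolding form_proper_def
  proof (intro conjI exI[of _ "2 * M + 2 * N"] ballI allI impI)
    show "0 \<le> 2 * M + 2 * N" using M N by simp
    fix l :: "'g \<Rightarrow> real" and d assume l: "l \<in> cutoffs"
    show "norm (cadj d * avg l (cadj (w + v) * (w + v)) * d) \<le> (2 * M + 2 * N) * (norm d)\<^sup>2"
      using le[OF l, of d] M(2)[OF l, of d] N(2)[OF l, of d] unfolding distrib_right by linarith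
  next
    fix d and e :: real assume "0 < e"
    then have e4: "0 < e / 4" by simp
    obtain l1 where l1: "l1 \<in> cutoffs" "\<And>l. l \<in> cutoffs \<Longrightarrow> l1 \<le> l \<Longrightarrow>
        norm (cadj d * avg (\<lambda>x. l x - l1 x) (cadj w * w) * d) \<le> e / 4"
      using w e4 unfolding form_proper_def by blast
    obtain l2 where l2: "l2 \<in> cutoffs" "\<And>l. l \<in> cutoffs \<Longrightarrow> l2 \<le> l \<Longrightarrow>
        norm (cadj d * avg (\<lambda>x. l x - l2 x) (cadj v * v) * d) \<le> e / 4"
      using v e4 unfolding form_proper_def by blast
    \<comment> \<open>A larger starting cutoff only shrinks the remaining increments, so both tail
      estimates hold from \<open>l0\<close> on; the factors \<open>2\<close> use up the two bounds
      \<open>e / 4\<close>.\<close>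
    obtain l0 where l0: "l0 \<in> cutoffs" "l1 \<le> l0" "l2 \<le> l0" using cutoffs_upper[OF l1(1) l2(1)] .
    have "norm (cadj d * avg (\<lambda>x. l x - l0 x) (cadj (w + v) * (w + v)) * d) \<le> e"
      if l: "l \<in> cutoffs" "l0 \<le> l" for l
    proof -
      have le1: "l1 \<le> l" and le2: "l2 \<le> l" using l0 l by auto
      have "norm (cadj d * avg (\<lambda>x. l x - l0 x) (cadj w * w) * d) \<le> norm (cadj d * avg (\<lambda>x. l x - l1 x) (cadj w * w) * d)"
        by (rule avg_form_mono[OF cutoffs_diff[OF l(1) l1(1) le1] cutoffs_diff[OF l(1) l0(1) l(2)]])
           (use l0(2) in \<open>auto simp: le_fun_def\<close>)
      moreover have "norm (cadj d * avg (\<lambda>x. l x - l0 x) (cadj v * v) * d) \<le> norm (cadj d * avg (\<lambda>x. l x - l2 x) (cadj v * v) * d)"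
        by (rule avg_form_mono[OF cutoffs_diff[OF l(1) l2(1) le2] cutoffs_diff[OF l(1) l0(1) l(2)]])
           (use l0(3) in \<open>auto simp: le_fun_def\<close>)
      ultimately show ?thesis
        using le[OF cutoffs_diff[OF l(1) l0(1) l(2)], of d] l1(2)[OF l(1) le1] l2(2)[OF l(1) le2] by linarith
    qed
    then show "\<exists>l0\<in>cutoffs. \<forall>l\<in>cutoffs. l0 \<le> l \<longrightarrow>
        norm (cadj d * avg (\<lambda>x. l x - l0 x) (cadj (w + v) * (w + v)) * d) \<le> e"
      using l0(1) by blast
  qed
qed

lemma form_proper_cscale:
  assumes "form_proper w"
  shows "form_proper (cscale z w)"
proof -
  define t where "t = (cmod z)\<^sup>2"
  have t0: "0 \<le> t" by (simp add: t_def)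
  have "cadj (cscale z w) * cscale z w = cscale (z * cnj z) (cadj w * w)"
    by (simp add: cadj_cscale cscale_mult_left cscale_mult_right cscale_cscale)
  also have "z * cnj z = complex_of_real t" by (simp only: t_def complex_norm_square)
  finally have sq: "cadj (cscale z w) * cscale z w = t *\<^sub>R (cadj w * w)" by (simp only: cscale_of_real)
  have eq: "norm (cadj d * avg l (cadj (cscale z w) * cscale z w) * d) = t * norm (cadj d * avg l (cadj w * w) * d)"
    if l: "l \<in> cutoffs" for l d
    unfolding sq avg_scaleR[OF l] using t0 by simp
  obtain M where M: "0 \<le> M" "\<And>l d. l \<in> cutoffs \<Longrightarrow> norm (cadj d * avg l (cadj w * w) * d) \<le> M * (norm d)\<^sup>2"
    using assms unfolding form_proper_def by blast
  show ?thesis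
    unfolding form_proper_def
  proof (intro conjI exI[of _ "t * M"] ballI allI impI)
    show "0 \<le> t * M" using M t0 by simp
    fix l :: "'g \<Rightarrow> real" and d assume l: "l \<in> cutoffs"
    show "norm (cadj d * avg l (cadj (cscale z w) * cscale z w) * d) \<le> t * M * (norm d)\<^sup>2"
      unfolding eq[OF l] using mult_left_mono[OF M(2)[OF l, of d] t0] by (simp add: mult.assoc)
  next
    fix d and e :: real assume e: "0 < e"
    then have "0 < e / (t + 1)" using t0 by simp
    then obtain l0 where l0: "l0 \<in> cutoffs" "\<And>l. l \<in> cutoffs \<Longrightarrow> l0 \<le> l \<Longrightarrow>
        norm (cadj d * avg (\<lambda>x. l x - l0 x) (cadj w * w) * d) \<le> e / (t + 1)"
      using assms unfolding form_proper_def by blast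
    have "norm (cadj d * avg (\<lambda>x. l x - l0 x) (cadj (cscale z w) * cscale z w) * d) \<le> e"
      if l: "l \<in> cutoffs" "l0 \<le> l" for l
    proof -
      have "t * norm (cadj d * avg (\<lambda>x. l x - l0 x) (cadj w * w) * d) \<le> (t + 1) * (e / (t + 1))"
        by (rule mult_mono[OF _ l0(2)[OF l]]) (use t0 in auto)
      also have "\<dots> = e" using t0 by simp
      finally show ?thesis unfolding eq[OF cutoffs_diff[OF l(1) l0(1) l(2)]] .
    qed
    then show "\<exists>l0\<in>cutoffs. \<forall>l\<in>cutoffs. l0 \<le> l \<longrightarrow>
        norm (cadj d * avg (\<lambda>x. l x - l0 x) (cadj (cscale z w) * cscale z w) * d) \<le> e"
      using l0(1) by blast
  qed
qed

text \<open>Strict convergence bounds each form near the limit, monotonicity extends the bound to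
  all cutoffs, and uniform boundedness of the operators \<open>k l\<close> makes it uniform in
  \<open>d\<close>.\<close>

lemma proper_elem_bounded:
  assumes b: "proper_elem \<mu> \<gamma> (cadj y * y)"
  shows "\<exists>M\<ge>0. \<forall>l\<in>cutoffs. norm (avg l (cadj y * y)) \<le> M"
proof -
  define b where "b = cadj y * y"
  obtain m where m: "strict_tendsto (\<lambda>l. mult_of (avg l b)) m cutoff_filter"
    using assms unfolding proper_elem_def b_def by blast
  have "\<exists>k::'a \<Rightarrow>\<^sub>L 'a. \<forall>d. (norm (k d))\<^sup>2 = norm (cadj d * avg l b * d)" if "l \<in> cutoffs" for l
    using cnonneg_sqrt_op[OF avg_nonneg[OF that, of y]] unfolding b_def by metis
  then obtain k :: "('g \<Rightarrow> real) \<Rightarrow> 'a \<Rightarrow>\<^sub>L 'a"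
    where k: "\<And>l d. l \<in> cutoffs \<Longrightarrow> (norm (k l d))\<^sup>2 = norm (cadj d * avg l b * d)" by metis
  have "\<exists>B. \<forall>l\<in>cutoffs. norm (k l d) \<le> B" for d
  proof -
    have "((\<lambda>l. avg l b * d) \<longlongrightarrow> fst m d) cutoff_filter"
      using m by (simp add: strict_tendsto_def mult_of_def)
    then have "\<forall>\<^sub>F l in cutoff_filter. dist (avg l b * d) (fst m d) < 1" by (rule tendstoD) simp
    then obtain l0 where l0: "l0 \<in> cutoffs"
      and *: "\<And>l. l \<in> cutoffs \<Longrightarrow> l0 \<le> l \<Longrightarrow> dist (avg l b * d) (fst m d) < 1"
      unfolding eventually_cutoff_filter by blast
    define B where "B = norm d * (norm (fst m d) + 1)"
    have "(norm (k l d))\<^sup>2 \<le> B" if l: "l \<in> cutoffs" for l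
    proof -
      \<comment> \<open>The estimate is known only beyond \<open>l0\<close>; a common upper bound
        \<open>n\<close> carries it back to an arbitrary \<open>l\<close>.\<close>
      obtain n where n: "n \<in> cutoffs" "l \<le> n" "l0 \<le> n" using cutoffs_upper[OF l l0] .
      have "norm (avg n b * d) \<le> norm (fst m d) + 1"
        using *[OF n(1,3)] norm_triangle_ineq2[of "avg n b * d" "fst m d"] by (simp add: dist_norm)
      then have "norm (cadj d * (avg n b * d)) \<le> B"
        unfolding B_def by (intro order_trans[OF norm_mult_ineq]) (simp add: mult_left_mono)
      then show ?thesis
        using avg_form_mono[OF n(1) l n(2), of d y] by (simp add: k[OF l] b_def mult.assoc)
    qed
    then have "\<forall>l\<in>cutoffs. norm (k l d) \<le> sqrt B" by (auto intro: real_le_rsqrt)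
    then show ?thesis by blast
  qed
  then obtain M where M: "0 \<le> M" "\<And>l. l \<in> cutoffs \<Longrightarrow> norm (k l) \<le> M"
    using banach_steinhaus[of cutoffs k] by blast
  have "norm (avg l b) \<le> M\<^sup>2" if l: "l \<in> cutoffs" for l
  proof (rule cnonneg_norm_le_form_bound)
    show "cnonneg (avg l b)" using avg_nonneg[OF l] by (simp add: b_def)
    fix d
    have "norm (k l d) \<le> M * norm d"
      by (rule order_trans[OF norm_blinfun mult_right_mono[OF M(2)[OF l]]]) simp
    then have "(norm (k l d))\<^sup>2 \<le> (M * norm d)\<^sup>2" by (intro power_mono) auto
    then show "norm (cadj d * avg l b * d) \<le> M\<^sup>2 * (norm d)\<^sup>2"
      by (simp add: k[OF l] power_mult_distrib)
  qed simp
  then show ?thesis unfolding b_def by (intro exI[of _ "M\<^sup>2"]) simp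
qed

end


subsection \<open>Morphisms\<close>

locale cstar_mor =
  fixes \<theta> :: "'b::cstar_algebra \<Rightarrow> 'a::cstar_algebra mult"
  assumes morphism: "cstar_morphism \<theta>"
begin

abbreviation lact :: "'b \<Rightarrow> 'a \<Rightarrow> 'a" where
  "lact b \<equiv> fst (\<theta> b)"

lemma lact_add: "lact (b + c) x = lact b x + lact c x"
  and lact_cscale: "lact (cscale z b) x = cscale z (lact b x)"
  and lact_mult: "lact (b * c) x = lact b (lact c x)"
  and \<theta>_adj: "\<theta> (cadj b) = mult_adj (\<theta> b)"
  and \<theta>_central: "snd (\<theta> b) x * y = x * lact b y"
  and lact_total: "closure (cspan {lact b x | b x. True}) = UNIV"
  using morphism
  by (auto simp: cstar_morphism_def mult_add_def mult_scale_def mult_mult_def double_centralizer_def)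

lemma lact_adj: "cadj (lact b x) * y = cadj x * lact (cadj b) y"
  using \<theta>_central[of "cadj b" "cadj x" y] by (simp add: \<theta>_adj mult_adj_def cadj_cadj)

lemma snd_\<theta>: "snd (\<theta> b) a = cadj (lact (cadj b) (cadj a))"
  using \<theta>_adj[of "cadj b"] by (simp add: cadj_cadj mult_adj_def)

lemma lact_scaleR: "lact (r *\<^sub>R b) x = r *\<^sub>R lact b x"
  using lact_cscale[of "complex_of_real r" b x] by (simp add: cscale_of_real)

lemma lact_diff: "lact (b - c) x = lact b x - lact c x"
  using lact_add[of "b - c" c x] by simp

lemma cadj_mult_eqI: "(\<And>z. cadj x * z = cadj y * z) \<Longrightarrow> x = (y::'a)"
  using cstar_eqI_right[of "cadj x" "cadj y"] by (metis cadj_cadj)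

text \<open>Linearity is not part of \<open>double_centralizer\<close>; it follows by moving
  \<open>lact b\<close> to the other side as \<open>lact (cadj b)\<close>.\<close>

lemma lact_add_right: "lact b (x + y) = lact b x + lact b y"
  by (rule cadj_mult_eqI) (simp add: lact_adj cadj_add distrib_right)

lemma lact_cscale_right: "lact b (cscale z x) = cscale z (lact b x)"
  by (rule cadj_mult_eqI) (simp add: lact_adj cadj_cscale cscale_mult_left)

lemma lact_0_right: "lact b 0 = 0"
  using lact_add_right[of b 0 0] by simp

lemma lact_diff_right: "lact b (x - y) = lact b x - lact b y"
  using lact_add_right[of b "x - y" y] by simp

text \<open>Writing \<open>b\<^sup>* b / \<parallel>b\<parallel>\<^sup>2 = 2 g - g\<^sup>2\<close> with \<open>g\<close> selfadjoint exhibits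
\<open>d\<^sup>* d - d\<^sup>* \<theta>(b\<^sup>* b) d / \<parallel>b\<parallel>\<^sup>2\<close> as \<open>w\<^sup>* w\<close> for \<open>w = d - \<theta>(g) d\<close>.\<close>
lemma norm_lact_le: "norm (lact b d) \<le> norm b * norm d"
proof (cases "b = 0")
  case True
  then show ?thesis using lact_scaleR[of 0 b d] by simp
next
  case False
  define t where "t = (norm b)\<^sup>2"
  have t: "t > 0" using False by (simp add: t_def)
  define h where "h = (1 / t) *\<^sub>R (cadj b * b)"
  have "norm h \<le> 1" using t by (simp add: h_def cstar_identity t_def)
  moreover have "cadj h = h" by (simp add: h_def cadj_scaleR cadj_mult cadj_cadj)
  ultimately obtain g where g: "g + g - g * g = h" "cadj g = g"
    using selfadj_sqrt_iteration by blast
  define w where "w = d - lact g d"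
  have "cadj w * w = cadj d * d - cadj d * lact (g + g - g * g) d"
    by (simp add: w_def cadj_diff lact_add lact_diff lact_mult left_diff_distrib right_diff_distrib
        distrib_left lact_adj g(2))
  also have "cadj d * lact (g + g - g * g) d = (1 / t) *\<^sub>R (cadj (lact b d) * lact b d)"
    unfolding g(1) by (simp add: h_def lact_scaleR lact_mult lact_adj)
  finally have "cnonneg (cadj d * d - (1 / t) *\<^sub>R (cadj (lact b d) * lact b d))"
    using cnonneg_star_mult[of w] by simp
  moreover have "cnonneg ((1 / t) *\<^sub>R (cadj (lact b d) * lact b d))"
    using t by (intro cnonneg_scaleR cnonneg_star_mult) simp
  ultimately have "norm ((1 / t) *\<^sub>R (cadj (lact b d) * lact b d)) \<le> norm (cadj d * d)"
    by (intro cnonneg_norm_mono)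
  then have "(norm (lact b d))\<^sup>2 \<le> t * (norm d)\<^sup>2"
    using t by (simp add: cstar_identity field_simps)
  then have "(norm (lact b d))\<^sup>2 \<le> (norm b * norm d)\<^sup>2" by (simp add: t_def power_mult_distrib)
  then show ?thesis by (rule power2_le_imp_le) simp
qed

lemma bounded_linear_lact: "bounded_linear (\<lambda>b. lact b d)"
  by (rule bounded_linear_intro[where K = "norm d"])
     (simp_all add: lact_add lact_scaleR norm_lact_le)

end

section \<open>Transfer along an equivariant morphism\<close>

locale equivariant_mor =
  A: haar_action \<mu> \<alpha> + B: haar_action \<mu> \<beta> + cstar_mor \<theta>
  for \<mu> :: "'g::{topological_group_add, t2_space} measure"
    and \<alpha> :: "'g \<Rightarrow> 'a::cstar_algebra \<Rightarrow> 'a"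
    and \<beta> :: "'g \<Rightarrow> 'b::cstar_algebra \<Rightarrow> 'b"
    and \<theta> :: "'b \<Rightarrow> 'a mult" +
  assumes equivariant: "equivariant \<alpha> \<beta> \<theta>"
begin

lemma act_lact: "\<alpha> x (lact b u) = lact (\<beta> x b) (\<alpha> x u)"
proof -
  have "\<theta> (\<beta> x b) = mult_ext (\<alpha> x) (\<theta> b)"
    using equivariant by (simp add: equivariant_def)
  then show ?thesis
    using A.act_bij[of x] by (simp add: mult_ext_def bij_is_inj)
qed

text \<open>For \<open>w = a \<theta>(y)\<close> and \<open>v = \<theta>(\<beta>\<^sub>x(y)) d\<close> the two forms at \<open>x\<close> are \<open>t v\<^sup>* v\<close> and
\<open>v\<^sup>* \<alpha>\<^sub>x(a\<^sup>* a) v\<close>; their difference is a square up to a factor, as in the proof of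
contractivity of \<open>\<theta>\<close>.\<close>
lemma avg_dominated:
  fixes y :: 'b and a d :: 'a
  assumes l: "l \<in> cutoffs" and t: "t = (norm a)\<^sup>2 + 1"
  defines "w \<equiv> snd (\<theta> y) a"
  shows "cnonneg (t *\<^sub>R (cadj d * lact (B.avg l (cadj y * y)) d) - cadj d * A.avg l (cadj w * w) * d)"
proof -
  \<comment> \<open>The summand \<open>1\<close> makes \<open>t\<close> invertible even for
    \<open>a = 0\<close>, while \<open>norm h <= 1\<close> remains true.\<close>
  have t0: "t > 0" using zero_le_power2[of "norm a"] unfolding t by linarith
  define h where "h = (1 / t) *\<^sub>R (cadj a * a)"
  have "norm h \<le> 1" using t0 by (simp add: h_def cstar_identity t)
  moreover have "cadj h = h" by (simp add: h_def cadj_scaleR cadj_mult cadj_cadj)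
  ultimately obtain g where g: "g + g - g * g = h" "cadj g = g"
    using selfadj_sqrt_iteration by blast
  have w: "w * u = a * lact y u" for u by (simp add: w_def \<theta>_central)
  have pointwise: "cnonneg (t *\<^sub>R (cadj d * lact (\<beta> x (cadj y * y)) d) - cadj d * \<alpha> x (cadj w * w) * d)" for x
  proof -
    define v where "v = lact (\<beta> x y) d"
    \<comment> \<open>Pulling \<open>d\<close> back along \<open>\<alpha> x\<close> lets the product
      \<open>w * u\<close> be evaluated before the action is applied; equivariance then moves the
      action past \<open>lact y\<close>.\<close>
    obtain u where u: "d = \<alpha> x u" using A.act_bij[of x] by (metis bij_pointE)
    have wd: "\<alpha> x w * d = \<alpha> x a * v"
      unfolding u v_def by (simp add: A.act_mult[symmetric] w act_lact[symmetric])
    have 1: "cadj d * \<alpha> x (cadj w * w) * d = cadj (\<alpha> x w * d) * (\<alpha> x w * d)"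
      by (simp add: A.act_mult A.act_cadj cadj_mult mult.assoc)
    have 2: "cadj (\<alpha> x w * d) * (\<alpha> x w * d) = cadj v * \<alpha> x (cadj a * a) * v"
      unfolding wd by (simp add: A.act_mult A.act_cadj cadj_mult mult.assoc)
    have 3: "cadj d * lact (\<beta> x (cadj y * y)) d = cadj v * v"
      by (simp add: v_def lact_adj B.act_mult B.act_cadj lact_mult)
    have aa: "cadj a * a = t *\<^sub>R (g + g - g * g)" using t0 by (simp add: g(1) h_def)
    have sa: "cadj (\<alpha> x g) = \<alpha> x g" using A.act_cadj[of x g] by (simp add: g(2))
    \<comment> \<open>The relation \<open>1 - h = (1 - g)^2\<close>, translated by
      \<open>\<alpha> x\<close> and applied to \<open>v\<close>.\<close>
    have "t *\<^sub>R (cadj v * v) - cadj v * \<alpha> x (cadj a * a) * v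
        = t *\<^sub>R (cadj (v - \<alpha> x g * v) * (v - \<alpha> x g * v))"
      unfolding aa A.act_scaleR A.act_diff A.act_add A.act_mult
      by (simp add: cadj_diff cadj_mult sa scaleR_diff_right scaleR_add_right left_diff_distrib
          right_diff_distrib distrib_left distrib_right mult.assoc)
    then show ?thesis
      unfolding 1 2 3 using t0 by (simp add: cnonneg_scaleR cnonneg_star_mult)
  qed
  have lin_B: "bounded_linear (\<lambda>b. t *\<^sub>R (cadj d * lact b d))"
    using bounded_linear_compose[OF bounded_linear_scaleR_right[of t]
        bounded_linear_compose[OF bounded_linear_mult_right[of "cadj d"] bounded_linear_lact[of d]]] .
  have lin_A: "bounded_linear (\<lambda>c. cadj d * c * d)"
    using bounded_linear_compose[OF bounded_linear_mult_left[of d] bounded_linear_mult_right[of "cadj d"]] .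
  show ?thesis
  \<comment> \<open>Both terms are bounded linear images of averages, so their difference is the
    weak integral of the pointwise differences weighted by \<open>l\<close>.\<close>
  proof (rule has_weak_integral_cnonneg[OF A.haar l _ pointwise])
    show "continuous_on UNIV (\<lambda>x. t *\<^sub>R (cadj d * lact (\<beta> x (cadj y * y)) d) - cadj d * \<alpha> x (cadj w * w) * d)"
      by (intro continuous_on_diff bounded_linear.continuous_on[OF lin_B B.act_cont]
          bounded_linear.continuous_on[OF lin_A A.act_cont])
    have "has_weak_integral \<mu> (\<lambda>x. t *\<^sub>R (cadj d * lact (l x *\<^sub>R \<beta> x (cadj y * y)) d) - cadj d * (l x *\<^sub>R \<alpha> x (cadj w * w)) * d)
      (t *\<^sub>R (cadj d * lact (B.avg l (cadj y * y)) d) - cadj d * A.avg l (cadj w * w) * d)"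
      by (intro has_weak_integral_diff has_weak_integral_linear[OF lin_B B.avg_integral[OF l]]
          has_weak_integral_linear[OF lin_A A.avg_integral[OF l]])
    then show "has_weak_integral \<mu> (\<lambda>x. l x *\<^sub>R (t *\<^sub>R (cadj d * lact (\<beta> x (cadj y * y)) d) - cadj d * \<alpha> x (cadj w * w) * d))
      (t *\<^sub>R (cadj d * lact (B.avg l (cadj y * y)) d) - cadj d * A.avg l (cadj w * w) * d)"
      by (simp add: lact_scaleR scaleR_diff_right mult.commute)
  qed
qed

text \<open>On a vector \<open>lact z x\<close> the average acts through
  \<open>B.avg l b * z\<close>, which converges strictly. Such vectors span a dense subspace, and
  the uniform bound on the averages extends the Cauchy property to every \<open>d\<close>.\<close>

lemma lact_avg_cauchy:
  assumes b: "proper_elem \<mu> \<beta> (cadj y * y)"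
  shows "\<forall>e>0. \<exists>l0\<in>cutoffs. \<forall>l\<in>cutoffs. \<forall>l'\<in>cutoffs. l0 \<le> l \<longrightarrow> l0 \<le> l' \<longrightarrow>
    norm (lact (B.avg l (cadj y * y)) d - lact (B.avg l' (cadj y * y)) d) \<le> e"
proof -
  define b where "b = cadj y * y"
  define D where "D = {d. \<forall>e>0. \<exists>l0\<in>cutoffs. \<forall>l\<in>cutoffs. \<forall>l'\<in>cutoffs. l0 \<le> l \<longrightarrow> l0 \<le> l' \<longrightarrow>
    norm (lact (B.avg l b) d - lact (B.avg l' b) d) \<le> e}"
  obtain m where m: "strict_tendsto (\<lambda>l. mult_of (B.avg l b)) m cutoff_filter"
    using assms unfolding proper_elem_def b_def by blast
  obtain M where M: "0 \<le> M" "\<And>l. l \<in> cutoffs \<Longrightarrow> norm (B.avg l b) \<le> M"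
    using B.proper_elem_bounded[OF assms] unfolding b_def by blast
  have "complex_subspace D"
    unfolding complex_subspace_def
  proof (intro conjI ballI allI)
    show "0 \<in> D" using cutoffs_0 by (auto simp: D_def lact_0_right)
  next
    fix x z assume x: "x \<in> D" and z: "z \<in> D"
    show "x + z \<in> D"
      unfolding D_def
    proof (intro CollectI allI impI)
      fix e :: real assume "0 < e"
      then have e2: "0 < e / 2" by simp
      obtain l1 where l1: "l1 \<in> cutoffs" "\<And>l l'. l \<in> cutoffs \<Longrightarrow> l' \<in> cutoffs \<Longrightarrow> l1 \<le> l \<Longrightarrow> l1 \<le> l' \<Longrightarrow>
          norm (lact (B.avg l b) x - lact (B.avg l' b) x) \<le> e / 2"
        using x e2 unfolding D_def by blast
      obtain l2 where l2: "l2 \<in> cutoffs" "\<And>l l'. l \<in> cutoffs \<Longrightarrow> l' \<in> cutoffs \<Longrightarrow> l2 \<le> l \<Longrightarrow> l2 \<le> l' \<Longrightarrow>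
          norm (lact (B.avg l b) z - lact (B.avg l' b) z) \<le> e / 2"
        using z e2 unfolding D_def by blast
      obtain l0 where l0: "l0 \<in> cutoffs" "l1 \<le> l0" "l2 \<le> l0" using cutoffs_upper[OF l1(1) l2(1)] .
      have "norm (lact (B.avg l b) (x + z) - lact (B.avg l' b) (x + z)) \<le> e"
        if l: "l \<in> cutoffs" "l' \<in> cutoffs" "l0 \<le> l" "l0 \<le> l'" for l l'
      proof -
        have "norm (lact (B.avg l b) x - lact (B.avg l' b) x) \<le> e / 2"
          "norm (lact (B.avg l b) z - lact (B.avg l' b) z) \<le> e / 2"
          by (rule l1(2) l2(2); use l l0 order_trans in blast)+
        moreover have "lact (B.avg l b) (x + z) - lact (B.avg l' b) (x + z)
          = (lact (B.avg l b) x - lact (B.avg l' b) x) + (lact (B.avg l b) z - lact (B.avg l' b) z)"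
          by (simp add: lact_add_right)
        ultimately show ?thesis using norm_triangle_ineq by (smt (verit) field_sum_of_halves)
      qed
      then show "\<exists>l0\<in>cutoffs. \<forall>l\<in>cutoffs. \<forall>l'\<in>cutoffs. l0 \<le> l \<longrightarrow> l0 \<le> l' \<longrightarrow>
          norm (lact (B.avg l b) (x + z) - lact (B.avg l' b) (x + z)) \<le> e"
        using l0(1) by blast
    qed
  next
    fix s x assume x: "x \<in> D"
    show "cscale s x \<in> D"
      unfolding D_def
    proof (intro CollectI allI impI)
      fix e :: real assume e: "0 < e"
      define r where "r = cmod s + 1"
      have r: "r > 0" "cmod s \<le> r" by (simp_all add: r_def add_nonneg_pos)
      have "0 < e / r" using e r by simp
      then obtain l1 where l1: "l1 \<in> cutoffs" "\<And>l l'. l \<in> cutoffs \<Longrightarrow> l' \<in> cutoffs \<Longrightarrow> l1 \<le> l \<Longrightarrow> l1 \<le> l' \<Longrightarrow>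
          norm (lact (B.avg l b) x - lact (B.avg l' b) x) \<le> e / r"
        using x unfolding D_def by blast
      have "norm (lact (B.avg l b) (cscale s x) - lact (B.avg l' b) (cscale s x)) \<le> e"
        if l: "l \<in> cutoffs" "l' \<in> cutoffs" "l1 \<le> l" "l1 \<le> l'" for l l'
      proof -
        have "norm (lact (B.avg l b) (cscale s x) - lact (B.avg l' b) (cscale s x))
          = cmod s * norm (lact (B.avg l b) x - lact (B.avg l' b) x)"
          by (simp add: lact_cscale_right cscale_diff_right[symmetric] norm_cscale)
        also have "\<dots> \<le> r * (e / r)"
          by (rule mult_mono[OF r(2) l1(2)[OF l]]) (use r in auto)
        finally show ?thesis using r by simp
      qed
      then show "\<exists>l0\<in>cutoffs. \<forall>l\<in>cutoffs. \<forall>l'\<in>cutoffs. l0 \<le> l \<longrightarrow> l0 \<le> l' \<longrightarrow>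
          norm (lact (B.avg l b) (cscale s x) - lact (B.avg l' b) (cscale s x)) \<le> e"
        using l1(1) by blast
    qed
  qed
  moreover have "{lact z x | z x. True} \<subseteq> D"
  proof clarify
    fix z x
    show "lact z x \<in> D"
      unfolding D_def
    proof (intro CollectI allI impI)
      fix e :: real assume e: "0 < e"
      define r where "r = norm x + 1"
      have r: "r > 0" "norm x \<le> r" by (simp_all add: r_def add_nonneg_pos)
      have lim: "((\<lambda>l. B.avg l b * z) \<longlongrightarrow> fst m z) cutoff_filter"
        using m by (simp add: strict_tendsto_def mult_of_def)
      have "0 < e / r / 2" using e r by simp
      from tendstoD[OF lim this] obtain l0 where l0: "l0 \<in> cutoffs"
        "\<And>l. l \<in> cutoffs \<Longrightarrow> l0 \<le> l \<Longrightarrow> dist (B.avg l b * z) (fst m z) < e / r / 2"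
        unfolding eventually_cutoff_filter by blast
      have "norm (lact (B.avg l b) (lact z x) - lact (B.avg l' b) (lact z x)) \<le> e"
        if l: "l \<in> cutoffs" "l' \<in> cutoffs" "l0 \<le> l" "l0 \<le> l'" for l l'
      proof -
        have d: "norm (B.avg l b * z - B.avg l' b * z) \<le> e / r"
          using dist_triangle_half_l[OF l0(2)[OF l(1,3)] l0(2)[OF l(2,4)]] by (simp add: dist_norm)
        have "norm (lact (B.avg l b) (lact z x) - lact (B.avg l' b) (lact z x))
          = norm (lact (B.avg l b * z - B.avg l' b * z) x)"
          by (simp add: lact_mult lact_diff)
        also have "\<dots> \<le> e / r * r"
          by (rule order_trans[OF norm_lact_le mult_mono[OF d r(2)]]) (use e r in auto)
        finally show ?thesis using r by simp
      qed
      then show "\<exists>l0\<in>cutoffs. \<forall>l\<in>cutoffs. \<forall>l'\<in>cutoffs. l0 \<le> l \<longrightarrow> l0 \<le> l' \<longrightarrow>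
          norm (lact (B.avg l b) (lact z x) - lact (B.avg l' b) (lact z x)) \<le> e"
        using l0(1) by blast
    qed
  qed
  ultimately have "cspan {lact z x | z x. True} \<subseteq> D" by (rule cspan_least)
  then have "closure D = UNIV"
    using closure_mono lact_total by (metis top.extremum_unique)
  have "d \<in> D"
    unfolding D_def
  proof (intro CollectI allI impI)
    fix e :: real assume e: "0 < e"
    have "0 < e / (4 * (M + 1))" using e M(1) by simp
    moreover have "d \<in> closure D" using \<open>closure D = UNIV\<close> by simp
    ultimately obtain c where c: "c \<in> D" "dist c d < e / (4 * (M + 1))"
      unfolding closure_approachable by blast
    \<comment> \<open>Two such errors and the bound \<open>e / 2\<close> for \<open>c\<close> add up
      to \<open>e\<close>; \<open>M + 1\<close> keeps the divisor positive.\<close>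
    have small: "norm (lact (B.avg l b) (d - c)) \<le> e / 4" if "l \<in> cutoffs" for l
    proof -
      have "norm (lact (B.avg l b) (d - c)) \<le> (M + 1) * (e / (4 * (M + 1)))"
      proof (rule order_trans[OF norm_lact_le mult_mono])
        show "norm (B.avg l b) \<le> M + 1" using M(2)[OF that] by simp
        show "norm (d - c) \<le> e / (4 * (M + 1))" using c(2) by (simp add: dist_norm norm_minus_commute)
      qed (use M in auto)
      also have "\<dots> = e / 4"
      proof -
        have "M + 1 \<noteq> 0" using M(1) by simp
        from nonzero_mult_divide_mult_cancel_left[OF this, of e 4] show ?thesis
          by (simp only: times_divide_eq_right mult.commute[of 4])
      qed
      finally show ?thesis .
    qed
    obtain l0 where l0: "l0 \<in> cutoffs" "\<And>l l'. l \<in> cutoffs \<Longrightarrow> l' \<in> cutoffs \<Longrightarrow> l0 \<le> l \<Longrightarrow> l0 \<le> l' \<Longrightarrow>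
        norm (lact (B.avg l b) c - lact (B.avg l' b) c) \<le> e / 2"
      using c(1) half_gt_zero[OF e] unfolding D_def by blast
    have "norm (lact (B.avg l b) d - lact (B.avg l' b) d) \<le> e"
      if l: "l \<in> cutoffs" "l' \<in> cutoffs" "l0 \<le> l" "l0 \<le> l'" for l l'
    proof -
      have "lact (B.avg l b) d - lact (B.avg l' b) d
        = (lact (B.avg l b) (d - c) - lact (B.avg l' b) (d - c)) + (lact (B.avg l b) c - lact (B.avg l' b) c)"
        by (simp add: lact_diff_right)
      also have "norm \<dots> \<le> norm (lact (B.avg l b) (d - c) - lact (B.avg l' b) (d - c)) + norm (lact (B.avg l b) c - lact (B.avg l' b) c)"
        by (rule norm_triangle_ineq)
      also have "norm (lact (B.avg l b) (d - c) - lact (B.avg l' b) (d - c))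
          \<le> norm (lact (B.avg l b) (d - c)) + norm (lact (B.avg l' b) (d - c))"
        by (rule norm_triangle_ineq4)
      finally show ?thesis using small[OF l(1)] small[OF l(2)] l0(2)[OF l] by linarith
    qed
    then show "\<exists>l0\<in>cutoffs. \<forall>l\<in>cutoffs. \<forall>l'\<in>cutoffs. l0 \<le> l \<longrightarrow> l0 \<le> l' \<longrightarrow>
        norm (lact (B.avg l b) d - lact (B.avg l' b) d) \<le> e"
      using l0(1) by blast
  qed
  then show ?thesis by (simp add: D_def b_def)
qed

text \<open>Domination bounds the form of \<open>w\<close> at \<open>d\<close> by
  \<open>t * (norm d * norm (lact (B.avg l b) d))\<close>. Averages over \<open>l - l0\<close> are
  differences of averages, so boundedness and the Cauchy property downstairs give both
  conditions.\<close>

lemma form_proper_snd_\<theta>: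
  assumes b: "proper_elem \<mu> \<beta> (cadj y * y)"
  shows "A.form_proper (snd (\<theta> y) a)"
proof -
  define b where "b = cadj y * y"
  define w where "w = snd (\<theta> y) a"
  define t where "t = (norm a)\<^sup>2 + 1"
  have t0: "t > 0" using zero_le_power2[of "norm a"] unfolding t_def by linarith
  obtain M where M: "0 \<le> M" "\<And>l. l \<in> cutoffs \<Longrightarrow> norm (B.avg l b) \<le> M"
    using B.proper_elem_bounded[OF assms] unfolding b_def by blast
  have le: "norm (cadj d * A.avg l (cadj w * w) * d) \<le> t * (norm d * norm (lact (B.avg l b) d))"
    if l: "l \<in> cutoffs" for l d
  proof -
    have "norm (cadj d * A.avg l (cadj w * w) * d) \<le> norm (t *\<^sub>R (cadj d * lact (B.avg l b) d))"
      unfolding b_def w_def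
      by (intro cnonneg_norm_mono A.avg_form_nonneg[OF l] avg_dominated[OF l t_def])
    also have "\<dots> \<le> t * (norm d * norm (lact (B.avg l b) d))"
      using t0 norm_mult_ineq[of "cadj d" "lact (B.avg l b) d"] by simp
    finally show ?thesis .
  qed
  show ?thesis
    unfolding A.form_proper_def w_def[symmetric]
  proof (intro conjI exI[of _ "t * M"] ballI allI impI)
    show "0 \<le> t * M" using M t0 by simp
    fix l :: "'g \<Rightarrow> real" and d assume l: "l \<in> cutoffs"
    have "norm (lact (B.avg l b) d) \<le> M * norm d"
      by (rule order_trans[OF norm_lact_le mult_right_mono[OF M(2)[OF l]]]) simp
    then have "t * (norm d * norm (lact (B.avg l b) d)) \<le> t * (norm d * (M * norm d))"
      using t0 by (intro mult_left_mono) auto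
    then show "norm (cadj d * A.avg l (cadj w * w) * d) \<le> t * M * (norm d)\<^sup>2"
      using le[OF l, of d] by (simp add: power2_eq_square mult_ac)
  next
    fix d :: 'a and e :: real assume e: "0 < e"
    define r where "r = t * norm d + 1"
    have r: "r > 0" "t * norm d \<le> r" using t0 by (simp_all add: r_def add_nonneg_pos)
    have "0 < e / r" using e r by simp
    then obtain l0 where l0: "l0 \<in> cutoffs" "\<And>l l'. l \<in> cutoffs \<Longrightarrow> l' \<in> cutoffs \<Longrightarrow> l0 \<le> l \<Longrightarrow> l0 \<le> l' \<Longrightarrow>
        norm (lact (B.avg l b) d - lact (B.avg l' b) d) \<le> e / r"
      using lact_avg_cauchy[OF assms, of d] unfolding b_def by blast
    have "norm (cadj d * A.avg (\<lambda>x. l x - l0 x) (cadj w * w) * d) \<le> e"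
      if l: "l \<in> cutoffs" "l0 \<le> l" for l
    proof -
      have "norm (cadj d * A.avg (\<lambda>x. l x - l0 x) (cadj w * w) * d)
          \<le> t * (norm d * norm (lact (B.avg (\<lambda>x. l x - l0 x) b) d))"
        by (rule le[OF cutoffs_diff[OF l(1) l0(1) l(2)]])
      also have "\<dots> = (t * norm d) * norm (lact (B.avg l b) d - lact (B.avg l0 b) d)"
        by (simp add: B.avg_cutoff_diff l l0 lact_diff)
      also have "\<dots> \<le> r * (e / r)"
        by (rule mult_mono[OF r(2) l0(2)[OF l(1) l0(1) l(2) order_refl]]) (use r in auto)
      finally show ?thesis using r by simp
    qed
    then show "\<exists>l0\<in>cutoffs. \<forall>l\<in>cutoffs. l0 \<le> l \<longrightarrow>
        norm (cadj d * A.avg (\<lambda>x. l x - l0 x) (cadj w * w) * d) \<le> e"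
      using l0(1) by blast
  qed
qed

text \<open>Density of \<open>\<theta>(B) A\<close> concerns left actions, whereas the available
  elements \<open>a \<theta>(y)\<close> are right actions; hence the passage to adjoints in
  \<open>S\<close>.\<close>

lemma closure_form_proper:
  assumes "proper_action \<mu> \<beta>"
  shows "closure {w. A.form_proper w} = UNIV"
proof -
  define S where "S = {z. A.form_proper (cadj z)}"
  have "complex_subspace S"
    unfolding complex_subspace_def S_def
    by (auto simp: A.form_proper_0 cadj_add A.form_proper_add cadj_cscale A.form_proper_cscale)
  then have sub: "complex_subspace (closure S)" by (rule complex_subspace_closure)
  have "lact b x \<in> closure S" for b x
  proof -
    define E where "E = {b. lact b x \<in> closure S}"
    have "complex_subspace E"
      using sub lact_scaleR[of 0 0 x] by (simp add: complex_subspace_def E_def lact_add lact_cscale)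
    moreover have "{c. proper_elem \<mu> \<beta> c} \<subseteq> E"
    proof
      fix c assume "c \<in> {c. proper_elem \<mu> \<beta> c}"
      then obtain y where y: "c = cadj y * y" "proper_elem \<mu> \<beta> (cadj y * y)"
        unfolding proper_elem_def cpositive_def by blast
      \<comment> \<open>Splitting \<open>c = cadj y * y\<close>, the adjoint of
        \<open>lact c x\<close> is the right action of \<open>y\<close> on
        \<open>cadj (lact y x)\<close>.\<close>
      have "lact c x \<in> S"
        using form_proper_snd_\<theta>[OF y(2), of "cadj (lact y x)"]
        by (simp add: S_def y(1) lact_mult snd_\<theta> cadj_cadj)
      then show "c \<in> E" using closure_subset by (auto simp: E_def)
    qed
    ultimately have "cspan {c. proper_elem \<mu> \<beta> c} \<subseteq> E" by (rule cspan_least)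
    moreover have "closed E"
      unfolding E_def
      using continuous_closed_vimage[OF closed_closure[of S], of "\<lambda>b. lact b x"]
        linear_continuous_at[OF bounded_linear_lact[of x]] by (simp add: vimage_def)
    ultimately have "closure (cspan {c. proper_elem \<mu> \<beta> c}) \<subseteq> E" by (rule closure_minimal)
    then show ?thesis using assms by (auto simp: proper_action_def E_def)
  qed
  then have "cspan {lact b x | b x. True} \<subseteq> closure S" by (intro cspan_least[OF sub]) auto
  then have "closure (cspan {lact b x | b x. True}) \<subseteq> closure S" by (rule closure_minimal) simp
  then have S: "closure S = UNIV" using lact_total by auto
  show ?thesis
  proof (intro equalityI subsetI UNIV_I)
    fix z
    have "cadj z \<in> closure S" using S by simp
    then obtain X where X: "\<And>n. X n \<in> S" "X \<longlonglongrightarrow> cadj z" unfolding closure_sequential by blast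
    have "(\<lambda>n. cadj (X n)) \<longlonglongrightarrow> z" using tendsto_cadj[OF X(2)] by (simp add: cadj_cadj)
    moreover have "cadj (X n) \<in> {w. A.form_proper w}" for n using X(1)[of n] by (simp add: S_def)
    ultimately show "z \<in> closure {w. A.form_proper w}" unfolding closure_sequential by (intro exI[of _ "\<lambda>n. cadj (X n)"]) simp
  qed
qed

lemma proper_transfer:
  assumes "proper_action \<mu> \<beta>"
  shows "proper_action \<mu> \<alpha>"
proof -
  define E where "E = cspan {c. proper_elem \<mu> \<alpha> c}"
  have E: "complex_subspace E" unfolding E_def by (rule complex_subspace_cspan)
  have square: "cadj w * w \<in> E" if "A.form_proper w" for w
    using A.form_proper_imp_proper_elem[OF that] cspan_superset unfolding E_def by blast
  have prod: "cadj z * w \<in> E" if "A.form_proper z" "A.form_proper w" for z w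
  proof -
    \<comment> \<open>Covers the polarization terms with \<open>s\<close> equal to
      \<open>-1\<close>, \<open>\<i>\<close> and \<open>-\<i>\<close>.\<close>
    have "cadj (z + cscale s w) * (z + cscale s w) \<in> E" for s
      by (intro square A.form_proper_add A.form_proper_cscale that)
    moreover have "cadj (z + w) * (z + w) \<in> E" by (intro square A.form_proper_add that)
    ultimately show ?thesis
      unfolding polarization[of z w] using E by (simp add: complex_subspace_def)
  qed
  have dense: "\<exists>X. (\<forall>n. A.form_proper (X n)) \<and> X \<longlonglongrightarrow> z" for z
    using closure_form_proper[OF assms] closure_sequential[of z "{w. A.form_proper w}"] by auto
  have "x * y \<in> closure E" for x y
  proof -
    obtain X Y where X: "\<And>n. A.form_proper (X n)" "X \<longlonglongrightarrow> cadj x"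
      and Y: "\<And>n. A.form_proper (Y n)" "Y \<longlonglongrightarrow> y" using dense by metis
    have "(\<lambda>n. cadj (X n) * Y n) \<longlonglongrightarrow> x * y"
      using tendsto_mult[OF tendsto_cadj[OF X(2)] Y(2)] by (simp add: cadj_cadj)
    then show ?thesis
      unfolding closure_sequential using prod X(1) Y(1) by (intro exI[of _ "\<lambda>n. cadj (X n) * Y n"]) simp
  qed
  \<comment> \<open>Every \<open>u * x\<close> already lies in the closure, so approximate left
    units place \<open>x\<close> there as well.\<close>
  moreover have "\<exists>u. dist (u * x) x < e" if "0 < e" for x :: 'a and e
    using approx_left_unit[OF that, of x] by (simp add: dist_norm norm_minus_commute)
  ultimately have "x \<in> closure (closure E)" for x
    unfolding closure_approachable[of x "closure E"] by blast
  then show ?thesis unfolding proper_action_def E_def[symmetric] by auto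
qed

end

theorem theorem5p3:
  fixes \<mu> :: "'g::{topological_group_add, t2_space} measure"
    and \<alpha> :: "'g \<Rightarrow> 'a::cstar_algebra \<Rightarrow> 'a"
    and \<beta> :: "'g \<Rightarrow> 'b::cstar_algebra \<Rightarrow> 'b"
    and \<theta> :: "'b \<Rightarrow> 'a mult"
  assumes "locally_compact_space (euclidean :: 'g topology)"
    and "left_haar_measure \<mu>"
    and "cstar_action \<alpha>"
    and "cstar_action \<beta>"
    and "proper_action \<mu> \<beta>"
    and "cstar_morphism \<theta>"
    and "equivariant \<alpha> \<beta> \<theta>"
  shows "proper_action \<mu> \<alpha>"
proof -
  interpret equivariant_mor \<mu> \<alpha> \<beta> \<theta>
    by unfold_locales (use assms in auto)
  show ?thesis using assms(5) by (rule proper_transfer)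
qed

end
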